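(* Let $J$ be an $\omega_0$-compatible complex structure on $\mathbb{R}^{2n}$ and $W:\mathbb{R}\to\mathrm{Sp}(2n)$, $W(t)=e^{tJ}$. Then $W$ has a conjugate instant at $T>0$ if and only if $T\in\pi\mathbb{N}$, and each such conjugate instant has multiplicity $n^2+n$. For every $T>0$ the timelike geodesic segment $W|_{[0,T]}$ has finite Morse co-index, equal to the sum of the multiplicities of the conjugate instants in $(0,T)$, i.e. $$\mathrm{co\text{-}ind}\,W|_{[0,T]}=\left(\Big\lceil\frac{T}{\pi}\Big\rceil-1\right)(n^2+n).$$
   Context: $\omega_0=\sum_j\mathrm{d}x_j\wedge\mathrm{d}y_j$ on $\mathbb{R}^{2n}$; $\mathrm{Sp}(2n)$ and its Lie algebra $\mathrm{sp}(2n)=\{X:(u,v)\mapsto\omega_0(u,Xv)\text{ symmetric}\}$; $\mathrm{sp}^+(2n)$ those $X$ for which this form is positive definite; $G(X)=(\det X)^{1/(2n)}$ on $\mathrm{sp}^+(2n)$. A complex structure $J$ is $\omega_0$-compatible if $(u,v)\mapsto\omega_0(u,Jv)$ is symmetric positive definite. For a timelike curve $W$ (i.e. $W'W^{-1}\in\mathrm{sp}^+(2n)$), $\mathrm{length}_G(W)=\int G(W'W^{-1})\,\mathrm{d}t$. For the geodesic $W(t)=e^{tX}$ with $X\in\mathrm{sp}^+(2n)$: a Jacobi field is a solution $Y:\mathbb{R}\to\mathrm{sp}(2n)$ of $Y''=[X,Y']=XY'-Y'X$; $t^*>0$ is a conjugate instant if there is a nonzero Jacobi field with $Y(0)=Y(t^*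 )=0$, and its multiplicity is the dimension of the space of such Jacobi fields. The Morse co-index of $W|_{[0,T]}$ is the maximal dimension of a linear space of curves $Y:[0,T]\to\mathrm{sp}(2n)$ (of Sobolev class $H^1$) vanishing at $0$ and $T$ on which the second variation $Y\mapsto\frac{\mathrm{d}^2}{\mathrm{d}s^2}\big|_{s=0}\mathrm{length}_G(e^{sY(\cdot)}W(\cdot)|_{[0,T]})$ (extended by continuity) is positive definite. *)

theory Defs
  imports "HOL-Analysis.Analysis" "HOL-Library.Function_Algebras"
begin

text \<open>Phase space R^(2n) is modelled as real^('n + 'n), where n = CARD('n);
  the coordinate Inl j is x_j and Inr j is y_j.  Matrices are real^('n+'n)^('n+'n).\<close>

type_synonym 'n pvec = "real ^ ('n + 'n)"
type_synonym 'n pmat = "real ^ ('n + 'n) ^ ('n + 'n)"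

definition omega0 :: "'n::finite pvec \<Rightarrow> 'n pvec \<Rightarrow> real" where
  "omega0 u v = (\<Sum>j\<in>UNIV. u $ Inl j * v $ Inr j - u $ Inr j * v $ Inl j)"

definition in_sp :: "'n::finite pmat \<Rightarrow> bool" where
  "in_sp X \<longleftrightarrow> (\<forall>u v. omega0 u (X *v v) = omega0 v (X *v u))"

definition in_sp_plus :: "'n::finite pmat \<Rightarrow> bool" where
  "in_sp_plus X \<longleftrightarrow> in_sp X \<and> (\<forall>u. u \<noteq> 0 \<longrightarrow> omega0 u (X *v u) > 0)"

definition compatible_cs :: "'n::finite pmat \<Rightarrow> bool" where
  "compatible_cs J \<longleftrightarrow> J ** J = - mat 1
     \<and> (\<forall>u v. omega0 u (J *v v) = omega0 v (J *v u))
     \<and> (\<forall>u. u \<noteq> 0 \<longrightarrow> omega0 u (J *v u) > 0)"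

fun matpow :: "'n::finite pmat \<Rightarrow> nat \<Rightarrow> 'n pmat" where
  "matpow X 0 = mat 1"
| "matpow X (Suc k) = X ** matpow X k"

definition mexp :: "'n::finite pmat \<Rightarrow> 'n pmat" where
  "mexp X = (\<Sum>k. (1 / fact k) *\<^sub>R matpow X k)"

definition G :: "'n::finite pmat \<Rightarrow> real" where
  "G X = det X powr (1 / (2 * real CARD('n)))"

definition length_G :: "real \<Rightarrow> (real \<Rightarrow> 'n::finite pmat) \<Rightarrow> real" where
  "length_G T V = integral {0..T} (\<lambda>t. G (vector_derivative V (at t) ** matrix_inv (V t)))"

text \<open>Jacobi fields along t \<mapsto> exp(tX).\<close>
definition jacobi_field :: "'n::finite pmat \<Rightarrow> (real \<Rightarrow> 'n pmat) \<Rightarrow> bool" where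
  "jacobi_field X Y \<longleftrightarrow> (\<exists>Y1 Y2. \<forall>t. in_sp (Y t)
      \<and> (Y has_vector_derivative Y1 t) (at t)
      \<and> (Y1 has_vector_derivative Y2 t) (at t)
      \<and> Y2 t = X ** Y1 t - Y1 t ** X)"

definition fscale :: "real \<Rightarrow> (real \<Rightarrow> 'n::finite pmat) \<Rightarrow> (real \<Rightarrow> 'n pmat)" where
  "fscale c f = (\<lambda>t. c *\<^sub>R f t)"

definition conj_fields :: "'n::finite pmat \<Rightarrow> real \<Rightarrow> (real \<Rightarrow> 'n pmat) set" where
  "conj_fields X T = {Y. jacobi_field X Y \<and> Y 0 = 0 \<and> Y T = 0}"

definition conjugate_instant :: "'n::finite pmat \<Rightarrow> real \<Rightarrow> bool" where
  "conjugate_instant X T \<longleftrightarrow> T > 0 \<and> (\<exists>Y\<in>conj_fields X T. Y \<noteq> 0)"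

definition conj_multiplicity :: "'n::finite pmat \<Rightarrow> real \<Rightarrow> nat" where
  "conj_multiplicity X T = vector_space.dim fscale (conj_fields X T)"

definition smooth_curve :: "(real \<Rightarrow> 'n::finite pmat) \<Rightarrow> bool" where
  "smooth_curve Y \<longleftrightarrow> (\<exists>D. D 0 = Y \<and> (\<forall>k t. (D k has_vector_derivative D (Suc k) t) (at t)))"

definition h1_deriv :: "real \<Rightarrow> (real \<Rightarrow> 'n::finite pmat) \<Rightarrow> (real \<Rightarrow> 'n pmat) \<Rightarrow> bool" where
  "h1_deriv T Y Z \<longleftrightarrow> Z absolutely_integrable_on {0..T}
     \<and> (\<lambda>t. (norm (Z t))\<^sup>2) integrable_on {0..T}
     \<and> (\<forall>t\<in>{0..T}. Y t = Y 0 + integral {0..t} Z)"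

definition H1_0_sp :: "real \<Rightarrow> (real \<Rightarrow> 'n::finite pmat) set" where
  "H1_0_sp T = {Y. (\<exists>Z. h1_deriv T Y Z) \<and> Y 0 = 0 \<and> Y T = 0
       \<and> (\<forall>t\<in>{0..T}. in_sp (Y t)) \<and> (\<forall>t. t \<notin> {0..T} \<longrightarrow> Y t = 0)}"

definition h1_conv :: "real \<Rightarrow> (nat \<Rightarrow> real \<Rightarrow> 'n::finite pmat) \<Rightarrow> (real \<Rightarrow> 'n pmat) \<Rightarrow> bool" where
  "h1_conv T Ys Y \<longleftrightarrow> (\<exists>Zs Z. (\<forall>k. h1_deriv T (Ys k) (Zs k)) \<and> h1_deriv T Y Z
      \<and> (\<lambda>k. Ys k 0) \<longlonglongrightarrow> Y 0
      \<and> (\<lambda>k. integral {0..T} (\<lambda>t. (norm (Zs k t - Z t))\<^sup>2)) \<longlonglongrightarrow> 0)"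

definition smooth_var :: "real \<Rightarrow> (real \<Rightarrow> 'n::finite pmat) \<Rightarrow> bool" where
  "smooth_var T Y \<longleftrightarrow> smooth_curve Y \<and> Y 0 = 0 \<and> Y T = 0 \<and> (\<forall>t\<in>{0..T}. in_sp (Y t))"

definition second_var :: "'n::finite pmat \<Rightarrow> real \<Rightarrow> (real \<Rightarrow> 'n pmat) \<Rightarrow> real" where
  "second_var X T Y = deriv (deriv (\<lambda>s. length_G T (\<lambda>t. mexp (s *\<^sub>R Y t) ** mexp (t *\<^sub>R X)))) 0"

definition second_var_ext :: "'n::finite pmat \<Rightarrow> real \<Rightarrow> (real \<Rightarrow> 'n pmat) \<Rightarrow> real" where
  "second_var_ext X T Y = (THE L. \<forall>Ys. (\<forall>k. smooth_var T (Ys k)) \<and> h1_conv T Ys Y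
       \<longrightarrow> (\<lambda>k. second_var X T (Ys k)) \<longlonglongrightarrow> L)"

definition coindex_dims :: "'n::finite pmat \<Rightarrow> real \<Rightarrow> nat set" where
  "coindex_dims X T = {vector_space.dim fscale S | S B. finite B \<and> S = module.span fscale B
       \<and> S \<subseteq> H1_0_sp T \<and> (\<forall>Y\<in>S. Y \<noteq> 0 \<longrightarrow> second_var_ext X T Y > 0)}"

end

theory Submission
  imports Defs
begin

text \<open>
  For \<open>V = e\<^bsup>sY\<^esup> e\<^bsup>tJ\<^esup>\<close>, conjugation by \<open>e\<^bsup>sY\<^esup>\<close> and Duhamel's formula give
  \<open>det (V' V\<^sup>-\<^sup>1) = det (1 - J U)\<close> with \<open>U(s,t)\<close> the integral of \<open>e\<^bsup>-rY\<^esup> Y' e\<^bsup>rY\<^esup>\<close> over \<open>0 \<le> r \<le> s\<close>.  With \<open>m = 2n\<close>,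
  the second variation is therefore the integral over \<open>[0,T]\<close> of
  \<open>(tr (J [Y,Y']) - tr (J Y' J Y')) / m + (tr (J Y'))\<^sup>2 / m\<^sup>2\<close>.

  Split \<open>Y = C + D\<close> into the parts commuting and anticommuting with \<open>J\<close>.  The \<open>C\<close>-part contributes
  a nonpositive amount by the Cauchy-Schwarz inequality; the \<open>D\<close>-part contributes
  \<open>(- tr (D' D') + 2 tr (J D D')) / m\<close>, which for \<open>D = e\<^bsup>tJ\<^esup> E\<close> is \<open>(tr (E E) - tr (E' E')) / m\<close>.  The
  anticommuting part of \<open>sp(2n)\<close> has dimension \<open>n\<^sup>2 + n\<close>, and \<open>tr (E E)\<close> is a positive definite form on it.

  The functions \<open>E = sin (k \<pi> t / T) F\<close> with \<open>k \<pi> < T\<close> span a space on which the form is positive.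
  Conversely, cut \<open>[0,T]\<close> into \<open>\<lceil>T/\<pi>\<rceil>\<close> intervals of length at most \<open>\<pi>\<close>; if \<open>D\<close> vanishes at the
  interior division points, a Riccati (Wirtinger) argument on each interval shows that the form is nonpositive.
  This is a condition of codimension \<open>(\<lceil>T/\<pi>\<rceil> - 1)(n\<^sup>2 + n)\<close>.
\<close>

text \<open>\<open>second_var_ext\<close> is a definite description of a limit over smooth
  variations, so it carries no information until the limit is shown to exist along every
  approximating sequence and such a sequence is shown to exist. The first is continuity in
  \<open>L2\<close> of a bounded bilinear form on pairs \<open>(Y, Z)\<close>, together with
  uniqueness of weak derivatives up to null sets. The second is density of polynomials, after
  projecting onto sp(2n).

  The Riccati argument differentiates pointwise and is therefore run on the smooth approximants.
  Their anticommuting parts need not vanish at the division points; they only tend to zero there, so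
  boundary terms must be carried along. On an interval of length exactly pi the natural comparison
  function tan(t - midpoint) is infinite at both ends and would multiply these small terms by
  infinity. It is replaced by c tan(c (t - midpoint)) with 0 < c < 1, at the cost of an error (1 -
  c^2) times the integral of tr(D D). The limit over the approximants is taken first, the limit c ->
  1 afterwards.\<close>

interpretation matmul: bounded_bilinear
  "(**) :: real ^ 'a::finite ^ 'b::finite \<Rightarrow> real ^ 'c::finite ^ 'a \<Rightarrow> real ^ 'c ^ 'b"
proof -
  have "bilinear ((**) :: real ^ 'a ^ 'b \<Rightarrow> real ^ 'c ^ 'a \<Rightarrow> real ^ 'c ^ 'b)"
    unfolding bilinear_def
    by (auto intro!: linearI simp: matrix_matrix_mult_def vec_eq_iff sum.distrib sum_distrib_left algebra_simps)
  then show "bounded_bilinear ((**) :: real ^ 'a ^ 'b \<Rightarrow> real ^ 'c ^ 'a \<Rightarrow> real ^ 'c ^ 'b)"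
    by (simp add: bilinear_conv_bounded_bilinear)
qed

lemmas matrix_distribs = matmul.add_left matmul.add_right matmul.diff_left matmul.diff_right
  matmul.minus_left matmul.minus_right matmul.scaleR_left matmul.scaleR_right
lemmas matmul_has_vector_derivative = bounded_bilinear.has_vector_derivative
  [OF matmul.bounded_bilinear_axioms]

subsection \<open>The matrix exponential\<close>

lemma matpow_commute: "matpow M k ** M = M ** matpow M k"
  by (induction k) (simp_all flip: matrix_mul_assoc)

lemma matpow_scaleR: "matpow (s *\<^sub>R M) k = s ^ k *\<^sub>R matpow M k"
  by (induction k) (simp_all add: matmul.scaleR_left matmul.scaleR_right)

text \<open>Submultiplicativity holds for this norm up to the constant \<open>c\<close> of bounded
  bilinearity, and \<open>c\<close> is absorbed into the argument of a real exponential series. The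
  bound depends on \<open>M\<close> only through \<open>norm M\<close>, so it serves both pointwise
  summability and uniform convergence on balls.\<close>

lemma mexp_term_bound:
  obtains c :: real where "0 < c"
    "\<And>(M :: 'n::finite pmat) k. norm ((1 / fact k) *\<^sub>R matpow M k)
       \<le> norm (mat 1 :: 'n pmat) * (inverse (fact k) * (c * norm M) ^ k)"
proof -
  obtain c where c: "0 < c" "\<And>(A :: 'n pmat) (B :: 'n pmat). norm (A ** B) \<le> norm A * norm B * c"
    using matmul.pos_bounded by blast
  have *: "norm (matpow M k) \<le> norm (mat 1 :: 'n pmat) * (c * norm M) ^ k" for M :: "'n pmat" and k
  proof (induction k)
    case (Suc k)
    have "norm (matpow M (Suc k)) \<le> norm M * norm (matpow M k) * c"
      using c(2)[of M "matpow M k"] by simp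
    also have "\<dots> \<le> norm M * (norm (mat 1 :: 'n pmat) * (c * norm M) ^ k) * c"
      using Suc c(1) by (intro mult_right_mono mult_left_mono) auto
    finally show ?case by (simp add: mult_ac)
  qed simp
  show ?thesis
  proof (rule that[OF c(1)])
    show "norm ((1 / fact k) *\<^sub>R matpow M k)
       \<le> norm (mat 1 :: 'n pmat) * (inverse (fact k) * (c * norm M) ^ k)" for M :: "'n pmat" and k
      using *[of M k] by (simp add: divide_simps mult_ac)
  qed
qed

lemma summable_mexp: "summable (\<lambda>k. (1 / fact k) *\<^sub>R matpow (M :: 'n::finite pmat) k)"
proof -
  obtain c :: real where c: "\<And>(M :: 'n pmat) k. norm ((1 / fact k) *\<^sub>R matpow M k)
       \<le> norm (mat 1 :: 'n pmat) * (inverse (fact k) * (c * norm M) ^ k)"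
    using mexp_term_bound by metis
  show ?thesis
    by (rule summable_comparison_test'[OF summable_mult[OF summable_exp] c])
qed

lemma mexp_0 [simp]: "mexp 0 = mat 1"
proof -
  have *: "(\<lambda>k. (1 / fact k) *\<^sub>R matpow (0 :: 'a pmat) k) = (\<lambda>k. if k = 0 then mat 1 else 0)"
  proof
    show "(1 / fact k) *\<^sub>R matpow (0 :: 'a pmat) k = (if k = 0 then mat 1 else 0)" for k
      by (cases k) auto
  qed
  show ?thesis
    unfolding mexp_def * by (subst suminf_finite[of "{0}"]) auto
qed

lemma continuous_on_mexp: "continuous_on S (mexp :: 'n::finite pmat \<Rightarrow> 'n pmat)"
proof -
  obtain c :: real where c: "0 < c" "\<And>(M :: 'n pmat) k. norm ((1 / fact k) *\<^sub>R matpow M k)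
       \<le> norm (mat 1 :: 'n pmat) * (inverse (fact k) * (c * norm M) ^ k)"
    using mexp_term_bound by metis
  have pow: "continuous_on S (\<lambda>M. matpow M k)" for k and S :: "'n pmat set"
    by (induction k) (auto intro!: continuous_intros matmul.continuous_on)
  have "continuous_on (ball 0 r) (mexp :: 'n pmat \<Rightarrow> 'n pmat)" for r
  proof (rule uniform_limit_theorem)
    show "uniform_limit (ball 0 r) (\<lambda>n M. \<Sum>k<n. (1 / fact k) *\<^sub>R matpow M k)
            (mexp :: 'n pmat \<Rightarrow> 'n pmat) sequentially"
      unfolding mexp_def
    proof (rule Weierstrass_m_test)
      show "summable (\<lambda>k. norm (mat 1 :: 'n pmat) * (inverse (fact k) * (c * r) ^ k))"
        by (intro summable_mult summable_exp)
      fix k and M :: "'n pmat" assume "M \<in> ball 0 r"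
      then have "(c * norm M) ^ k \<le> (c * r) ^ k"
        using c(1) by (intro power_mono) auto
      then have "norm (mat 1 :: 'n pmat) * (inverse (fact k) * (c * norm M) ^ k)
          \<le> norm (mat 1 :: 'n pmat) * (inverse (fact k) * (c * r) ^ k)"
        by (intro mult_left_mono) auto
      then show "norm ((1 / fact k) *\<^sub>R matpow M k)
          \<le> norm (mat 1 :: 'n pmat) * (inverse (fact k) * (c * r) ^ k)"
        using c(2)[of k M] by linarith
    qed
  qed (auto intro!: always_eventually continuous_intros pow)
  then have "continuous (at M) (mexp :: 'n pmat \<Rightarrow> 'n pmat)" for M
    by (metis centre_in_ball continuous_on_eq_continuous_at dist_0_norm less_add_one mem_ball open_ball)
  then show ?thesis
    by (simp add: continuous_at_imp_continuous_on)
qed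

lemmas continuous_on_mexp_compose [continuous_intros] =
  continuous_on_compose2[OF continuous_on_mexp _ subset_UNIV]

text \<open>Paired with a fixed \<open>b\<close>, the curve is a scalar power series in
  \<open>s\<close>; termwise differentiation (\<open>diffs\<close>) shifts the index and brings out
  one factor \<open>M\<close>. The components are then reassembled.\<close>

lemma mexp_has_vector_derivative:
  fixes M :: "'n::finite pmat"
  shows "((\<lambda>s. mexp (s *\<^sub>R M)) has_vector_derivative M ** mexp (s *\<^sub>R M)) (at s within X)"
proof -
  have inner: "mexp (s *\<^sub>R M) \<bullet> b = (\<Sum>k. (matpow M k \<bullet> b / fact k) * s ^ k)" for s b
    unfolding mexp_def
    by (subst bounded_linear.suminf[OF bounded_linear_inner_left summable_mexp, of _ b])
       (simp add: matpow_scaleR mult_ac)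
  have sm: "summable (\<lambda>k. (matpow M k \<bullet> b / fact k) * s ^ k)" for s b
    using bounded_linear.summable[OF bounded_linear_inner_left summable_mexp[of "s *\<^sub>R M"], of b]
    by (simp add: matpow_scaleR mult_ac)
  have D: "((\<lambda>s. mexp (s *\<^sub>R M) \<bullet> b) has_field_derivative ((M ** mexp (s *\<^sub>R M)) \<bullet> b)) (at s)" for b
  proof -
    have lin: "bounded_linear (\<lambda>X. (M ** X) \<bullet> b)"
      by (rule bounded_linear_compose[OF bounded_linear_inner_left matmul.bounded_linear_right])
    have "(M ** mexp (s *\<^sub>R M)) \<bullet> b = (\<Sum>k. diffs (\<lambda>k. matpow M k \<bullet> b / fact k) k * s ^ k)"
      unfolding mexp_def
      by (subst bounded_linear.suminf[OF lin summable_mexp])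
         (simp add: matpow_scaleR mult_ac diffs_def matmul.scaleR_right del: of_nat_Suc)
    then show ?thesis
      unfolding inner
      using termdiffs_strong_converges_everywhere[of "\<lambda>k. matpow M k \<bullet> b / fact k" s] sm by simp
  qed
  have "((\<lambda>s. mexp (s *\<^sub>R M)) has_vector_derivative M ** mexp (s *\<^sub>R M)) (at s)"
    unfolding has_vector_derivative_def
    by (subst has_derivative_componentwise_within)
       (use D in \<open>auto simp: has_field_derivative_def mult.commute[of _ "(M ** mexp (s *\<^sub>R M)) \<bullet> _"]\<close>)
  then show ?thesis
    by (rule has_vector_derivative_at_within)
qed

lemma mexp_commute: "mexp M ** M = M ** mexp (M :: 'n::finite pmat)"
proof -
  have "mexp M ** M = (\<Sum>k. (1 / fact k) *\<^sub>R matpow M k ** M)"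
    unfolding mexp_def by (rule bounded_linear.suminf[OF matmul.bounded_linear_left summable_mexp])
  also have "\<dots> = (\<Sum>k. M ** ((1 / fact k) *\<^sub>R matpow M k))"
    by (simp add: matrix_distribs matpow_commute)
  also have "\<dots> = M ** mexp M"
    unfolding mexp_def
    by (rule bounded_linear.suminf[OF matmul.bounded_linear_right summable_mexp, symmetric])
  finally show ?thesis .
qed

lemma mexp_scaleR_commute: "mexp (s *\<^sub>R M) ** M = M ** mexp (s *\<^sub>R (M :: 'n::finite pmat))"
proof (cases "s = 0")
  case False
  then show ?thesis
    using mexp_commute[of "s *\<^sub>R M"] by (simp add: matrix_distribs)
qed simp

lemma mexp_minus_has_vector_derivative:
  fixes M :: "'n::finite pmat"
  shows "((\<lambda>s. mexp (- (s *\<^sub>R M))) has_vector_derivative - (mexp (- (s *\<^sub>R M)) ** M)) (at s within X)"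
  using mexp_has_vector_derivative[of "- M" s X] mexp_scaleR_commute[of s "- M"]
  by (simp add: matrix_distribs)

text \<open>Used twice: \<open>N = M\<close> gives a constant curve and hence the inverse of
  \<open>mexp M\<close>, and integration over [0,1] gives Duhamel's formula.\<close>

lemma mexp_minus_mexp_derivative:
  fixes M N :: "'n::finite pmat"
  shows "((\<lambda>s. mexp (- (s *\<^sub>R M)) ** mexp (s *\<^sub>R N)) has_vector_derivative
    mexp (- (s *\<^sub>R M)) ** (N - M) ** mexp (s *\<^sub>R N)) (at s within X)"
  by (rule has_vector_derivative_eq_rhs[OF matmul_has_vector_derivative
        [OF mexp_minus_has_vector_derivative mexp_has_vector_derivative]])
     (simp add: matrix_distribs matrix_mul_assoc)

lemma mexp_minus_left [simp]: "mexp (- M) ** mexp M = mat 1"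
proof -
  have "((\<lambda>s. mexp (- (s *\<^sub>R M)) ** mexp (s *\<^sub>R M)) has_vector_derivative 0) (at s within UNIV)" for s
    using mexp_minus_mexp_derivative[of M M s UNIV] by simp
  then obtain c where c: "mexp (- (s *\<^sub>R M)) ** mexp (s *\<^sub>R M) = c" for s
    by (rule has_vector_derivative_zero_constant[OF convex_UNIV]) auto
  show ?thesis
    using c[of 0] c[of 1] by simp
qed

lemma mexp_minus_right [simp]: "mexp M ** mexp (- M) = mat 1"
  using mexp_minus_left[of "- M"] by simp

lemma matrix_inv_eqI:
  fixes A B :: "real ^ 'k::finite ^ 'k"
  assumes "A ** B = mat 1"
  shows "matrix_inv A = B"
proof -
  have BA: "B ** A = mat 1"
    using assms by (simp add: matrix_left_right_inverse)
  then have "invertible A"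
    using assms by (auto simp: invertible_def)
  then have "matrix_inv A ** A = mat 1"
    unfolding matrix_inv_def invertible_def by (rule someI2_ex) auto
  then have "matrix_inv A ** (A ** B) = B"
    by (simp add: matrix_mul_assoc)
  then show ?thesis by (simp add: assms)
qed

text \<open>An exact formula for a finite increment. Since it is linear in \<open>N - M\<close>,
  dividing by a time step leaves an integral in which the difference quotient of a curve appears
  explicitly.\<close>

lemma mexp_duhamel:
  fixes M N :: "'n::finite pmat"
  shows "mexp N - mexp M
    = mexp M ** integral {0..1} (\<lambda>x. mexp (- (x *\<^sub>R M)) ** (N - M) ** mexp (x *\<^sub>R N))"
proof -
  have "((\<lambda>x. mexp (- (x *\<^sub>R M)) ** (N - M) ** mexp (x *\<^sub>R N)) has_integral
      mexp (- (1 *\<^sub>R M)) ** mexp (1 *\<^sub>R N) - mexp (- (0 *\<^sub>R M)) ** mexp (0 *\<^sub>R N)) {0..1}"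
    by (rule fundamental_theorem_of_calculus) (auto intro: mexp_minus_mexp_derivative)
  then have "integral {0..1} (\<lambda>x. mexp (- (x *\<^sub>R M)) ** (N - M) ** mexp (x *\<^sub>R N))
      = mexp (- M) ** mexp N - mat 1"
    by (simp add: integral_unique)
  then show ?thesis
    by (simp add: matrix_distribs matrix_mul_assoc)
qed

lemma has_vector_derivative_at_iff_quotient:
  "(f has_vector_derivative D) (at t) \<longleftrightarrow> ((\<lambda>y. (f y - f t) /\<^sub>R (y - t)) \<longlongrightarrow> D) (at t)"
proof -
  have "(f has_vector_derivative D) (at t) \<longleftrightarrow>
      ((\<lambda>y. norm ((1 / norm (y - t)) *\<^sub>R (f y - (f t + (y - t) *\<^sub>R D)))) \<longlongrightarrow> 0) (at t)"
    unfolding has_vector_derivative_def has_derivative_within tendsto_norm_zero_iff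
    by (simp add: bounded_linear_scaleR_left)
  also have "\<dots> \<longleftrightarrow> ((\<lambda>y. norm ((f y - f t) /\<^sub>R (y - t) - D)) \<longlongrightarrow> 0) (at t)"
  proof (rule filterlim_cong[OF refl refl])
    have "norm ((1 / norm (y - t)) *\<^sub>R (f y - (f t + (y - t) *\<^sub>R D)))
        = norm ((f y - f t) /\<^sub>R (y - t) - D)" if "y \<noteq> t" for y
    proof -
      have "(f y - f t) /\<^sub>R (y - t) - D = inverse (y - t) *\<^sub>R (f y - (f t + (y - t) *\<^sub>R D))"
        using that by (simp add: scaleR_diff_right scaleR_add_right)
      then show ?thesis by (simp add: divide_inverse)
    qed
    then show "\<forall>\<^sub>F y in at t. norm ((1 / norm (y - t)) *\<^sub>R (f y - (f t + (y - t) *\<^sub>R D)))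
        = norm ((f y - f t) /\<^sub>R (y - t) - D)"
      by (auto simp: eventually_at_filter)
  qed
  also have "\<dots> \<longleftrightarrow> ((\<lambda>y. (f y - f t) /\<^sub>R (y - t)) \<longlongrightarrow> D) (at t)"
    by (simp add: tendsto_norm_zero_iff flip: Lim_null)
  finally show ?thesis .
qed

text \<open>\<open>M t\<close> and \<open>M'\<close> need not commute, so the derivative is an
  average of conjugates of \<open>M'\<close>. It is the limit of Duhamel's formula for the
  difference quotient, the integral \<open>I\<close> being jointly continuous in the quotient and in
  the end point.\<close>

lemma mexp_curve_has_vector_derivative:
  fixes M :: "real \<Rightarrow> 'n::finite pmat"
  assumes M: "(M has_vector_derivative M') (at t)"
  shows "((\<lambda>t. mexp (M t)) has_vector_derivative
    mexp (M t) ** integral {0..1} (\<lambda>x. mexp (- (x *\<^sub>R M t)) ** M' ** mexp (x *\<^sub>R M t))) (at t)"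
proof -
  define I where "I = (\<lambda>(A, B). integral {0..1} (\<lambda>x. mexp (- (x *\<^sub>R M t)) ** A ** mexp (x *\<^sub>R (B :: 'n pmat))))"
  have I: "continuous_on UNIV I"
  proof -
    have "continuous_on UNIV (\<lambda>p :: 'n pmat \<times> 'n pmat. integral (cbox (0::real) 1)
        (\<lambda>x. mexp (- (x *\<^sub>R M t)) ** fst p ** mexp (x *\<^sub>R snd p)))"
      by (rule integral_continuous_on_param)
         (auto simp: split_beta intro!: continuous_intros matmul.continuous_on)
    then show ?thesis by (simp add: I_def split_beta)
  qed
  have "((\<lambda>y. I ((M y - M t) /\<^sub>R (y - t), M y)) \<longlongrightarrow> I (M', M t)) (at t)"
  proof (rule isCont_tendsto_compose[where g = I])
    show "isCont I (M', M t)"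
      using I by (simp add: continuous_on_eq_continuous_at)
    have "isCont M t"
      using M by (rule has_vector_derivative_continuous)
    then show "((\<lambda>y. ((M y - M t) /\<^sub>R (y - t), M y)) \<longlongrightarrow> (M', M t)) (at t)"
      using M by (intro tendsto_Pair) (simp_all add: has_vector_derivative_at_iff_quotient isCont_def)
  qed
  then have "((\<lambda>y. mexp (M t) ** I ((M y - M t) /\<^sub>R (y - t), M y)) \<longlongrightarrow> mexp (M t) ** I (M', M t)) (at t)"
    by (intro matmul.tendsto tendsto_const)
  moreover have "mexp (M t) ** I ((M y - M t) /\<^sub>R (y - t), M y) = (mexp (M y) - mexp (M t)) /\<^sub>R (y - t)" for y
    by (subst mexp_duhamel) (simp add: I_def matrix_distribs)
  ultimately show ?thesis
    by (simp add: has_vector_derivative_at_iff_quotient I_def)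
qed

lemma ex_antiderivative:
  fixes g :: "real \<Rightarrow> 'a::banach"
  assumes g: "continuous_on UNIV g"
  obtains \<Gamma> where "\<And>r. (\<Gamma> has_vector_derivative g r) (at r)"
proof
  \<comment> \<open>At least one of the two intervals is empty or a single point, so this is the
    oriented integral from 0 to \<open>r\<close> for either sign of \<open>r\<close>.\<close>
  define \<Gamma> where "\<Gamma> r = integral {0..r} g - integral {r..0} g" for r
  have int: "g integrable_on {a..b}" for a b
    using g by (intro integrable_continuous_real) (auto intro: continuous_on_subset)
  show "(\<Gamma> has_vector_derivative g r) (at r)" for r
  proof -
    define a b where "a = - \<bar>r\<bar> - 1" and "b = \<bar>r\<bar> + 1"
    have ab: "a < r" "r < b" "a < 0" "0 < b" by (auto simp: a_def b_def)
    have "((\<lambda>u. integral {a..u} g) has_vector_derivative g r) (at r within {a..b})"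
      using g ab by (intro integral_has_vector_derivative) (auto intro: continuous_on_subset)
    then have "((\<lambda>u. integral {a..u} g - integral {a..0} g) has_vector_derivative g r) (at r)"
      using ab by (auto intro!: derivative_eq_intros simp: at_within_Icc_at)
    then show ?thesis
    proof (rule has_vector_derivative_transform_within_open[where S = "{a<..<b}"])
      fix u assume u: "u \<in> {a<..<b}"
      show "integral {a..u} g - integral {a..0} g = \<Gamma> u"
      proof (cases "0 \<le> u")
        case True
        then show ?thesis
          using Henstock_Kurzweil_Integration.integral_combine[of a 0 u g] int ab
          by (cases "u = 0") (auto simp: \<Gamma>_def algebra_simps)
      next
        case False
        then show ?thesis
          using Henstock_Kurzweil_Integration.integral_combine[of a u 0 g] int u
          by (auto simp: \<Gamma>_def algebra_simps)
      qed
    qed (use ab in auto)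
  qed
qed

text \<open>The substitution \<open>r = s * x\<close> turns the integral into the oriented integral
  of \<open>g\<close> from 0 to \<open>s\<close>. The left-hand shape is that of
  \<open>conj_velocity\<close>.\<close>

lemma scaled_integral_has_vector_derivative:
  fixes g :: "real \<Rightarrow> 'a::banach"
  assumes g: "continuous_on UNIV g"
  shows "((\<lambda>s. integral {0..1} (\<lambda>x. s *\<^sub>R g (s * x))) has_vector_derivative g s) (at s)"
proof -
  obtain \<Gamma> where \<Gamma>: "\<And>r. (\<Gamma> has_vector_derivative g r) (at r)"
    by (rule ex_antiderivative[OF g]) blast
  have "integral {0..1} (\<lambda>x. s *\<^sub>R g (s * x)) = \<Gamma> s - \<Gamma> 0" for s
  proof -
    have "((\<lambda>x. s *\<^sub>R g (s * x)) has_integral \<Gamma> (s * 1) - \<Gamma> (s * 0)) {0..1}"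
    proof (rule fundamental_theorem_of_calculus)
      fix x :: real
      have "((\<lambda>x. s * x) has_vector_derivative s) (at x)"
        by (auto intro!: derivative_eq_intros simp flip: has_real_derivative_iff_has_vector_derivative)
      from vector_diff_chain_at[OF this \<Gamma>]
      show "((\<lambda>x. \<Gamma> (s * x)) has_vector_derivative s *\<^sub>R g (s * x)) (at x within {0..1})"
        by (simp add: o_def has_vector_derivative_at_within)
    qed simp
    then show ?thesis by (auto dest: integral_unique)
  qed
  then show ?thesis
    using \<Gamma>[of s] by (auto intro!: derivative_eq_intros)
qed

subsection \<open>Derivatives of the determinant\<close>

text \<open>The differential of \<open>det\<close> at \<open>A\<close> in direction
  \<open>H\<close>, obtained from the Leibniz expansion by the product rule.\<close>

definition det_deriv :: "real ^ 'k::finite ^ 'k \<Rightarrow> real ^ 'k ^ 'k \<Rightarrow> real" where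
  "det_deriv A H = (\<Sum>p | p permutes UNIV. of_int (sign p) *
     (\<Sum>i\<in>UNIV. H $ i $ p i * (\<Prod>j\<in>UNIV - {i}. A $ j $ p j)))"

text \<open>The second differential of \<open>det\<close> at \<open>A\<close>: the derivative of
  \<open>det_deriv A H\<close> when \<open>A\<close> moves in direction \<open>K\<close>.\<close>

definition det_deriv2 :: "real ^ 'k::finite ^ 'k \<Rightarrow> real ^ 'k ^ 'k \<Rightarrow> real ^ 'k ^ 'k \<Rightarrow> real" where
  "det_deriv2 A H K = (\<Sum>p | p permutes UNIV. of_int (sign p) *
     (\<Sum>i\<in>UNIV. H $ i $ p i *
        (\<Sum>j\<in>UNIV - {i}. K $ j $ p j * (\<Prod>l\<in>UNIV - {i} - {j}. A $ l $ p l))))"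

lemma matrix_entry_has_derivative:
  assumes "(A has_vector_derivative A') (at (s::real))"
  shows "((\<lambda>s. A s $ i $ j :: real) has_real_derivative A' $ i $ j) (at s)"
  unfolding has_real_derivative_iff_has_vector_derivative
  by (intro bounded_linear.has_vector_derivative[OF bounded_linear_vec_nth] assms)

lemma det_has_derivative:
  assumes "(A has_vector_derivative A') (at s)"
  shows "((\<lambda>s. det (A s)) has_real_derivative det_deriv (A s) A') (at s)"
  unfolding det_def det_deriv_def
  by (auto intro!: derivative_eq_intros has_field_derivative_prod matrix_entry_has_derivative[OF assms] sum.cong)

lemma det_deriv_has_derivative:
  assumes A: "(A has_vector_derivative A') (at s)" and H: "(H has_vector_derivative H') (at s)"
  shows "((\<lambda>s. det_deriv (A s) (H s)) has_real_derivative
    det_deriv (A s) H' + det_deriv2 (A s) (H s) A') (at s)"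
proof -
  have "((\<lambda>s. det_deriv (A s) (H s)) has_real_derivative
      (\<Sum>p | p permutes UNIV. of_int (sign p) *
        (\<Sum>i\<in>UNIV. H' $ i $ p i * (\<Prod>j\<in>UNIV - {i}. A s $ j $ p j) +
           (\<Sum>j\<in>UNIV - {i}. A' $ j $ p j * (\<Prod>l\<in>UNIV - {i} - {j}. A s $ l $ p l)) * H s $ i $ p i))) (at s)"
    unfolding det_deriv_def
    by (intro DERIV_sum DERIV_cmult DERIV_mult has_field_derivative_prod
        matrix_entry_has_derivative[OF A] matrix_entry_has_derivative[OF H])
  then show ?thesis
    by (simp add: det_deriv_def det_deriv2_def sum.distrib ring_distribs mult_ac)
qed

lemma continuous_on_det [continuous_intros]:
  "continuous_on S A \<Longrightarrow> continuous_on S (\<lambda>x. det (A x :: real ^ 'k::finite ^ 'k))"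
  unfolding det_def by (intro continuous_intros)

lemma continuous_on_det_deriv [continuous_intros]:
  assumes "continuous_on S A" "continuous_on S H"
  shows "continuous_on S (\<lambda>x. det_deriv (A x) (H x))"
  unfolding det_deriv_def by (intro continuous_intros assms)

lemma continuous_on_det_deriv2 [continuous_intros]:
  assumes "continuous_on S A" "continuous_on S H" "continuous_on S K"
  shows "continuous_on S (\<lambda>x. det_deriv2 (A x) (H x) (K x))"
  unfolding det_deriv2_def by (intro continuous_intros assms)

text \<open>A permutation other than the identity moves at least two points, so after one factor is
  removed another off-diagonal entry of the identity matrix remains and kills the product.\<close>

lemma det_deriv_id: "det_deriv (mat 1) H = trace H"
proof -
  have *: "(\<Sum>i\<in>UNIV. H $ i $ p i * (\<Prod>j\<in>UNIV - {i}. mat 1 $ j $ p j)) = 0"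
    if p: "p permutes UNIV" "p \<noteq> id" for p :: "'a \<Rightarrow> 'a"
  proof (rule sum.neutral, rule ballI)
    fix i :: 'a
    have "\<exists>j. j \<noteq> i \<and> p j \<noteq> j"
    proof (rule ccontr)
      assume "\<nexists>j. j \<noteq> i \<and> p j \<noteq> j"
      then have *: "p j = j" if "j \<noteq> i" for j using that by auto
      then have "p i = i"
        using permutes_inj[OF p(1)] by (metis injD)
      with * p(2) show False by (metis eq_id_iff)
    qed
    then show "H $ i $ p i * (\<Prod>j\<in>UNIV - {i}. mat 1 $ j $ p j) = 0"
      by (auto simp: mat_def)
  qed
  have "det_deriv (mat 1) H = (\<Sum>p | p permutes (UNIV :: 'a set). if p = id then
      (\<Sum>i\<in>UNIV. H $ i $ i * (\<Prod>j\<in>UNIV - {i}. mat 1 $ j $ j)) else 0)"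
    unfolding det_deriv_def
    by (rule sum.cong) (use * in \<open>auto simp: sign_id\<close>)
  also have "\<dots> = trace H"
    by (simp add: trace_def mat_def permutes_id)
  finally show ?thesis .
qed

text \<open>Jacobi's formula, from differentiating det(A + y H A) = det(1 + y H) det A at
  \<open>y = 0\<close>.\<close>

lemma det_deriv_mult: "det_deriv A (H ** A) = trace H * det A"
proof -
  have "((\<lambda>y. det (A + y *\<^sub>R (H ** A))) has_real_derivative det_deriv (A + 0 *\<^sub>R (H ** A)) (H ** A)) (at 0)"
    by (rule det_has_derivative) (auto intro!: derivative_eq_intros)
  moreover have "((\<lambda>y. det (mat 1 + y *\<^sub>R H)) has_real_derivative det_deriv (mat 1 + 0 *\<^sub>R H) H) (at 0)"
    by (rule det_has_derivative) (auto intro!: derivative_eq_intros)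
  then have "((\<lambda>y. det (mat 1 + y *\<^sub>R H) * det A) has_real_derivative trace H * det A) (at 0)"
    by (auto intro!: derivative_eq_intros simp: det_deriv_id)
  moreover have "det (mat 1 + y *\<^sub>R H) * det A = det (A + y *\<^sub>R (H ** A))" for y
    by (simp add: matrix_distribs flip: det_mul)
  ultimately show ?thesis
    by (auto dest: DERIV_unique)
qed

text \<open>Read off from the exponential instead of from permutations: f(x) = det(e^(xH)) satisfies
  f' = (tr H) f, so f''(0) is the square of tr H, while the chain rule gives f''(0) = tr(H H) +
  \<open>det_deriv2 (mat 1) H H\<close>.\<close>

lemma det_deriv2_id: "det_deriv2 (mat 1) H H = (trace H)\<^sup>2 - trace (H ** (H :: 'n::finite pmat))"
proof -
  define E where "E x = mexp (x *\<^sub>R H)" for x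
  have E: "(E has_vector_derivative H ** E x) (at x)" for x
    unfolding E_def by (rule mexp_has_vector_derivative)
  have D: "((\<lambda>x. det (E x)) has_real_derivative trace H * det (E x)) (at x)" for x
    using det_has_derivative[OF E] by (simp add: det_deriv_mult)
  have "((\<lambda>x. det_deriv (E x) (H ** E x)) has_real_derivative
      det_deriv (E 0) (H ** (H ** E 0)) + det_deriv2 (E 0) (H ** E 0) (H ** E 0)) (at 0)"
    by (intro det_deriv_has_derivative E bounded_linear.has_vector_derivative[OF matmul.bounded_linear_right])
  moreover have "((\<lambda>x. det_deriv (E x) (H ** E x)) has_real_derivative trace H * (trace H * det (E 0))) (at 0)"
    unfolding det_deriv_mult by (intro DERIV_cmult D)
  ultimately have "det_deriv (E 0) (H ** (H ** E 0)) + det_deriv2 (E 0) (H ** E 0) (H ** E 0)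
      = trace H * (trace H * det (E 0))"
    by (rule DERIV_unique)
  then show ?thesis
    by (simp add: E_def det_deriv_id power2_eq_square)
qed

text \<open>The equation for \<open>J\<close> fixes \<open>det J\<close> only up to sign. The path
  cos(theta) + sin(theta) J of invertible matrices joins the identity to \<open>J\<close> and
  decides the sign.\<close>

lemma det_complex_structure:
  fixes J :: "real ^ 'k::finite ^ 'k"
  assumes J: "J ** J = - mat 1"
  shows "det J = 1"
proof -
  define h where "h \<theta> = det (cos \<theta> *\<^sub>R mat 1 + sin \<theta> *\<^sub>R J)" for \<theta>
  have nz: "h \<theta> \<noteq> 0" for \<theta>
  proof -
    have "(cos \<theta> *\<^sub>R mat 1 + sin \<theta> *\<^sub>R J) ** (cos \<theta> *\<^sub>R mat 1 - sin \<theta> *\<^sub>R J)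
        = ((cos \<theta>)\<^sup>2 + (sin \<theta>)\<^sup>2) *\<^sub>R mat 1"
      by (simp add: matrix_distribs J algebra_simps power2_eq_square flip: scaleR_left.add)
    also have "\<dots> = (mat 1 :: real ^ 'k ^ 'k)" by simp
    finally have "h \<theta> * det (cos \<theta> *\<^sub>R mat 1 - sin \<theta> *\<^sub>R J) = 1"
      unfolding h_def by (metis det_mul det_I)
    then show ?thesis by auto
  qed
  have "0 < det J"
  proof (rule ccontr)
    assume "\<not> 0 < det J"
    then have "h (pi / 2) \<le> 0" "0 \<le> h 0"
      by (auto simp: h_def)
    moreover have "continuous_on {0..pi / 2} h"
      unfolding h_def by (intro continuous_intros)
    ultimately obtain x where "h x = 0"
      using IVT2'[of h "pi / 2" 0 0] by auto
    with nz show False by blast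
  qed
  moreover have "(det J) ^ 4 = 1"
  proof -
    have "J ** J ** (J ** J) = mat 1" by (simp add: J matrix_distribs)
    then have "det J * det J * (det J * det J) = 1" by (metis det_mul det_I)
    then show ?thesis by (simp add: power4_eq_xxxx mult.assoc)
  qed
  ultimately show ?thesis
    using power_eq_1_iff[of "det J" 4] by auto
qed

subsection \<open>The second variation\<close>

text \<open>The integrand of the second variation at \<open>Y\<close> with velocity \<open>Z\<close>, polarised so that it is a
  bilinear form on pairs \<open>(Y, Z)\<close>.\<close>

definition var_form :: "'n::finite pmat \<Rightarrow> 'n pmat \<times> 'n pmat \<Rightarrow> 'n pmat \<times> 'n pmat \<Rightarrow> real" where
  "var_form J v w =
     (1 / (2 * real CARD('n))) * (trace (J ** (fst v ** snd w - snd v ** fst w)) - trace (J ** snd v ** J ** snd w))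
     + (1 / (2 * real CARD('n)))\<^sup>2 * trace (J ** snd v) * trace (J ** snd w)"

text \<open>The logarithmic derivative in \<open>t\<close> of \<open>mexp (s *\<^sub>R Y t)\<close>,
  that is, U(s,t) of the overview after the substitution r = s x. Integrating over the fixed
  interval [0,1] makes joint continuity in \<open>s\<close> and \<open>t\<close> a statement about
  parameter integrals.\<close>

definition conj_velocity :: "(real \<Rightarrow> 'n::finite pmat) \<Rightarrow> (real \<Rightarrow> 'n pmat) \<Rightarrow> real \<Rightarrow> real \<Rightarrow> 'n pmat" where
  "conj_velocity Y Z s t =
     integral {0..1} (\<lambda>x. mexp (- (x *\<^sub>R s *\<^sub>R Y t)) ** (s *\<^sub>R Z t) ** mexp (x *\<^sub>R s *\<^sub>R Y t))"

lemma trace_minus: "trace (- A :: real ^ 'k::finite ^ 'k) = - trace A"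
  by (simp add: trace_def sum_negf)

lemma trace_scaleR: "trace (c *\<^sub>R A :: real ^ 'k::finite ^ 'k) = c * trace A"
  by (simp add: trace_def sum_distrib_left)

lemma bounded_linear_trace: "bounded_linear (trace :: real ^ 'k::finite ^ 'k \<Rightarrow> real)"
  by (auto simp: linear_conv_bounded_linear[symmetric] trace_add trace_scaleR intro!: linearI)

lemma det_mexp_conjugate: "det (mexp M ** A ** mexp (- M)) = det (A :: 'n::finite pmat)"
proof -
  have "det (mexp M) * det (mexp (- M)) = 1"
    by (metis det_I det_mul mexp_minus_right)
  then show ?thesis
    by (simp add: det_mul mult_ac)
qed

text \<open>Since the inverse of \<open>J\<close> is -J, one has J + U = J (1 - J U), and
  \<open>det J = 1\<close> removes the factor. The remaining determinant is 1 at
  \<open>s = 0\<close>, where real powers are smooth.\<close>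

lemma length_G_variation:
  fixes J :: "'n::finite pmat"
  assumes J: "J ** J = - mat 1" and Y: "\<And>t. (Y has_vector_derivative Z t) (at t)"
  shows "length_G T (\<lambda>t. mexp (s *\<^sub>R Y t) ** mexp (t *\<^sub>R J))
    = integral {0..T} (\<lambda>t. det (mat 1 - J ** conj_velocity Y Z s t) powr (1 / (2 * real CARD('n))))"
proof -
  have "det (vector_derivative (\<lambda>t. mexp (s *\<^sub>R Y t) ** mexp (t *\<^sub>R J)) (at t)
      ** matrix_inv (mexp (s *\<^sub>R Y t) ** mexp (t *\<^sub>R J))) = det (mat 1 - J ** conj_velocity Y Z s t)" for t
  proof -
    have "((\<lambda>t. s *\<^sub>R Y t) has_vector_derivative s *\<^sub>R Z t) (at t)"
      using Y[of t] by (auto intro!: derivative_eq_intros)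
    from mexp_curve_has_vector_derivative[OF this]
    have "((\<lambda>t. mexp (s *\<^sub>R Y t)) has_vector_derivative
        mexp (s *\<^sub>R Y t) ** conj_velocity Y Z s t) (at t)"
      by (simp add: conj_velocity_def)
    from matmul_has_vector_derivative[OF this mexp_has_vector_derivative]
    have vd: "vector_derivative (\<lambda>t. mexp (s *\<^sub>R Y t) ** mexp (t *\<^sub>R J)) (at t)
        = mexp (s *\<^sub>R Y t) ** (J + conj_velocity Y Z s t) ** mexp (t *\<^sub>R J)"
      by (intro vector_derivative_at) (simp add: matrix_distribs matrix_mul_assoc)
    have cancel: "mexp (t *\<^sub>R J) ** (mexp (- (t *\<^sub>R J)) ** A) = A" for A :: "'n pmat"
      by (simp add: matrix_mul_assoc)
    have inv: "matrix_inv (mexp (s *\<^sub>R Y t) ** mexp (t *\<^sub>R J)) = mexp (- (t *\<^sub>R J)) ** mexp (- (s *\<^sub>R Y t))"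
      by (rule matrix_inv_eqI) (simp add: cancel flip: matrix_mul_assoc)
    have "vector_derivative (\<lambda>t. mexp (s *\<^sub>R Y t) ** mexp (t *\<^sub>R J)) (at t)
        ** matrix_inv (mexp (s *\<^sub>R Y t) ** mexp (t *\<^sub>R J))
        = mexp (s *\<^sub>R Y t) ** (J + conj_velocity Y Z s t) ** mexp (- (s *\<^sub>R Y t))"
      unfolding vd inv by (simp add: cancel flip: matrix_mul_assoc)
    also have "J + conj_velocity Y Z s t = J ** (mat 1 - J ** conj_velocity Y Z s t)"
      by (simp add: matrix_distribs matrix_mul_assoc J)
    finally show ?thesis
      by (simp only: det_mexp_conjugate) (simp add: det_mul det_complex_structure[OF J])
  qed
  then show ?thesis
    unfolding length_G_def G_def by simp
qed

text \<open>Differentiation under the integral sign, twice. At \<open>s = 0\<close> the determinant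
  is 1 and its first two \<open>s\<close>-derivatives are -tr(J Z) and tr(J [Y,Z]) + (tr(J Z))^2 -
  tr(J Z J Z); the power \<open>\<alpha>\<close> adds \<alpha> (\<alpha> - 1) (tr(J Z))^2, so the
  coefficient of (tr(J Z))^2 becomes \<alpha>^2.\<close>

lemma second_var_eq:
  fixes J :: "'n::finite pmat"
  assumes J: "J ** J = - mat 1" and Y: "\<And>t. (Y has_vector_derivative Z t) (at t)"
    and Z: "continuous_on UNIV Z"
  shows "second_var J T Y = integral {0..T} (\<lambda>t. var_form J (Y t, Z t) (Y t, Z t))"
proof -
  define \<alpha> where "\<alpha> = 1 / (2 * real CARD('n))"
  define a where "a s t = mat 1 - J ** conj_velocity Y Z s t" for s t
  \<comment> \<open>\<open>g\<close> is the \<open>s\<close>-derivative of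
    \<open>conj_velocity Y Z\<close>; \<open>a1\<close> and \<open>a2\<close> are the first and
    second \<open>s\<close>-derivatives of \<open>a\<close>.\<close>
  define g where "g s t = mexp (- (s *\<^sub>R Y t)) ** Z t ** mexp (s *\<^sub>R Y t)" for s t
  define a1 where "a1 s t = - (J ** g s t)" for s t
  define a2 where "a2 s t = - (J ** (mexp (- (s *\<^sub>R Y t)) ** (Z t ** Y t - Y t ** Z t) ** mexp (s *\<^sub>R Y t)))" for s t
  have Yc: "continuous_on S Y" for S
    by (meson Y continuous_at_imp_continuous_on has_vector_derivative_continuous)
  have Zc: "continuous_on S Z" for S
    using Z continuous_on_subset by blast
  note Yc' = continuous_on_compose2[OF Yc[of UNIV] _ subset_UNIV]
  note Zc' = continuous_on_compose2[OF Zc[of UNIV] _ subset_UNIV]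
  have g_cont: "continuous_on S (\<lambda>p. g (fst p) (snd p))" for S
    unfolding g_def by (intro continuous_intros matmul.continuous_on Yc' Zc')
  have a_cont: "continuous_on S (\<lambda>p. a (fst p) (snd p))" for S
  proof -
    have "continuous_on S (\<lambda>p. integral (cbox 0 1) (\<lambda>x::real. mexp (- (x *\<^sub>R fst p *\<^sub>R Y (snd p)))
        ** (fst p *\<^sub>R Z (snd p)) ** mexp (x *\<^sub>R fst p *\<^sub>R Y (snd p))))"
      unfolding split_beta
      by (intro integral_continuous_on_param)
         (auto simp: split_beta intro!: continuous_intros matmul.continuous_on Yc' Zc')
    then show ?thesis
      unfolding a_def conj_velocity_def by (auto intro!: continuous_intros matmul.continuous_on)
  qed
  have a1_cont: "continuous_on S (\<lambda>p. a1 (fst p) (snd p))" for S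
    unfolding a1_def by (intro continuous_intros matmul.continuous_on g_cont)
  have a2_cont: "continuous_on S (\<lambda>p. a2 (fst p) (snd p))" for S
    unfolding a2_def by (intro continuous_intros matmul.continuous_on Yc' Zc')
  have a_0: "a 0 t = mat 1" for t
    by (simp add: a_def conj_velocity_def)
  have a_deriv: "((\<lambda>s. a s t) has_vector_derivative a1 s t) (at s)" for s t
  proof -
    have "continuous_on UNIV (\<lambda>s. g s t)"
      unfolding g_def by (intro continuous_intros matmul.continuous_on)
    from scaled_integral_has_vector_derivative[OF this]
    have "((\<lambda>s. conj_velocity Y Z s t) has_vector_derivative g s t) (at s)"
      by (simp add: conj_velocity_def g_def matrix_distribs mult.commute)
    from bounded_linear.has_vector_derivative[OF matmul.bounded_linear_right this]
    show ?thesis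
      unfolding a_def a1_def by (auto intro!: derivative_eq_intros)
  qed
  have a1_deriv: "((\<lambda>s. a1 s t) has_vector_derivative a2 s t) (at s)" for s t
  proof -
    have "((\<lambda>s. g s t) has_vector_derivative
        mexp (- (s *\<^sub>R Y t)) ** (Z t ** Y t - Y t ** Z t) ** mexp (s *\<^sub>R Y t)) (at s)"
      unfolding g_def
      by (rule has_vector_derivative_eq_rhs[OF matmul_has_vector_derivative[OF
            bounded_linear.has_vector_derivative[OF matmul.bounded_linear_left
              mexp_minus_has_vector_derivative] mexp_has_vector_derivative]])
         (simp add: matrix_distribs matrix_mul_assoc)
    from bounded_linear.has_vector_derivative[OF matmul.bounded_linear_right this]
    show ?thesis
      unfolding a2_def a1_def by (auto intro!: derivative_eq_intros)
  qed
  define f where "f s t = det (a s t) powr \<alpha>" for s t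
  define f1 where "f1 s t = \<alpha> * det (a s t) powr (\<alpha> - 1) * det_deriv (a s t) (a1 s t)" for s t
  define f2 where "f2 s t = \<alpha> * ((\<alpha> - 1) * det (a s t) powr (\<alpha> - 2) * (det_deriv (a s t) (a1 s t))\<^sup>2 +
      det (a s t) powr (\<alpha> - 1) * (det_deriv (a s t) (a2 s t) + det_deriv2 (a s t) (a1 s t) (a1 s t)))" for s t
  \<comment> \<open>Differentiating \<open>powr\<close> needs a positive base, and differentiating
    under the integral needs one range of \<open>s\<close> valid for all \<open>t\<close>. Uniform
    continuity on a compact rectangle provides it, since \<open>a 0 t\<close> is the
    identity.\<close>
  obtain \<delta> where "0 < \<delta>" and pos: "\<And>s t. s \<in> {-\<delta><..<\<delta>} \<Longrightarrow> t \<in> {0..T} \<Longrightarrow> 0 < det (a s t)"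
  proof -
    define K where "K = {-1..1::real} \<times> {0..T}"
    have "uniformly_continuous_on K (\<lambda>p. det (a (fst p) (snd p)))"
      by (intro compact_uniformly_continuous continuous_intros a_cont)
         (auto simp: K_def intro: compact_Times)
    then obtain d where d: "0 < d" "\<And>p q. p \<in> K \<Longrightarrow> q \<in> K \<Longrightarrow> dist q p < d \<Longrightarrow>
        dist (det (a (fst q) (snd q))) (det (a (fst p) (snd p))) < 1"
      unfolding uniformly_continuous_on_def by (metis zero_less_one)
    show ?thesis
    proof (rule that[of "min 1 d"])
      fix s t assume "s \<in> {- min 1 d<..<min 1 d}" "t \<in> {0..T}"
      then have "-1 \<le> s" "s \<le> 1" "\<bar>s\<bar> < d" "t \<in> {0..T}" by auto
      then show "0 < det (a s t)"
        using d(2)[of "(0, t)" "(s, t)"] by (auto simp: K_def a_0 dist_Pair_Pair dist_real_def)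
    qed (use d in auto)
  qed
  define U where "U = {-\<delta><..<\<delta>}"
  have U: "open U" "convex U" "0 \<in> U"
    using \<open>0 < \<delta>\<close> by (auto simp: U_def)
  have det_ne: "det (a s t) \<noteq> 0" if "s \<in> U" "t \<in> {0..T}" for s t
    using pos[of s t] that by (auto simp: U_def)
  have f_deriv: "((\<lambda>s. f s t) has_real_derivative f1 s t) (at s)" if "s \<in> U" "t \<in> {0..T}" for s t
    using DERIV_fun_powr[OF det_has_derivative[OF a_deriv] pos, of s t \<alpha>] that
    by (simp add: f_def f1_def U_def)
  have f1_deriv: "((\<lambda>s. f1 s t) has_real_derivative f2 s t) (at s)" if "s \<in> U" "t \<in> {0..T}" for s t
  proof -
    have "((\<lambda>s. det (a s t) powr (\<alpha> - 1)) has_real_derivative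
        (\<alpha> - 1) * det (a s t) powr (\<alpha> - 2) * det_deriv (a s t) (a1 s t)) (at s)"
      using DERIV_fun_powr[OF det_has_derivative[OF a_deriv] pos, of s t "\<alpha> - 1"] that
      by (simp add: U_def)
    from DERIV_mult[OF DERIV_cmult[OF this, of \<alpha>] det_deriv_has_derivative[OF a_deriv a1_deriv]]
    show ?thesis
      unfolding f1_def f2_def by (rule DERIV_cong) (simp add: algebra_simps power2_eq_square)
  qed
  have f_cont: "continuous_on (U \<times> cbox 0 T) (\<lambda>p. f (fst p) (snd p))"
    unfolding f_def using det_ne by (intro continuous_intros a_cont) auto
  have f1_cont: "continuous_on (U \<times> cbox 0 T) (\<lambda>p. f1 (fst p) (snd p))"
    unfolding f1_def using det_ne by (intro continuous_intros a_cont a1_cont) auto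
  have f2_cont: "continuous_on (U \<times> cbox 0 T) (\<lambda>p. f2 (fst p) (snd p))"
    unfolding f2_def using det_ne by (intro continuous_intros a_cont a1_cont a2_cont) auto
  have slice: "h s integrable_on cbox 0 T"
    if "continuous_on (U \<times> cbox 0 T) (\<lambda>p. h (fst p) (snd p))" "s \<in> U" for h :: "real \<Rightarrow> real \<Rightarrow> real" and s
  proof -
    have "continuous_on (cbox 0 T) (\<lambda>t. h (fst (s, t)) (snd (s, t)))"
      by (rule continuous_on_compose2[OF that(1)]) (use that(2) in \<open>auto intro!: continuous_intros\<close>)
    then show ?thesis
      by (intro integrable_continuous) simp
  qed
  define L where "L s = integral {0..T} (f s)" for s
  have L: "(L has_real_derivative integral {0..T} (f1 s)) (at s)" if "s \<in> U" for s
    unfolding L_def[abs_def] at_within_open[OF that U(1), symmetric] cbox_interval[symmetric]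
    by (rule leibniz_rule_field_derivative[OF _ slice[OF f_cont] _ that U(2)])
       (use f_deriv f1_cont in \<open>auto simp: split_beta intro: has_field_derivative_at_within\<close>)
  have L1: "((\<lambda>s. integral {0..T} (f1 s)) has_real_derivative integral {0..T} (f2 0)) (at 0)"
    unfolding at_within_open[OF U(3,1), symmetric] cbox_interval[symmetric]
    by (rule leibniz_rule_field_derivative[OF _ slice[OF f1_cont] _ U(3,2)])
       (use f1_deriv f2_cont in \<open>auto simp: split_beta intro: has_field_derivative_at_within\<close>)
  \<comment> \<open>\<open>deriv L\<close> is identified with the integral of \<open>f1 s\<close>
    only for \<open>s\<close> in \<open>U\<close>, which suffices because \<open>U\<close> is an
    open neighbourhood of 0.\<close>
  have "(deriv L has_real_derivative integral {0..T} (f2 0)) (at 0)"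
    using U L by (intro has_field_derivative_transform_within_open[OF L1, of U]) (auto intro: DERIV_imp_deriv[symmetric])
  moreover have "second_var J T Y = deriv (deriv L) 0"
    unfolding second_var_def length_G_variation[OF J Y] L_def[abs_def] f_def[abs_def] a_def \<alpha>_def by simp
  moreover have "f2 0 t = var_form J (Y t, Z t) (Y t, Z t)" for t
    by (simp add: f2_def a_0 a1_def a2_def g_def det_deriv_id det_deriv2_id var_form_def
        trace_minus trace_sub matrix_distribs matrix_mul_assoc power2_eq_square flip: \<alpha>_def)
       (simp add: algebra_simps)
  then have "f2 0 = (\<lambda>t. var_form J (Y t, Z t) (Y t, Z t))" by auto
  ultimately show ?thesis
    by (simp add: DERIV_imp_deriv)
qed

subsection \<open>Square-integrable curves\<close>

text \<open>Measurability is a separate clause because integrability of the squared norm does not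
  imply it.\<close>

definition sq_int :: "real \<Rightarrow> (real \<Rightarrow> 'a::euclidean_space) \<Rightarrow> bool" where
  "sq_int T f \<longleftrightarrow> f \<in> borel_measurable (lebesgue_on {0..T}) \<and> (\<lambda>t. (norm (f t))\<^sup>2) integrable_on {0..T}"

definition l2_sq :: "real \<Rightarrow> (real \<Rightarrow> 'a::euclidean_space) \<Rightarrow> real" where
  "l2_sq T f = integral {0..T} (\<lambda>t. (norm (f t))\<^sup>2)"

lemma l2_sq_nonneg: "0 \<le> l2_sq T f"
  unfolding l2_sq_def
  \<comment> \<open>\<open>integral\<close> is 0 by convention where the integrand is not
    integrable.\<close>
  by (cases "(\<lambda>t. (norm (f t))\<^sup>2) integrable_on {0..T}")
     (auto intro: integral_nonneg simp: not_integrable_integral)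

lemma sq_int_continuous:
  assumes "continuous_on {0..T} f" shows "sq_int T f"
  unfolding sq_int_def
proof
  show "f \<in> borel_measurable (lebesgue_on {0..T})"
    using assms by (rule continuous_imp_measurable_on_sets_lebesgue) simp
  show "(\<lambda>t. (norm (f t))\<^sup>2) integrable_on {0..T}"
    by (intro integrable_continuous_real continuous_intros assms)
qed

lemma sq_int_bound:
  assumes f: "sq_int T f" and h: "h \<in> borel_measurable (lebesgue_on {0..T})"
    and le: "\<And>t. t \<in> {0..T} \<Longrightarrow> norm (h t) \<le> C * norm (f t)"
  shows "sq_int T h"
proof -
  have "(\<lambda>t. (norm (h t))\<^sup>2) absolutely_integrable_on {0..T}"
  proof (rule measurable_bounded_by_integrable_imp_absolutely_integrable)
    show "(\<lambda>t. (norm (h t))\<^sup>2) \<in> borel_measurable (lebesgue_on {0..T})"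
      using h by measurable
    show "(\<lambda>t. C\<^sup>2 * (norm (f t))\<^sup>2) integrable_on {0..T}"
      using f by (intro integrable_on_mult_right) (auto simp: sq_int_def)
    show "norm ((norm (h t))\<^sup>2) \<le> C\<^sup>2 * (norm (f t))\<^sup>2" if "t \<in> {0..T}" for t
      using power_mono[OF le[OF that], of 2] by (simp add: power_mult_distrib)
  qed simp
  then show ?thesis
    using h by (auto simp: sq_int_def absolutely_integrable_on_def)
qed

lemma sq_int_linear:
  assumes f: "sq_int T f" and L: "bounded_linear L"
  shows "sq_int T (\<lambda>t. L (f t))"
proof -
  obtain C where C: "\<And>x. norm (L x) \<le> norm x * C"
    using bounded_linear.bounded[OF L] by blast
  have "L \<in> borel_measurable borel"
    using L by (intro borel_measurable_continuous_onI linear_continuous_on)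
  then have "(\<lambda>t. L (f t)) \<in> borel_measurable (lebesgue_on {0..T})"
    using f measurable_compose[of f _ borel L] by (auto simp: sq_int_def)
  then show ?thesis
    by (rule sq_int_bound[OF f, of _ C]) (use C in \<open>simp add: mult.commute\<close>)
qed

lemma sq_int_Pair:
  assumes "sq_int T f" "sq_int T g"
  shows "sq_int T (\<lambda>t. (f t, g t))"
  unfolding sq_int_def
proof
  show "(\<lambda>t. (f t, g t)) \<in> borel_measurable (lebesgue_on {0..T})"
    using assms by (intro borel_measurable_Pair) (auto simp: sq_int_def)
  have "(\<lambda>t. (norm (f t))\<^sup>2 + (norm (g t))\<^sup>2) integrable_on {0..T}"
    using assms by (intro integrable_add) (auto simp: sq_int_def)
  then show "(\<lambda>t. (norm (f t, g t))\<^sup>2) integrable_on {0..T}"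
    by (simp add: norm_Pair)
qed

lemma sq_int_add:
  assumes f: "sq_int T f" and g: "sq_int T g"
  shows "sq_int T (\<lambda>t. f t + g t)"
  using sq_int_linear[OF sq_int_Pair[OF f g], of "\<lambda>p. fst p + snd p"]
  by (simp add: bounded_linear_add bounded_linear_fst bounded_linear_snd)

lemma sq_int_diff:
  assumes f: "sq_int T f" and g: "sq_int T g"
  shows "sq_int T (\<lambda>t. f t - g t)"
  using sq_int_linear[OF sq_int_Pair[OF f g], of "\<lambda>p. fst p - snd p"]
  by (simp add: bounded_linear_sub bounded_linear_fst bounded_linear_snd)

lemma sq_int_bilinear:
  fixes b :: "'a::euclidean_space \<Rightarrow> 'b::euclidean_space \<Rightarrow> real"
  assumes f: "sq_int T f" and g: "sq_int T g" and b: "bounded_bilinear b"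
  shows "(\<lambda>t. b (f t) (g t)) absolutely_integrable_on {0..T}"
proof -
  obtain C where C: "0 < C" "\<And>x y. norm (b x y) \<le> norm x * norm y * C"
    using bounded_bilinear.pos_bounded[OF b] by blast
  show ?thesis
  proof (rule measurable_bounded_by_integrable_imp_absolutely_integrable)
  show "(\<lambda>t. b (f t) (g t)) \<in> borel_measurable (lebesgue_on {0..T})"
    by (rule borel_measurable_bilinear)
       (use f g b in \<open>simp_all add: sq_int_def bilinear_conv_bounded_bilinear\<close>)
  show "(\<lambda>t. C * ((norm (f t))\<^sup>2 + (norm (g t))\<^sup>2)) integrable_on {0..T}"
    using f g by (intro integrable_on_mult_right integrable_add) (auto simp: sq_int_def)
  show "norm (b (f t) (g t)) \<le> C * ((norm (f t))\<^sup>2 + (norm (g t))\<^sup>2)" for t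
  proof -
    have "norm (f t) * norm (g t) \<le> (norm (f t))\<^sup>2 + (norm (g t))\<^sup>2"
      using sum_squares_bound[of "norm (f t)" "norm (g t)"]
        mult_nonneg_nonneg[OF norm_ge_zero norm_ge_zero, of "f t" "g t"] by linarith
    then have "C * (norm (f t) * norm (g t)) \<le> C * ((norm (f t))\<^sup>2 + (norm (g t))\<^sup>2)"
      using C(1) by (intro mult_left_mono) auto
    then show ?thesis
      using C(2)[of "f t" "g t"] by (simp add: mult.commute)
  qed
qed simp
qed

lemma sq_int_imp_absolutely_integrable:
  assumes f: "sq_int T f"
  shows "f absolutely_integrable_on {0..T}"
proof (rule measurable_bounded_by_integrable_imp_absolutely_integrable)
  show "(\<lambda>t. 1 + (norm (f t))\<^sup>2) integrable_on {0..T}"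
    using f by (intro integrable_add) (auto simp: sq_int_def)
  show "norm (f t) \<le> 1 + (norm (f t))\<^sup>2" for t
    using sum_squares_bound[of 1 "norm (f t)"] norm_ge_zero[of "f t"] by (simp del: norm_ge_zero)
qed (use f in \<open>auto simp: sq_int_def\<close>)

text \<open>Young's inequality with a free weight \<open>r\<close>. Taking \<open>r\<close> slightly
  above the square root of \<open>l2_sq T f\<close> gives the effect of the Cauchy-Schwarz
  inequality.\<close>

lemma l1_le_l2:
  assumes f: "sq_int T f" and r: "0 < r" and T: "0 \<le> T"
  shows "integral {0..T} (\<lambda>t. norm (f t)) \<le> r * T + l2_sq T f / r"
proof -
  have "integral {0..T} (\<lambda>t. norm (f t)) \<le> integral {0..T} (\<lambda>t. r + (norm (f t))\<^sup>2 / r)"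
  proof (rule integral_le)
    show "(\<lambda>t. norm (f t)) integrable_on {0..T}"
      using sq_int_imp_absolutely_integrable[OF f] by (simp add: absolutely_integrable_on_def)
    show "(\<lambda>t. r + (norm (f t))\<^sup>2 / r) integrable_on {0..T}"
      using f by (intro integrable_add integrable_on_divide) (auto simp: sq_int_def)
    show "norm (f t) \<le> r + (norm (f t))\<^sup>2 / r" for t
    proof -
      have "0 \<le> r * norm (f t)" using r by simp
      then have "r * norm (f t) \<le> r\<^sup>2 + (norm (f t))\<^sup>2"
        using sum_squares_bound[of r "norm (f t)"] by linarith
      then show ?thesis
        using r by (simp add: field_simps power2_eq_square)
    qed
  qed
  also have "\<dots> = integral {0..T} (\<lambda>t. r) + integral {0..T} (\<lambda>t. (norm (f t))\<^sup>2 / r)"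
    using f by (intro Henstock_Kurzweil_Integration.integral_add integrable_on_divide) (auto simp: sq_int_def)
  also have "\<dots> = r * T + l2_sq T f / r"
    using T by (simp add: l2_sq_def)
  finally show ?thesis .
qed

lemma l2_sq_add_le:
  assumes f: "sq_int T f" and g: "sq_int T g"
  shows "l2_sq T (\<lambda>t. f t + g t) \<le> 2 * l2_sq T f + 2 * l2_sq T g"
proof -
  have "l2_sq T (\<lambda>t. f t + g t) \<le> integral {0..T} (\<lambda>t. 2 * (norm (f t))\<^sup>2 + 2 * (norm (g t))\<^sup>2)"
    unfolding l2_sq_def
  proof (rule integral_le)
    show "(\<lambda>t. (norm (f t + g t))\<^sup>2) integrable_on {0..T}"
      using sq_int_add[OF f g] by (simp add: sq_int_def)
    show "(\<lambda>t. 2 * (norm (f t))\<^sup>2 + 2 * (norm (g t))\<^sup>2) integrable_on {0..T}"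
      using f g by (intro integrable_add integrable_on_mult_right) (auto simp: sq_int_def)
    show "(norm (f t + g t))\<^sup>2 \<le> 2 * (norm (f t))\<^sup>2 + 2 * (norm (g t))\<^sup>2" for t
    proof -
      have "(norm (f t + g t))\<^sup>2 \<le> (norm (f t) + norm (g t))\<^sup>2"
        by (intro power_mono norm_triangle_ineq norm_ge_zero)
      then show ?thesis
        using sum_squares_bound[of "norm (f t)" "norm (g t)"] by (simp add: power2_sum)
    qed
  qed
  also have "\<dots> = integral {0..T} (\<lambda>t. 2 * (norm (f t))\<^sup>2) + integral {0..T} (\<lambda>t. 2 * (norm (g t))\<^sup>2)"
    using f g by (intro Henstock_Kurzweil_Integration.integral_add integrable_on_mult_right) (auto simp: sq_int_def)
  also have "\<dots> = 2 * l2_sq T f + 2 * l2_sq T g"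
    by (simp add: l2_sq_def)
  finally show ?thesis .
qed

lemma l2_sq_linear_le:
  assumes f: "sq_int T f" and L: "bounded_linear L" and C: "\<And>x. norm (L x) \<le> norm x * C"
  shows "l2_sq T (\<lambda>t. L (f t)) \<le> C\<^sup>2 * l2_sq T f"
proof -
  have "l2_sq T (\<lambda>t. L (f t)) \<le> integral {0..T} (\<lambda>t. C\<^sup>2 * (norm (f t))\<^sup>2)"
    unfolding l2_sq_def
  proof (rule integral_le)
    show "(\<lambda>t. (norm (L (f t)))\<^sup>2) integrable_on {0..T}"
      using sq_int_linear[OF f L] by (simp add: sq_int_def)
    show "(\<lambda>t. C\<^sup>2 * (norm (f t))\<^sup>2) integrable_on {0..T}"
      using f by (intro integrable_on_mult_right) (auto simp: sq_int_def)
    show "(norm (L (f t)))\<^sup>2 \<le> C\<^sup>2 * (norm (f t))\<^sup>2" for t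
      using power_mono[OF C[of "f t"], of 2] by (simp add: power_mult_distrib mult.commute)
  qed
  then show ?thesis by (simp add: l2_sq_def)
qed

text \<open>With d = fk - f, the difference of the integrands is b(d,d) + b(d,f) + b(f,d). The mixed
  terms are split by Young's inequality with a weight \<open>r k\<close> that tends to 0 slowly
  enough for \<open>N k / r k\<close> to tend to 0 as well.\<close>

lemma integral_bilinear_tendsto:
  fixes b :: "'a::euclidean_space \<Rightarrow> 'a \<Rightarrow> real"
  assumes b: "bounded_bilinear b" and fk: "\<And>k. sq_int T (fk k)" and f: "sq_int T f"
    and lim: "(\<lambda>k. l2_sq T (\<lambda>t. fk k t - f t)) \<longlonglongrightarrow> 0"
  shows "(\<lambda>k. integral {0..T} (\<lambda>t. b (fk k t) (fk k t))) \<longlonglongrightarrow> integral {0..T} (\<lambda>t. b (f t) (f t))"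
proof -
  interpret b: bounded_bilinear b by fact
  obtain C where C: "0 < C" "\<And>x y. norm (b x y) \<le> norm x * norm y * C"
    using b.pos_bounded by blast
  define d where "d k t = fk k t - f t" for k t
  define N where "N k = l2_sq T (d k)" for k
  \<comment> \<open>The square root yields \<open>N k / r k \<le> r k\<close>; the added reciprocal
    keeps \<open>r k\<close> positive when \<open>N k = 0\<close>.\<close>
  define r where "r k = sqrt (N k) + inverse (real (Suc k))" for k
  have d: "sq_int T (d k)" for k
    unfolding d_def by (intro sq_int_diff fk f)
  have N: "N \<longlonglongrightarrow> 0" using lim by (simp add: N_def[abs_def] d_def[abs_def])
  have N0: "0 \<le> N k" for k by (simp add: N_def l2_sq_nonneg)
  have r0: "0 < r k" for k using N0[of k] by (simp add: r_def add_nonneg_pos)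
  have r: "r \<longlonglongrightarrow> 0"
    unfolding r_def[abs_def]
    using tendsto_add[OF tendsto_real_sqrt[OF N] LIMSEQ_inverse_real_of_nat] by simp
  have bound: "norm (integral {0..T} (\<lambda>t. b (fk k t) (fk k t)) - integral {0..T} (\<lambda>t. b (f t) (f t)))
      \<le> C * (N k + (r k + r k * l2_sq T f))" for k
  proof -
    have ii: "(\<lambda>t. b (fk k t) (fk k t)) integrable_on {0..T}" "(\<lambda>t. b (f t) (f t)) integrable_on {0..T}"
      using sq_int_bilinear[OF fk fk b, of k k] sq_int_bilinear[OF f f b]
      by (simp_all only: absolutely_integrable_on_def)
    have "integral {0..T} (\<lambda>t. b (fk k t) (fk k t)) - integral {0..T} (\<lambda>t. b (f t) (f t))
        = integral {0..T} (\<lambda>t. b (fk k t) (fk k t) - b (f t) (f t))"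
      by (rule Henstock_Kurzweil_Integration.integral_diff[OF ii, symmetric])
    also have "norm \<dots> \<le> integral {0..T} (\<lambda>t. C * ((norm (d k t))\<^sup>2 + ((norm (d k t))\<^sup>2 / r k + r k * (norm (f t))\<^sup>2)))"
    proof (rule integral_norm_bound_integral)
      show "(\<lambda>t. b (fk k t) (fk k t) - b (f t) (f t)) integrable_on {0..T}"
        by (rule integrable_diff[OF ii])
      show "(\<lambda>t. C * ((norm (d k t))\<^sup>2 + ((norm (d k t))\<^sup>2 / r k + r k * (norm (f t))\<^sup>2))) integrable_on {0..T}"
        using d[of k] f unfolding sq_int_def
        by (intro integrable_on_mult_right integrable_add integrable_on_divide) blast+
      fix t
      have eq: "b (fk k t) (fk k t) - b (f t) (f t) = b (d k t) (d k t) + b (d k t) (f t) + b (f t) (d k t)"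
        by (simp add: d_def b.diff_left b.diff_right)
      have "norm (b (fk k t) (fk k t) - b (f t) (f t))
          \<le> norm (d k t) * norm (d k t) * C + norm (d k t) * norm (f t) * C + norm (f t) * norm (d k t) * C"
        unfolding eq by (intro norm_triangle_mono C(2))
      also have "\<dots> = C * ((norm (d k t))\<^sup>2 + 2 * norm (d k t) * norm (f t))"
        by (simp add: algebra_simps power2_eq_square)
      also have "2 * norm (d k t) * norm (f t) \<le> (norm (d k t))\<^sup>2 / r k + r k * (norm (f t))\<^sup>2"
      proof -
        have "2 * norm (d k t) * (r k * norm (f t)) \<le> (norm (d k t))\<^sup>2 + (r k * norm (f t))\<^sup>2"
          by (rule sum_squares_bound)
        then show ?thesis
          using r0[of k] by (simp add: field_simps power2_eq_square)
      qed
      finally show "norm (b (fk k t) (fk k t) - b (f t) (f t))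
          \<le> C * ((norm (d k t))\<^sup>2 + ((norm (d k t))\<^sup>2 / r k + r k * (norm (f t))\<^sup>2))"
        using C(1) by simp
    qed
    also have "\<dots> = C * (N k + (N k / r k + r k * l2_sq T f))"
    proof -
      have i: "(\<lambda>t. (norm (d k t))\<^sup>2) integrable_on {0..T}" "(\<lambda>t. (norm (f t))\<^sup>2) integrable_on {0..T}"
        using d[of k] f by (auto simp: sq_int_def)
      show ?thesis
        unfolding integral_mult_right
        by (subst Henstock_Kurzweil_Integration.integral_add[OF i(1) integrable_add[OF
              integrable_on_divide[OF i(1)] integrable_on_mult_right[OF i(2)]]],
            subst Henstock_Kurzweil_Integration.integral_add[OF
              integrable_on_divide[OF i(1)] integrable_on_mult_right[OF i(2)]])
           (simp add: N_def l2_sq_def)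
    qed
    also have "\<dots> \<le> C * (N k + (r k + r k * l2_sq T f))"
    proof -
      have "N k = sqrt (N k) * sqrt (N k)" using N0 by simp
      also have "\<dots> \<le> r k * r k"
        using N0 by (intro mult_mono) (auto simp: r_def)
      finally have "N k / r k \<le> r k"
        using r0[of k] by (simp add: field_simps)
      then show ?thesis using C(1) by simp
    qed
    finally show ?thesis .
  qed
  have "(\<lambda>k. C * (N k + (r k + r k * l2_sq T f))) \<longlonglongrightarrow> C * (0 + (0 + 0 * l2_sq T f))"
    by (intro tendsto_intros N r)
  then have "(\<lambda>k. integral {0..T} (\<lambda>t. b (fk k t) (fk k t)) - integral {0..T} (\<lambda>t. b (f t) (f t))) \<longlonglongrightarrow> 0"
    using Lim_null_comparison[OF always_eventually[OF allI[OF bound]]] by simp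
  then show ?thesis
    by (rule LIM_zero_cancel)
qed

section \<open>Density of polynomials in L2\<close>

lemma closest_point_cball_bounds:
  fixes x :: "'a::euclidean_space"
  assumes M: "0 \<le> M"
  shows "norm (x - closest_point (cball 0 M) x) \<le> norm x" "norm (closest_point (cball 0 M) x) \<le> M"
  using closest_point_le[of "cball 0 M" 0 x] closest_point_in_set[of "cball 0 M" x] M
  by (auto simp: dist_norm)

text \<open>The nearest point of a ball is a continuous truncation for vector-valued curves.\<close>

lemma sq_int_clip:
  fixes f :: "real \<Rightarrow> 'a::euclidean_space"
  assumes f: "sq_int T f" and M: "0 \<le> M"
  shows "sq_int T (\<lambda>t. closest_point (cball 0 M) (f t))"
proof -
  have ne: "cball (0::'a) M \<noteq> {}" using M by simp
  have "closest_point (cball (0::'a) M) \<in> borel_measurable borel"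
    using ne by (intro borel_measurable_continuous_onI continuous_on_closest_point) auto
  then have "(\<lambda>t. closest_point (cball 0 M) (f t)) \<in> borel_measurable (lebesgue_on {0..T})"
    using f measurable_compose[of f _ borel "closest_point (cball 0 M)"] by (auto simp: sq_int_def)
  then show "sq_int T (\<lambda>t. closest_point (cball 0 M) (f t))"
  proof (rule sq_int_bound[OF f, of _ 2])
    show "norm (closest_point (cball 0 M) (f t)) \<le> 2 * norm (f t)" for t
      using closest_point_cball_bounds(1)[OF M, of "f t"] norm_triangle_ineq2[of "closest_point (cball 0 M) (f t)" "f t"]
      by (simp add: norm_minus_commute)
  qed
qed

text \<open>Three approximations: by a truncation of \<open>f\<close>, by a truncated member of a
  sequence of continuous functions converging almost everywhere, and by a polynomial through
  Stone-Weierstrass. The first two use dominated convergence.\<close>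

lemma l2_dense_polynomial:
  fixes f :: "real \<Rightarrow> 'a::euclidean_space"
  assumes f: "sq_int T f" and e: "0 < e"
  obtains p where "polynomial_function p" "l2_sq T (\<lambda>t. f t - p t) < e"
proof -
  \<comment> \<open>For squared norms each triangle inequality costs a factor 2: two errors e/16
    combine to e/4, and two errors e/4 combine to e.\<close>
  have trans: "l2_sq T (\<lambda>t. f t - h t) < 2 * a + 2 * b"
    if "sq_int T f" "sq_int T g" "sq_int T h" "l2_sq T (\<lambda>t. f t - g t) < a" "l2_sq T (\<lambda>t. g t - h t) < b"
    for f g h :: "real \<Rightarrow> 'a" and a b
    using l2_sq_add_le[of T "\<lambda>t. f t - g t" "\<lambda>t. g t - h t"] that by (simp add: sq_int_diff)
  let ?c = "\<lambda>M. closest_point (cball (0::'a) M)"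
  obtain M where M: "0 \<le> M" "l2_sq T (\<lambda>t. f t - ?c M (f t)) < e / 16"
  proof -
    have "(\<lambda>k. integral {0..T} (\<lambda>t. (norm (f t - ?c (real k) (f t)))\<^sup>2)) \<longlonglongrightarrow> integral {0..T} (\<lambda>t. 0::real)"
    proof (rule dominated_convergence(2)[where h = "\<lambda>t. (norm (f t))\<^sup>2"])
      show "(\<lambda>t. (norm (f t - ?c (real k) (f t)))\<^sup>2) integrable_on {0..T}" for k
        using sq_int_diff[OF f sq_int_clip[OF f, of "real k"]] by (simp add: sq_int_def)
      show "norm ((norm (f t - ?c (real k) (f t)))\<^sup>2) \<le> (norm (f t))\<^sup>2" for k t
        using closest_point_cball_bounds(1)[of "real k" "f t"] by (simp add: power_mono)
      show "(\<lambda>k. (norm (f t - ?c (real k) (f t)))\<^sup>2) \<longlonglongrightarrow> 0" for t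
      proof (rule tendsto_eventually)
        obtain K :: nat where "norm (f t) \<le> real K" using real_arch_simple by blast
        then have "norm (f t) \<le> real k" if "k \<ge> K" for k
          using that by linarith
        then show "\<forall>\<^sub>F k in sequentially. (norm (f t - ?c (real k) (f t)))\<^sup>2 = 0"
          by (auto simp: eventually_sequentially intro!: exI[of _ K] closest_point_self[symmetric])
      qed
    qed (use f in \<open>auto simp: sq_int_def\<close>)
    then have "\<forall>\<^sub>F k in sequentially. l2_sq T (\<lambda>t. f t - ?c (real k) (f t)) < e / 16"
      unfolding l2_sq_def using e by (rule_tac order_tendstoD(2)) auto
    then obtain k where "l2_sq T (\<lambda>t. f t - ?c (real k) (f t)) < e / 16"
      by (rule eventually_happens'[OF sequentially_bot, THEN exE])
    then show ?thesis
      by (rule that[rotated]) simp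
  qed
  define w where "w t = ?c M (f t)" for t
  have w: "sq_int T w" unfolding w_def by (rule sq_int_clip[OF f M(1)])
  obtain h where h: "continuous_on UNIV h" "l2_sq T (\<lambda>t. w t - h t) < e / 16"
  proof -
    have "w measurable_on {0..T}"
      using w by (simp add: measurable_on_iff_borel_measurable sq_int_def)
    then obtain N g where N: "negligible N" and g: "\<And>n. continuous_on UNIV (g n)"
      and lim0: "\<And>x. x \<notin> N \<Longrightarrow> (\<lambda>n. g n x) \<longlonglongrightarrow> (if x \<in> {0..T} then w x else 0)"
      unfolding measurable_on_def by blast
    have lim: "(\<lambda>n. g n x) \<longlonglongrightarrow> w x" if "x \<notin> N" "x \<in> {0..T}" for x
      using lim0[OF that(1)] that(2) by simp
    \<comment> \<open>Truncating the \<open>g n\<close> at height \<open>M\<close> preserves the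
      limit, because \<open>w\<close> already lies in the ball, and supplies the dominating constant
      (2 M)^2.\<close>
    have ccont: "continuous_on UNIV (?c M)"
      using M(1) by (intro continuous_on_closest_point) auto
    have cg: "continuous_on UNIV (\<lambda>t. ?c M (g n t))" for n
      using continuous_on_compose2[OF ccont g] by simp
    have "(\<lambda>n. integral {0..T} (\<lambda>t. if t \<in> N then 0 else (norm (w t - ?c M (g n t)))\<^sup>2)) \<longlonglongrightarrow> integral {0..T} (\<lambda>t. 0::real)"
    proof (rule dominated_convergence(2)[where h = "\<lambda>t. (2 * M)\<^sup>2"])
      show "(\<lambda>t. if t \<in> N then 0 else (norm (w t - ?c M (g n t)))\<^sup>2) integrable_on {0..T}" for n
      proof (rule integrable_spike[OF _ N])
        show "(\<lambda>t. (norm (w t - ?c M (g n t)))\<^sup>2) integrable_on {0..T}"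
          using sq_int_diff[OF w sq_int_continuous[OF continuous_on_subset[OF cg]]] by (simp add: sq_int_def)
      qed auto
      show "norm (if t \<in> N then 0 else (norm (w t - ?c M (g n t)))\<^sup>2) \<le> (2 * M)\<^sup>2" for n t
      proof -
        have "norm (w t - ?c M (g n t)) \<le> 2 * M"
          using norm_triangle_ineq4[of "w t" "?c M (g n t)"] closest_point_cball_bounds(2)[OF M(1), of "f t"]
            closest_point_cball_bounds(2)[OF M(1), of "g n t"] by (simp add: w_def)
        then have "(norm (w t - ?c M (g n t)))\<^sup>2 \<le> (2 * M)\<^sup>2"
          by (intro power_mono) auto
        then show ?thesis by simp
      qed
      show "(\<lambda>n. if t \<in> N then 0 else (norm (w t - ?c M (g n t)))\<^sup>2) \<longlonglongrightarrow> 0" if t: "t \<in> {0..T}" for t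
      proof (cases "t \<in> N")
        case False
        have "(\<lambda>n. ?c M (g n t)) \<longlonglongrightarrow> ?c M (w t)"
          using ccont lim[OF False t] by (intro isCont_tendsto_compose[of _ "?c M"]) (auto simp: continuous_on_eq_continuous_at)
        moreover have "?c M (w t) = w t"
          using closest_point_cball_bounds(2)[OF M(1), of "f t"] by (intro closest_point_self) (simp add: w_def)
        ultimately have "(\<lambda>n. (norm (w t - ?c M (g n t)))\<^sup>2) \<longlonglongrightarrow> (norm (w t - w t))\<^sup>2"
          by (intro tendsto_intros) simp
        then show ?thesis using False by simp
      qed simp
    qed (rule integrable_const_ivl)
    moreover have "integral {0..T} (\<lambda>t. if t \<in> N then 0 else (norm (w t - ?c M (g n t)))\<^sup>2)
        = l2_sq T (\<lambda>t. w t - ?c M (g n t))" for n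
      unfolding l2_sq_def by (rule integral_spike[OF N]) auto
    ultimately have "\<forall>\<^sub>F n in sequentially. l2_sq T (\<lambda>t. w t - ?c M (g n t)) < e / 16"
      using e by (rule_tac order_tendstoD(2)) auto
    then obtain n where "l2_sq T (\<lambda>t. w t - ?c M (g n t)) < e / 16"
      by (rule eventually_happens'[OF sequentially_bot, THEN exE])
    then show ?thesis
      using that[OF cg] by blast
  qed
  have hs: "sq_int T h" by (rule sq_int_continuous[OF continuous_on_subset[OF h(1)]]) simp
  \<comment> \<open>The summand 1 keeps the division in \<open>\<epsilon>\<close> meaningful for
    \<open>T = 0\<close>; the absolute value covers negative \<open>T\<close>, where the interval is
    empty.\<close>
  define \<kappa> where "\<kappa> = 1 + \<bar>T\<bar>"
  define \<epsilon> where "\<epsilon> = sqrt (e / (8 * \<kappa>))"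
  have \<kappa>: "0 < \<kappa>" "\<bar>T\<bar> \<le> \<kappa>" by (auto simp: \<kappa>_def)
  have "\<epsilon>\<^sup>2 * \<bar>T\<bar> \<le> \<epsilon>\<^sup>2 * \<kappa>"
    using \<kappa> by (intro mult_left_mono) auto
  also have "\<dots> = e / 8"
    using e \<kappa> by (simp add: \<epsilon>_def)
  also have "\<dots> < e / 4" using e by simp
  finally have \<epsilon>: "0 < \<epsilon>" "\<epsilon>\<^sup>2 * \<bar>T\<bar> < e / 4"
    using e \<kappa> by (simp_all add: \<epsilon>_def)
  obtain p where p: "polynomial_function p" "\<And>x. x \<in> {0..T} \<Longrightarrow> norm (h x - p x) < \<epsilon>"
    using Stone_Weierstrass_polynomial_function[of "{0..T}" h \<epsilon>] \<epsilon>(1) continuous_on_subset[OF h(1)] by auto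
  have ps: "sq_int T p"
    by (intro sq_int_continuous continuous_on_polymonial_function p)
  have "l2_sq T (\<lambda>t. h t - p t) \<le> integral {0..T} (\<lambda>t. \<epsilon>\<^sup>2)"
    unfolding l2_sq_def
  proof (rule integral_le)
    show "(\<lambda>t. (norm (h t - p t))\<^sup>2) integrable_on {0..T}"
      using sq_int_diff[OF hs ps] by (simp add: sq_int_def)
    show "(norm (h t - p t))\<^sup>2 \<le> \<epsilon>\<^sup>2" if "t \<in> {0..T}" for t
      using p(2)[OF that] by (intro power_mono) auto
  qed auto
  also have "\<dots> \<le> \<epsilon>\<^sup>2 * \<bar>T\<bar>"
    by (cases "0 \<le> T") (auto simp: mult_le_0_iff)
  also have "\<dots> < e / 4" by (rule \<epsilon>(2))
  finally have 3: "l2_sq T (\<lambda>t. h t - p t) < e / 4" .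
  have "l2_sq T (\<lambda>t. f t - h t) < 2 * (e / 16) + 2 * (e / 16)"
    using M(2) h(2) by (intro trans[OF f w hs]) (simp_all only: w_def)
  then have "l2_sq T (\<lambda>t. f t - h t) < e / 4" by simp
  from trans[OF f hs ps this 3] have "l2_sq T (\<lambda>t. f t - p t) < e" by simp
  with p(1) show ?thesis by (rule that)
qed

subsection \<open>Weak derivatives and the continuous extension of the second variation\<close>

lemma h1_deriv_sq_int: "h1_deriv T Y Z \<Longrightarrow> sq_int T Z"
proof -
  have "{0..T} \<in> sets lebesgue" by simp
  then show "h1_deriv T Y Z \<Longrightarrow> sq_int T Z"
    using absolutely_integrable_imp_borel_measurable unfolding h1_deriv_def sq_int_def by blast
qed

lemma h1_derivI: "sq_int T Z \<Longrightarrow> (\<And>t. t \<in> {0..T} \<Longrightarrow> Y t = Y 0 + integral {0..t} Z) \<Longrightarrow> h1_deriv T Y Z"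
  using sq_int_imp_absolutely_integrable[of T Z] unfolding h1_deriv_def sq_int_def by blast

lemma h1_deriv_eq: "h1_deriv T Y Z \<Longrightarrow> t \<in> {0..T} \<Longrightarrow> Y t = Y 0 + integral {0..t} Z"
  unfolding h1_deriv_def by blast

lemma h1_deriv_integrable: "h1_deriv T Y Z \<Longrightarrow> Z integrable_on {0..T}"
  unfolding h1_deriv_def absolutely_integrable_on_def by blast

lemma h1_deriv_continuous:
  assumes "h1_deriv T Y Z"
  shows "continuous_on {0..T} Y"
proof -
  have "continuous_on {0..T} (\<lambda>t. Y 0 + integral {0..t} Z)"
    by (intro continuous_intros indefinite_integral_continuous_1 h1_deriv_integrable[OF assms])
  then show ?thesis
    by (rule continuous_on_eq) (rule h1_deriv_eq[OF assms, symmetric])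
qed

lemma h1_deriv_C1:
  assumes Y: "\<And>t. t \<in> {0..T} \<Longrightarrow> (Y has_vector_derivative Z t) (at t within {0..T})"
    and Z: "continuous_on {0..T} Z"
  shows "h1_deriv T Y Z"
proof (rule h1_derivI[OF sq_int_continuous[OF Z]])
  fix t assume t: "t \<in> {0..T}"
  have "(Z has_integral Y t - Y 0) {0..t}"
    using t by (intro fundamental_theorem_of_calculus) (auto intro: has_vector_derivative_within_subset[OF Y])
  then show "Y t = Y 0 + integral {0..t} Z"
    by (simp add: integral_unique)
qed

text \<open>The sum of a \<open>C\<^sup>1\<close> function and a steep linear function is monotone, so the second mean
  value theorem tests against all \<open>C\<^sup>1\<close> functions.\<close>

lemma integral_mult_C1_eq_0:
  fixes w p :: "real \<Rightarrow> real"
  assumes w: "w integrable_on {0..T}" and T: "0 \<le> T" and z: "\<And>t. t \<in> {0..T} \<Longrightarrow> integral {0..t} w = 0"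
    and p: "\<And>t. (p has_real_derivative p' t) (at t)" and p': "continuous_on UNIV p'"
  shows "((\<lambda>t. p t * w t) has_integral 0) {0..T}"
proof -
  have mono0: "((\<lambda>t. g t * w t) has_integral 0) {0..T}"
    if g: "\<And>x y. \<lbrakk>0 \<le> x; x \<le> y; y \<le> T\<rbrakk> \<Longrightarrow> g x \<le> g y" for g :: "real \<Rightarrow> real"
  proof -
    obtain c where c: "c \<in> {0..T}"
      "((\<lambda>x. g x * w x) has_integral (g 0 * integral {0..c} w + g T * integral {c..T} w)) {0..T}"
      by (rule second_mean_value_theorem_full[OF w T, of g]) (use g in auto)
    moreover have "integral {c..T} w = 0"
      using Henstock_Kurzweil_Integration.integral_combine[of 0 c T w] w c(1) z[of T] z[of c] by simp
    ultimately show ?thesis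
      using z[of c] by simp
  qed
  have "bounded (p' ` {0..T})"
    by (intro compact_imp_bounded compact_continuous_image continuous_on_subset[OF p']) auto
  then obtain K where K: "0 < K" "\<And>x. x \<in> {0..T} \<Longrightarrow> \<bar>p' x\<bar> \<le> K"
    by (auto simp: bounded_pos)
  have mono: "p x + K * x \<le> p y + K * y" if "0 \<le> x" "x \<le> y" "y \<le> T" for x y
  proof (rule DERIV_nonneg_imp_nondecreasing[OF that(2)])
    fix u assume "x \<le> u" "u \<le> y"
    then have "0 \<le> p' u + K"
      using K(2)[of u] that by simp
    moreover have "((\<lambda>x. p x + K * x) has_real_derivative p' u + K) (at u)"
      by (auto intro!: derivative_eq_intros p)
    ultimately show "\<exists>D. ((\<lambda>x. p x + K * x) has_real_derivative D) (at u) \<and> 0 \<le> D" by blast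
  qed
  have "((\<lambda>t. (p t + K * t) * w t) has_integral 0) {0..T}"
    by (rule mono0) (rule mono)
  moreover have "((\<lambda>t. (K * t) * w t) has_integral 0) {0..T}"
    by (rule mono0) (use K(1) in simp)
  ultimately have "((\<lambda>t. (p t + K * t) * w t - (K * t) * w t) has_integral 0 - 0) {0..T}"
    by (rule has_integral_diff)
  then show ?thesis by (simp add: ring_distribs)
qed

text \<open>\<open>w\<close> is orthogonal to every polynomial \<open>p\<close>, so by Pythagoras
  its squared norm is at most that of w - p, which is arbitrarily small by density.\<close>

lemma l2_sq_eq_0_if_integrals_0:
  fixes w :: "real \<Rightarrow> 'a::euclidean_space"
  assumes w: "sq_int T w" and T: "0 \<le> T" and z: "\<And>t. t \<in> {0..T} \<Longrightarrow> integral {0..t} w = 0"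
  shows "l2_sq T w = 0"
proof (rule antisym[OF _ l2_sq_nonneg], rule field_le_epsilon)
  fix e :: real assume e: "0 < e"
  obtain p where p: "polynomial_function p" "l2_sq T (\<lambda>t. w t - p t) < e"
    using l2_dense_polynomial[OF w e] by blast
  obtain p' where p': "polynomial_function p'" "\<And>x. (p has_vector_derivative p' x) (at x)"
    using has_vector_derivative_polynomial_function[OF p(1)] by blast
  have ps: "sq_int T p"
    by (intro sq_int_continuous continuous_on_polymonial_function p)
  have wi: "w integrable_on {0..t}" if "t \<in> {0..T}" for t
    using integrable_on_subinterval[OF set_lebesgue_integral_eq_integral(1)[OF sq_int_imp_absolutely_integrable[OF w]], of 0 t] that
    by auto
  have "((\<lambda>t. (p t \<bullet> b) * (w t \<bullet> b)) has_integral 0) {0..T}" if "b \<in> Basis" for b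
  proof (rule integral_mult_C1_eq_0[OF _ T])
    show "(\<lambda>t. w t \<bullet> b) integrable_on {0..T}"
      using wi[of T] T by (auto intro: integrable_component)
    show "integral {0..t} (\<lambda>t. w t \<bullet> b) = 0" if "t \<in> {0..T}" for t
      using integral_component_eq[OF wi[OF that], of b] z[OF that] by simp
    show "((\<lambda>t. p t \<bullet> b) has_real_derivative p' t \<bullet> b) (at t)" for t
      using bounded_linear.has_vector_derivative[OF bounded_linear_inner_left p'(2)]
      by (simp add: has_real_derivative_iff_has_vector_derivative)
    show "continuous_on UNIV (\<lambda>t. p' t \<bullet> b)"
      by (intro continuous_intros continuous_on_polymonial_function p')
  qed
  then have "((\<lambda>t. \<Sum>b\<in>Basis. (p t \<bullet> b) * (w t \<bullet> b)) has_integral (\<Sum>b\<in>(Basis :: 'a set). 0)) {0..T}"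
    by (intro has_integral_sum) auto
  then have pw: "((\<lambda>t. p t \<bullet> w t) has_integral 0) {0..T}"
    by (simp flip: euclidean_inner)
  have i: "((\<lambda>t. (norm (w t))\<^sup>2) has_integral l2_sq T w) {0..T}"
    "((\<lambda>t. (norm (w t - p t))\<^sup>2) has_integral l2_sq T (\<lambda>t. w t - p t)) {0..T}"
    using w sq_int_diff[OF w ps] by (auto simp: sq_int_def l2_sq_def)
  have "l2_sq T w - 2 * 0 \<le> l2_sq T (\<lambda>t. w t - p t)"
  proof (rule has_integral_le[OF has_integral_diff[OF i(1) has_integral_mult_right[OF pw]] i(2)])
    show "(norm (w t))\<^sup>2 - 2 * (p t \<bullet> w t) \<le> (norm (w t - p t))\<^sup>2" for t
      by (simp add: power2_norm_eq_inner inner_diff_left inner_diff_right inner_commute)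
  qed
  then show "l2_sq T w \<le> 0 + e"
    using p(2) by simp
qed

text \<open>Different occurrences of \<open>h1_deriv\<close> may choose different weak derivatives
  of one curve; this makes integrals of \<open>var_form\<close> independent of the choice.\<close>

lemma h1_deriv_unique:
  assumes "h1_deriv T Y Z" "h1_deriv T Y Z'" "0 \<le> T"
  shows "l2_sq T (\<lambda>t. Z t - Z' t) = 0"
proof (rule l2_sq_eq_0_if_integrals_0[OF sq_int_diff assms(3)])
  show "integral {0..t} (\<lambda>t. Z t - Z' t) = 0" if t: "t \<in> {0..T}" for t
  proof -
    have "Z integrable_on {0..t}" "Z' integrable_on {0..t}"
      using t by (auto intro!: integrable_on_subinterval[OF h1_deriv_integrable[OF assms(1)]]
          integrable_on_subinterval[OF h1_deriv_integrable[OF assms(2)]])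
    moreover have "integral {0..t} Z = integral {0..t} Z'"
      using h1_deriv_eq[OF assms(1) t] h1_deriv_eq[OF assms(2) t] by (metis add_left_imp_eq)
    ultimately show ?thesis
      by (simp add: Henstock_Kurzweil_Integration.integral_diff)
  qed
qed (use assms in \<open>auto intro: h1_deriv_sq_int\<close>)

lemma sq_int_h1_pair:
  assumes "h1_deriv T Y Z"
  shows "sq_int T (\<lambda>t. (Y t, Z t))"
  by (intro sq_int_Pair sq_int_continuous h1_deriv_continuous[OF assms] h1_deriv_sq_int[OF assms])

lemma l2_sq_Pair:
  assumes "sq_int T f" "sq_int T g"
  shows "l2_sq T (\<lambda>t. (f t, g t)) = l2_sq T f + l2_sq T g"
  using assms
  by (simp add: l2_sq_def norm_Pair sq_int_def Henstock_Kurzweil_Integration.integral_add)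

text \<open>L2 convergence of the derivatives implies L1 convergence by \<open>l1_le_l2\<close>, and
  the curves are recovered by integration from 0. This gives meaning to limits of values at single
  instants, which the division points require.\<close>

lemma h1_conv_uniform:
  assumes Yk: "\<And>k. h1_deriv T (Yk k) (Zk k)" and Y: "h1_deriv T Y Z" and T: "0 \<le> T"
    and lim0: "(\<lambda>k. Yk k 0) \<longlonglongrightarrow> Y 0"
    and lim: "(\<lambda>k. l2_sq T (\<lambda>t. Zk k t - Z t)) \<longlonglongrightarrow> 0"
  obtains \<eta> where "\<eta> \<longlonglongrightarrow> 0" "\<And>k t. t \<in> {0..T} \<Longrightarrow> norm (Yk k t - Y t) \<le> \<eta> k"
proof -
  define N where "N k = l2_sq T (\<lambda>t. Zk k t - Z t)" for k
  define r where "r k = sqrt (N k) + inverse (real (Suc k))" for k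
  have N0: "0 \<le> N k" for k by (simp add: N_def l2_sq_nonneg)
  have r0: "0 < r k" for k using N0[of k] by (simp add: r_def add_nonneg_pos)
  have r: "r \<longlonglongrightarrow> 0"
    unfolding r_def[abs_def]
    using tendsto_add[OF tendsto_real_sqrt[OF lim] LIMSEQ_inverse_real_of_nat] by (simp add: N_def)
  have d: "sq_int T (\<lambda>t. Zk k t - Z t)" for k
    by (intro sq_int_diff h1_deriv_sq_int[OF Yk] h1_deriv_sq_int[OF Y])
  show ?thesis
  proof
    have "(\<lambda>k. norm (Yk k 0 - Y 0) + (r k * T + r k)) \<longlonglongrightarrow> norm (Y 0 - Y 0) + (0 * T + 0)"
      by (intro tendsto_intros lim0 r)
    then show "(\<lambda>k. norm (Yk k 0 - Y 0) + (r k * T + r k)) \<longlonglongrightarrow> 0" by simp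
    fix k t assume t: "t \<in> {0..T}"
    have int: "(\<lambda>t. norm (Zk k t - Z t)) integrable_on {0..T}" "(\<lambda>t. Zk k t - Z t) integrable_on {0..T}"
      using sq_int_imp_absolutely_integrable[OF d[of k]] by (simp_all only: absolutely_integrable_on_def)
    have "Yk k t - Y t = (Yk k 0 - Y 0) + (integral {0..t} (Zk k) - integral {0..t} Z)"
      by (subst h1_deriv_eq[OF Yk t], subst h1_deriv_eq[OF Y t]) simp
    also have "integral {0..t} (Zk k) - integral {0..t} Z = integral {0..t} (\<lambda>t. Zk k t - Z t)"
      using t by (intro Henstock_Kurzweil_Integration.integral_diff[symmetric])
        (auto intro!: integrable_on_subinterval[OF h1_deriv_integrable[OF Yk]]
          integrable_on_subinterval[OF h1_deriv_integrable[OF Y]])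
    finally have "norm (Yk k t - Y t) \<le> norm (Yk k 0 - Y 0) + norm (integral {0..t} (\<lambda>t. Zk k t - Z t))"
      by (simp add: norm_triangle_ineq)
    also have "norm (integral {0..t} (\<lambda>t. Zk k t - Z t)) \<le> integral {0..t} (\<lambda>t. norm (Zk k t - Z t))"
      using t by (intro integral_norm_bound_integral) (auto intro: integrable_on_subinterval[OF int(1)] integrable_on_subinterval[OF int(2)])
    also have "\<dots> \<le> integral {0..T} (\<lambda>t. norm (Zk k t - Z t))"
      using t by (intro integral_subset_le) (auto intro: integrable_on_subinterval[OF int(1)] int(1))
    also have "\<dots> \<le> r k * T + N k / r k"
      using l1_le_l2[OF d r0 T] by (simp add: N_def)
    also have "N k / r k \<le> r k"
    proof -
      have "N k = sqrt (N k) * sqrt (N k)" using N0 by simp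
      also have "\<dots> \<le> r k * r k"
        using N0 by (intro mult_mono) (auto simp: r_def)
      finally show ?thesis using r0[of k] by (simp add: field_simps)
    qed
    finally show "norm (Yk k t - Y t) \<le> norm (Yk k 0 - Y 0) + (r k * T + r k)" by simp
  qed
qed

lemma h1_conv_pair:
  assumes Yk: "\<And>k. h1_deriv T (Yk k) (Zk k)" and Y: "h1_deriv T Y Z" and T: "0 \<le> T"
    and lim0: "(\<lambda>k. Yk k 0) \<longlonglongrightarrow> Y 0"
    and lim: "(\<lambda>k. l2_sq T (\<lambda>t. Zk k t - Z t)) \<longlonglongrightarrow> 0"
  shows "(\<lambda>k. l2_sq T (\<lambda>t. (Yk k t, Zk k t) - (Y t, Z t))) \<longlonglongrightarrow> 0"
proof -
  obtain \<eta> where \<eta>: "\<eta> \<longlonglongrightarrow> 0" "\<And>k t. t \<in> {0..T} \<Longrightarrow> norm (Yk k t - Y t) \<le> \<eta> k"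
    using h1_conv_uniform[OF assms] by blast
  have dY: "sq_int T (\<lambda>t. Yk k t - Y t)" for k
    by (intro sq_int_diff sq_int_continuous h1_deriv_continuous[OF Yk] h1_deriv_continuous[OF Y])
  have dZ: "sq_int T (\<lambda>t. Zk k t - Z t)" for k
    by (intro sq_int_diff h1_deriv_sq_int[OF Yk] h1_deriv_sq_int[OF Y])
  have "(\<lambda>k. l2_sq T (\<lambda>t. Yk k t - Y t)) \<longlonglongrightarrow> 0"
  proof (rule tendsto_sandwich[OF _ _ tendsto_const])
    have "l2_sq T (\<lambda>t. Yk k t - Y t) \<le> T * (\<eta> k)\<^sup>2" for k
    proof -
      have "l2_sq T (\<lambda>t. Yk k t - Y t) \<le> integral {0..T} (\<lambda>t. (\<eta> k)\<^sup>2)"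
        unfolding l2_sq_def
      proof (rule integral_le)
        show "(\<lambda>t. (norm (Yk k t - Y t))\<^sup>2) integrable_on {0..T}"
          using dY by (simp add: sq_int_def)
        show "(norm (Yk k t - Y t))\<^sup>2 \<le> (\<eta> k)\<^sup>2" if "t \<in> {0..T}" for t
          using \<eta>(2)[OF that] by (intro power_mono) auto
      qed (rule integrable_const_ivl)
      then show ?thesis using T by simp
    qed
    then show "\<forall>\<^sub>F k in sequentially. l2_sq T (\<lambda>t. Yk k t - Y t) \<le> T * (\<eta> k)\<^sup>2"
      by (simp add: always_eventually)
    have "(\<lambda>k. T * (\<eta> k)\<^sup>2) \<longlonglongrightarrow> T * 0\<^sup>2"
      by (intro tendsto_intros \<eta>(1))
    then show "(\<lambda>k. T * (\<eta> k)\<^sup>2) \<longlonglongrightarrow> 0" by simp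
  qed (simp add: l2_sq_nonneg always_eventually)
  from tendsto_add[OF this lim] show ?thesis
    by (simp add: l2_sq_Pair[OF dY dZ])
qed

lemma polynomial_function_smooth:
  fixes p :: "real \<Rightarrow> 'a::euclidean_space"
  assumes "polynomial_function p"
  obtains D where "D 0 = p" "\<And>k t. (D k has_vector_derivative D (Suc k) t) (at t)"
proof -
  have "\<forall>q. \<exists>q'. polynomial_function q \<longrightarrow> polynomial_function q' \<and> (\<forall>t. ((q :: real \<Rightarrow> 'a) has_vector_derivative q' t) (at t))"
    using has_vector_derivative_polynomial_function by metis
  then obtain S where S: "\<And>q. polynomial_function q \<Longrightarrow> polynomial_function (S q)"
    "\<And>q t. polynomial_function q \<Longrightarrow> ((q :: real \<Rightarrow> 'a) has_vector_derivative S q t) (at t)"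
    by metis
  define D where "D k = (S ^^ k) p" for k
  have "polynomial_function (D k)" for k
    by (induction k) (auto simp: D_def assms S)
  then show ?thesis
    using that[of D] S(2) by (simp add: D_def)
qed

section \<open>Smooth variations are dense, and the second variation extends continuously\<close>

interpretation omega0: bounded_bilinear "omega0 :: 'n::finite pvec \<Rightarrow> 'n pvec \<Rightarrow> real"
proof -
  have "bilinear (omega0 :: 'n pvec \<Rightarrow> 'n pvec \<Rightarrow> real)"
    unfolding bilinear_def omega0_def
    by (auto intro!: linearI simp: sum.distrib sum_subtractf sum_distrib_left algebra_simps)
  then show "bounded_bilinear (omega0 :: 'n pvec \<Rightarrow> 'n pvec \<Rightarrow> real)"
    by (simp add: bilinear_conv_bounded_bilinear)
qed

interpretation matvec: bounded_bilinear
  "(*v) :: real ^ 'a::finite ^ 'b::finite \<Rightarrow> real ^ 'a \<Rightarrow> real ^ 'b"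
proof -
  have "bilinear ((*v) :: real ^ 'a ^ 'b \<Rightarrow> real ^ 'a \<Rightarrow> real ^ 'b)"
    unfolding bilinear_def
    by (auto intro!: linearI simp: matrix_vector_mult_def vec_eq_iff sum.distrib sum_distrib_left algebra_simps)
  then show "bounded_bilinear ((*v) :: real ^ 'a ^ 'b \<Rightarrow> real ^ 'a \<Rightarrow> real ^ 'b)"
    by (simp add: bilinear_conv_bounded_bilinear)
qed

lemma in_spD: "in_sp X \<Longrightarrow> omega0 u (X *v v) = omega0 v (X *v u)"
  unfolding in_sp_def by blast

lemma subspace_sp: "subspace {X :: 'n::finite pmat. in_sp X}"
proof (rule subspaceI, unfold mem_Collect_eq)
  show "in_sp (0 :: 'n pmat)" by (simp add: in_sp_def omega0.zero_right)
  show "in_sp (X + Y)" if "in_sp X" "in_sp Y" for X Y :: "'n pmat"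
    unfolding in_sp_def matvec.add_left omega0.add_right
    by (intro allI arg_cong2[where f = "(+)"] in_spD that)
  show "in_sp (c *\<^sub>R X)" if "in_sp X" for c and X :: "'n pmat"
    unfolding in_sp_def matvec.scaleR_left omega0.scaleR_right
    by (intro allI arg_cong2[where f = "(*\<^sub>R)"] refl in_spD that)
qed

text \<open>The weak derivative is approximated by polynomials, corrected to have integral 0,
  integrated, and projected onto sp(2n). The projection is linear, so it preserves smoothness and
  the end conditions, and it fixes \<open>Y\<close> on [0,T].\<close>

lemma smooth_var_dense:
  fixes Y :: "real \<Rightarrow> 'n::finite pmat"
  assumes Y: "Y \<in> H1_0_sp T" and T: "0 < T"
  obtains Ys where "\<And>k. smooth_var T (Ys k)" "h1_conv T Ys Y"
proof -
  have Y0: "Y 0 = 0" "Y T = 0" and Ysp: "\<And>t. t \<in> {0..T} \<Longrightarrow> in_sp (Y t)"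
    using Y by (auto simp: H1_0_sp_def)
  obtain Z where Z: "h1_deriv T Y Z"
    using Y by (auto simp: H1_0_sp_def)
  note Zs = h1_deriv_sq_int[OF Z]
  \<comment> \<open>A linear projection onto sp(2n), as a left inverse of the identity on that
    subspace.\<close>
  obtain P :: "'n pmat \<Rightarrow> 'n pmat" where P: "linear P" "\<And>X. in_sp (P X)" "\<And>X. in_sp X \<Longrightarrow> P X = X"
    using linear_exists_left_inverse_on[OF linear_id subspace_sp] by auto
  have Pb: "bounded_linear P" using P(1) by (simp add: linear_conv_bounded_linear)
  obtain C where C: "\<And>x. norm (P x) \<le> norm x * C"
    using bounded_linear.bounded[OF Pb] by blast
  have "\<forall>k. \<exists>p. polynomial_function p \<and> l2_sq T (\<lambda>t. Z t - p t) < inverse (real (Suc k))"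
    using l2_dense_polynomial[OF Zs] by (metis inverse_positive_iff_positive of_nat_0_less_iff zero_less_Suc)
  then obtain p where p: "\<And>k. polynomial_function (p k)" "\<And>k. l2_sq T (\<lambda>t. Z t - p k t) < inverse (real (Suc k))"
    by metis
  have ps: "sq_int T (p k)" for k
    by (intro sq_int_continuous continuous_on_polymonial_function p)
  have pZ: "(\<lambda>k. l2_sq T (\<lambda>t. p k t - Z t)) \<longlonglongrightarrow> 0"
  proof (rule tendsto_sandwich[OF _ _ tendsto_const LIMSEQ_inverse_real_of_nat])
    show "\<forall>\<^sub>F k in sequentially. l2_sq T (\<lambda>t. p k t - Z t) \<le> inverse (real (Suc k))"
      using p(2) by (auto intro!: always_eventually less_imp_le simp: l2_sq_def norm_minus_commute)
  qed (simp add: l2_sq_nonneg always_eventually)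
  \<comment> \<open>The mean of \<open>p k\<close>; subtracting it makes the antiderivative return
    to its initial value at \<open>T\<close>. It tends to 0 because the integrals of
    \<open>p k\<close> tend to \<open>Y T = 0\<close>.\<close>
  define c where "c k = integral {0..T} (p k) /\<^sub>R T" for k
  have c: "c \<longlonglongrightarrow> 0"
  proof -
    have "h1_deriv T (\<lambda>t. integral {0..t} (p k)) (p k)" for k
      by (rule h1_derivI[OF ps]) simp
    then obtain \<eta> where \<eta>: "\<eta> \<longlonglongrightarrow> 0" "\<And>k t. t \<in> {0..T} \<Longrightarrow> norm (integral {0..t} (p k) - Y t) \<le> \<eta> k"
      using h1_conv_uniform[OF _ Z _ _ pZ, of "\<lambda>k t. integral {0..t} (p k)"] T Y0 by auto
    have "(\<lambda>k. integral {0..T} (p k)) \<longlonglongrightarrow> 0"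
      by (rule Lim_null_comparison[OF _ \<eta>(1)]) (use \<eta>(2)[of T] T Y0 in \<open>simp add: always_eventually\<close>)
    from tendsto_scaleR[OF tendsto_const this, of "inverse T"] show ?thesis
      by (simp add: c_def[abs_def])
  qed
  define q where "q k t = p k t - c k" for k t
  have q: "polynomial_function (q k)" for k
    unfolding q_def[abs_def] by (intro polynomial_function_diff p polynomial_function_const)
  have qs: "sq_int T (q k)" for k
    by (intro sq_int_continuous continuous_on_polymonial_function q)
  have qZ: "(\<lambda>k. l2_sq T (\<lambda>t. q k t - Z t)) \<longlonglongrightarrow> 0"
  proof (rule tendsto_sandwich[OF _ _ tendsto_const])
    have "l2_sq T (\<lambda>t. q k t - Z t) \<le> 2 * l2_sq T (\<lambda>t. p k t - Z t) + 2 * (T * (norm (c k))\<^sup>2)" for k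
      using l2_sq_add_le[OF sq_int_diff[OF ps Zs] sq_int_continuous[OF continuous_on_const], of k "- c k"] T
      by (simp add: q_def algebra_simps l2_sq_def)
    then show "\<forall>\<^sub>F k in sequentially. l2_sq T (\<lambda>t. q k t - Z t) \<le> 2 * l2_sq T (\<lambda>t. p k t - Z t) + 2 * (T * (norm (c k))\<^sup>2)"
      by (simp add: always_eventually)
    have "(\<lambda>k. 2 * l2_sq T (\<lambda>t. p k t - Z t) + 2 * (T * (norm (c k))\<^sup>2)) \<longlonglongrightarrow> 2 * 0 + 2 * (T * (norm (0 :: 'n pmat))\<^sup>2)"
      by (intro tendsto_intros pZ c)
    then show "(\<lambda>k. 2 * l2_sq T (\<lambda>t. p k t - Z t) + 2 * (T * (norm (c k))\<^sup>2)) \<longlonglongrightarrow> 0" by simp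
  qed (simp add: l2_sq_nonneg always_eventually)
  have "\<exists>\<Gamma>. \<forall>t. (\<Gamma> has_vector_derivative q k t) (at t)" for k
    using ex_antiderivative[OF continuous_on_polymonial_function[OF q]] by metis
  then obtain \<Gamma> where \<Gamma>: "\<And>k t. (\<Gamma> k has_vector_derivative q k t) (at t)"
    by metis
  define Ys where "Ys k t = P (\<Gamma> k t - \<Gamma> k 0)" for k t
  have "smooth_var T (Ys k)" for k
    unfolding smooth_var_def
  proof (intro conjI ballI)
    obtain D where D: "D 0 = q k" "\<And>j t. (D j has_vector_derivative D (Suc j) t) (at t)"
      using polynomial_function_smooth[OF q] by blast
    define E where "E j t = P (case j of 0 \<Rightarrow> \<Gamma> k t - \<Gamma> k 0 | Suc i \<Rightarrow> D i t)" for j t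
    have "(E j has_vector_derivative E (Suc j) t) (at t)" for j t
    proof (cases j)
      case 0
      have "((\<lambda>t. \<Gamma> k t - \<Gamma> k 0) has_vector_derivative q k t) (at t)"
        using \<Gamma>[of k t] by (simp add: has_vector_derivative_diff_const)
      from bounded_linear.has_vector_derivative[OF Pb this] show ?thesis
        by (simp add: 0 E_def[abs_def] D(1))
    next
      case (Suc i)
      from bounded_linear.has_vector_derivative[OF Pb D(2)[of i t]] show ?thesis
        by (simp add: Suc E_def[abs_def])
    qed
    moreover have "E 0 = Ys k"
      by (simp add: E_def Ys_def fun_eq_iff)
    ultimately show "smooth_curve (Ys k)"
      unfolding smooth_curve_def by blast
    show "Ys k 0 = 0"
      using P(1) by (simp add: Ys_def linear_0)
    have "(q k has_integral \<Gamma> k T - \<Gamma> k 0) {0..T}"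
      using T \<Gamma> by (intro fundamental_theorem_of_calculus) (auto intro: has_vector_derivative_at_within)
    moreover have "(q k has_integral integral {0..T} (p k) - T *\<^sub>R c k) {0..T}"
      unfolding q_def[abs_def]
      using T has_integral_diff[OF integrable_integral has_integral_const_real[of "c k" 0 T], of "p k"]
        continuous_on_polymonial_function[OF p(1)] by (simp add: integrable_continuous_real)
    moreover have "integral {0..T} (p k) - T *\<^sub>R c k = 0"
      using T by (simp add: c_def)
    ultimately have "\<Gamma> k T - \<Gamma> k 0 = 0"
      by (metis has_integral_unique)
    then show "Ys k T = 0"
      using P(1) by (simp add: Ys_def linear_0)
    show "in_sp (Ys k t)" for t
      by (simp add: Ys_def P(2))
  qed
  moreover have "h1_conv T Ys Y"
    unfolding h1_conv_def
  proof (intro exI conjI allI)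
    show "h1_deriv T (Ys k) (\<lambda>t. P (q k t))" for k
    proof (rule h1_deriv_C1)
      have "((\<lambda>t. \<Gamma> k t - \<Gamma> k 0) has_vector_derivative q k t) (at t)" for t
        using \<Gamma>[of k t] by (simp add: has_vector_derivative_diff_const)
      then show "(Ys k has_vector_derivative P (q k t)) (at t within {0..T})" for t
        unfolding Ys_def[abs_def]
        by (rule has_vector_derivative_at_within[OF bounded_linear.has_vector_derivative[OF Pb]])
      show "continuous_on {0..T} (\<lambda>t. P (q k t))"
        by (rule bounded_linear.continuous_on[OF Pb continuous_on_polymonial_function[OF q]])
    qed
    \<comment> \<open>The derivatives of the \<open>Ys k\<close> converge to \<open>P (Z t)\<close>
      instead of \<open>Z t\<close>, so this curve is the one used as the weak derivative of
      \<open>Y\<close>.\<close>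
    show "h1_deriv T Y (\<lambda>t. P (Z t))"
    proof (rule h1_derivI[OF sq_int_linear[OF Zs Pb]])
      fix t assume t: "t \<in> {0..T}"
      have "Z integrable_on {0..t}"
        using t by (auto intro!: integrable_on_subinterval[OF h1_deriv_integrable[OF Z]])
      then have "integral {0..t} (\<lambda>t. P (Z t)) = P (integral {0..t} Z)"
        using integral_linear[OF _ Pb] by (simp add: o_def)
      also have "integral {0..t} Z = Y t"
        using h1_deriv_eq[OF Z t] Y0 by simp
      finally show "Y t = Y 0 + integral {0..t} (\<lambda>t. P (Z t))"
        using Y0 P(3)[OF Ysp[OF t]] by simp
    qed
    show "(\<lambda>k. Ys k 0) \<longlonglongrightarrow> Y 0"
      using P(1) by (simp add: Ys_def linear_0 Y0)
    have le: "l2_sq T (\<lambda>t. P (q k t) - P (Z t)) \<le> C\<^sup>2 * l2_sq T (\<lambda>t. q k t - Z t)" for k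
      using l2_sq_linear_le[OF sq_int_diff[OF qs Zs] Pb C, of k] P(1) by (simp add: linear_diff)
    have "(\<lambda>k. C\<^sup>2 * l2_sq T (\<lambda>t. q k t - Z t)) \<longlonglongrightarrow> 0"
      using tendsto_mult_left[OF qZ, of "C\<^sup>2"] by simp
    then have "(\<lambda>k. l2_sq T (\<lambda>t. P (q k t) - P (Z t))) \<longlonglongrightarrow> 0"
      by (rule tendsto_sandwich[OF always_eventually[OF allI[OF l2_sq_nonneg]]
            always_eventually[OF allI[OF le]] tendsto_const])
    then show "(\<lambda>k. integral {0..T} (\<lambda>t. (norm (P (q k t) - P (Z t)))\<^sup>2)) \<longlonglongrightarrow> 0"
      by (simp add: l2_sq_def)
  qed
  ultimately show ?thesis by (rule that)
qed

lemma bounded_bilinear_var_form: "bounded_bilinear (var_form (J :: 'n::finite pmat))"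
proof -
  define \<alpha> where "\<alpha> = 1 / (2 * real CARD('n))"
  note simps = var_form_def \<alpha>_def[symmetric] fst_add snd_add fst_scaleR snd_scaleR matrix_distribs
    trace_add trace_sub trace_scaleR real_scaleR_def
  have "bilinear (var_form J)"
    unfolding bilinear_def
  proof (intro conjI allI linearI)
    show "var_form J x (y + z) = var_form J x y + var_form J x z" for x y z
      unfolding simps by (simp add: ring_distribs)
    show "var_form J x (c *\<^sub>R y) = c *\<^sub>R var_form J x y" for x y c
      unfolding simps by (simp add: ring_distribs mult_ac)
    show "var_form J (y + z) x = var_form J y x + var_form J z x" for x y z
      unfolding simps by (simp add: ring_distribs)
    show "var_form J (c *\<^sub>R y) x = c *\<^sub>R var_form J y x" for x y c
      unfolding simps by (simp add: ring_distribs mult_ac)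
  qed
  then show ?thesis by (simp add: bilinear_conv_bounded_bilinear)
qed

text \<open>The classical derivatives of the \<open>Ys k\<close>, the weak derivatives chosen in
  \<open>h1_conv\<close> and the given \<open>Z\<close> come from different sources;
  \<open>indep\<close> reconciles them, and the rest is continuity of a bilinear integral.\<close>

lemma second_var_h1_tendsto:
  fixes Y :: "real \<Rightarrow> 'n::finite pmat"
  assumes J: "J ** J = - mat 1" and T: "0 < T" and Z: "h1_deriv T Y Z"
    and Ys: "\<And>k. smooth_var T (Ys k)" and conv: "h1_conv T Ys Y"
  shows "(\<lambda>k. second_var J T (Ys k)) \<longlonglongrightarrow> integral {0..T} (\<lambda>t. var_form J (Y t, Z t) (Y t, Z t))"
proof -
  \<comment> \<open>A constant sequence: the pairs are at L2 distance 0, so one integral converges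
    to the other.\<close>
  have indep: "integral {0..T} (\<lambda>t. var_form J (V t, A t) (V t, A t)) = integral {0..T} (\<lambda>t. var_form J (V t, B t) (V t, B t))"
    if "h1_deriv T V A" "h1_deriv T V B" for V A B :: "real \<Rightarrow> 'n pmat"
  proof -
    have "(\<lambda>k::nat. integral {0..T} (\<lambda>t. var_form J (V t, A t) (V t, A t)))
        \<longlonglongrightarrow> integral {0..T} (\<lambda>t. var_form J (V t, B t) (V t, B t))"
    proof (rule integral_bilinear_tendsto[OF bounded_bilinear_var_form sq_int_h1_pair[OF that(1)] sq_int_h1_pair[OF that(2)]])
      show "(\<lambda>k::nat. l2_sq T (\<lambda>t. (V t, A t) - (V t, B t))) \<longlonglongrightarrow> 0"
        using h1_deriv_unique[OF that] T by (simp add: l2_sq_def norm_Pair)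
    qed
    then show ?thesis by (simp add: LIMSEQ_const_iff)
  qed
  obtain Zs Z' where Zs: "\<And>k. h1_deriv T (Ys k) (Zs k)" and Z': "h1_deriv T Y Z'"
    and lim: "(\<lambda>k. Ys k 0) \<longlonglongrightarrow> Y 0" "(\<lambda>k. l2_sq T (\<lambda>t. Zs k t - Z' t)) \<longlonglongrightarrow> 0"
    using conv by (auto simp: h1_conv_def l2_sq_def)
  have "second_var J T (Ys k) = integral {0..T} (\<lambda>t. var_form J (Ys k t, Zs k t) (Ys k t, Zs k t))" for k
  proof -
    obtain D where D: "D 0 = Ys k" "\<And>j t. (D j has_vector_derivative D (Suc j) t) (at t)"
      using Ys[of k] by (auto simp: smooth_var_def smooth_curve_def)
    have D0: "(Ys k has_vector_derivative D 1 t) (at t)" for t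
      using D(2)[of 0 t] D(1) by simp
    have D1: "continuous_on S (D 1)" for S
      using D(2)[of 1] by (meson continuous_at_imp_continuous_on has_vector_derivative_continuous)
    have "h1_deriv T (Ys k) (D 1)"
      by (rule h1_deriv_C1[OF has_vector_derivative_at_within[OF D0] D1])
    from indep[OF this Zs] show ?thesis
      using second_var_eq[OF J D0 D1] by simp
  qed
  moreover have "(\<lambda>k. integral {0..T} (\<lambda>t. var_form J (Ys k t, Zs k t) (Ys k t, Zs k t)))
      \<longlonglongrightarrow> integral {0..T} (\<lambda>t. var_form J (Y t, Z' t) (Y t, Z' t))"
    using T by (intro integral_bilinear_tendsto bounded_bilinear_var_form sq_int_h1_pair Zs Z'
        h1_conv_pair[OF Zs Z' _ lim]) simp
  ultimately show ?thesis
    using indep[OF Z' Z] by simp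
qed

text \<open>Density is what makes the description unique: without an approximating sequence every
  \<open>L\<close> would satisfy it vacuously.\<close>

lemma second_var_ext_eq:
  assumes J: "J ** J = - mat 1" and T: "0 < T" and Y: "Y \<in> H1_0_sp T" and Z: "h1_deriv T Y Z"
  shows "second_var_ext J T Y = integral {0..T} (\<lambda>t. var_form J (Y t, Z t) (Y t, Z t))"
  unfolding second_var_ext_def
proof (rule the_equality)
  fix L assume L: "\<forall>Ys. (\<forall>k. smooth_var T (Ys k)) \<and> h1_conv T Ys Y \<longrightarrow> (\<lambda>k. second_var J T (Ys k)) \<longlonglongrightarrow> L"
  obtain Ys where "\<And>k. smooth_var T (Ys k)" "h1_conv T Ys Y"
    using smooth_var_dense[OF Y T] by blast
  with L second_var_h1_tendsto[OF J T Z] show "L = integral {0..T} (\<lambda>t. var_form J (Y t, Z t) (Y t, Z t))"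
    by (meson LIMSEQ_unique)
qed (use second_var_h1_tendsto[OF J T Z] in blast)

subsection \<open>Unitary frames\<close>

lemma sum_UNIV_sum:
  fixes f :: "'a::finite + 'b::finite \<Rightarrow> 'c::comm_monoid_add"
  shows "(\<Sum>k\<in>UNIV. f k) = (\<Sum>i\<in>UNIV. f (Inl i)) + (\<Sum>i\<in>UNIV. f (Inr i))"
  by (simp add: sum.Plus flip: UNIV_Plus_UNIV)

lemma omega0_skew: "omega0 u v = - omega0 v u"
  by (simp add: omega0_def sum_negf[symmetric] mult.commute)

lemma omega0_self [simp]: "omega0 u u = 0"
  using omega0_skew[of u u] by simp

text \<open>Multiplication by i on C^n, with x_j + i y_j as coordinates.\<close>

definition std_cs :: "'n::finite pmat" where
  "std_cs = (\<chi> k l. case k of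
     Inl i \<Rightarrow> (case l of Inl j \<Rightarrow> 0 | Inr j \<Rightarrow> if i = j then - 1 else 0)
   | Inr i \<Rightarrow> (case l of Inl j \<Rightarrow> if i = j then 1 else 0 | Inr j \<Rightarrow> 0))"

lemma std_cs_mult:
  "(std_cs ** X) $ Inl i $ l = - (X $ Inr i $ l)" "(std_cs ** X) $ Inr i $ l = X $ Inl i $ l"
  "(X ** std_cs) $ l $ Inl i = X $ l $ Inr i" "(X ** std_cs) $ l $ Inr i = - (X $ l $ Inl i)"
  for X :: "'n::finite pmat"
  by (simp_all add: std_cs_def matrix_matrix_mult_def sum_UNIV_sum if_distrib[of "\<lambda>x. x * _"]
      if_distrib[of "\<lambda>x. _ * x"] cong: if_cong)

lemma std_cs_vec: "(std_cs *v x) $ Inl i = - (x $ Inr i)" "(std_cs *v x) $ Inr i = x $ Inl i"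
  by (simp_all add: std_cs_def matrix_vector_mult_def sum_UNIV_sum if_distrib[of "\<lambda>x. x * _"] cong: if_cong)

lemma transpose_eq_entry: "transpose A = A \<Longrightarrow> A $ i $ j = A $ j $ i" for A :: "'a ^ 'k ^ 'k"
proof -
  assume "transpose A = A"
  moreover have "transpose A $ i $ j = A $ j $ i" by (simp add: transpose_def)
  ultimately show ?thesis by simp
qed

lemma vec_sum_eq_iff: "x = y \<longleftrightarrow> (\<forall>i. x $ Inl i = y $ Inl i) \<and> (\<forall>i. x $ Inr i = y $ Inr i)"
  for x y :: "'a ^ ('n::finite + 'n)"
  by (metis vec_eq_iff sum.exhaust)

locale compatible =
  fixes J :: "'n::finite pmat"
  assumes J: "compatible_cs J"
begin

lemma cs_squared: "J ** J = - mat 1"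
  using J unfolding compatible_cs_def by blast

lemma cs_vec: "J *v (J *v v) = - v"
  by (simp add: matrix_vector_mul_assoc cs_squared matvec.minus_left)

lemma cs_sym: "omega0 u (J *v v) = omega0 v (J *v u)"
  using J unfolding compatible_cs_def by blast

lemma cs_pos: "u \<noteq> 0 \<Longrightarrow> 0 < omega0 u (J *v u)"
  using J unfolding compatible_cs_def by blast

lemma omega0_cs: "omega0 (J *v u) (J *v v) = omega0 u v"
proof -
  have "omega0 (J *v u) (J *v v) = omega0 v (J *v (J *v u))" by (rule cs_sym)
  also have "\<dots> = omega0 u v"
    using omega0_skew[of u v] by (simp add: cs_vec omega0.minus_right)
  finally show ?thesis .
qed

text \<open>Gram-Schmidt for the hermitian form whose real and imaginary parts are, up to sign,
  omega0(u, J v) and omega0(u, v). The vectors already found impose at most 2 |A| < 2n real linear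
  conditions on the next one, so a nonzero solution exists and can be normalised.\<close>

lemma ex_unitary_family:
  "finite A \<Longrightarrow> \<exists>e :: 'n \<Rightarrow> 'n pvec. \<forall>i\<in>A. \<forall>j\<in>A.
     omega0 (e i) (J *v e j) = (if i = j then 1 else 0) \<and> omega0 (e i) (e j) = 0"
proof (induction A rule: finite_induct)
  case (insert a A)
  then obtain e :: "'n \<Rightarrow> 'n pvec" where e: "\<And>i j. i \<in> A \<Longrightarrow> j \<in> A \<Longrightarrow>
      omega0 (e i) (J *v e j) = (if i = j then 1 else 0) \<and> omega0 (e i) (e j) = 0"
    by blast
  \<comment> \<open>The vector representing the functional \<open>omega0 w\<close> by the Euclidean
    inner product, which turns the conditions into orthogonality to a span.\<close>
  define c where "c w = adjoint (omega0 w) (1::real)" for w :: "'n pvec"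
  have c: "v \<bullet> c w = omega0 w v" for v w
    unfolding c_def
    using adjoint_works[OF bounded_linear.linear[OF omega0.bounded_linear_right], of v w 1] by simp
  define C where "C = (\<lambda>i. c (J *v e i)) ` A \<union> (\<lambda>i. c (e i)) ` A"
  have "card C \<le> card A + card A"
    unfolding C_def using insert(1) by (intro order_trans[OF card_Un_le] add_mono card_image_le)
  moreover have "card A < CARD('n)"
    using insert(1,2) by (metis card_mono card_seteq finite iso_tuple_UNIV_I not_less subset_UNIV)
  moreover have "dim C \<le> card C"
    using insert(1) by (intro dim_le_card') (simp add: C_def)
  ultimately have "dim C < DIM('n pvec)"
    by simp
  then obtain v where v: "v \<noteq> 0" "\<And>y. y \<in> span C \<Longrightarrow> orthogonal v y"
    using orthogonal_to_subspace_exists by blast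
  have v0: "omega0 (J *v e i) v = 0" "omega0 (e i) v = 0" if "i \<in> A" for i
    using v(2)[of "c (J *v e i)"] v(2)[of "c (e i)"] that
    by (auto simp: C_def span_base orthogonal_def c)
  define r where "r = inverse (sqrt (omega0 v (J *v v)))"
  have pos: "0 < omega0 v (J *v v)" using v(1) by (rule cs_pos)
  have rr: "r * (r * omega0 v (J *v v)) = 1"
    using pos by (simp add: r_def field_simps)
  have v1: "omega0 (e i) (J *v v) = 0" if "i \<in> A" for i
    using omega0_cs[of "e i" "J *v v"] v0(1)[OF that] by (simp add: cs_vec omega0.minus_right)
  define e' where "e' = e(a := r *\<^sub>R v)"
  have "omega0 (e' i) (J *v e' j) = (if i = j then 1 else 0) \<and> omega0 (e' i) (e' j) = 0"
    if ij: "i \<in> insert a A" "j \<in> insert a A" for i j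
  proof -
    consider "i = a" "j = a" | "i = a" "j \<in> A" "j \<noteq> a" | "i \<in> A" "i \<noteq> a" "j = a" | "i \<in> A" "j \<in> A" "i \<noteq> a" "j \<noteq> a"
      using ij by blast
    then show ?thesis
    proof cases
      case 1
      then show ?thesis
        using rr by (simp add: e'_def omega0.scaleR_left omega0.scaleR_right matrix_vector_mult_scaleR)
    next
      case 2
      then show ?thesis
        using v1[OF 2(2)] v0(2)[OF 2(2)] omega0_skew[of v "e j"] cs_sym[of v "e j"]
        by (simp add: e'_def omega0.scaleR_left)
    next
      case 3
      then show ?thesis
        using v1[OF 3(1)] v0(2)[OF 3(1)]
        by (simp add: e'_def omega0.scaleR_right matrix_vector_mult_scaleR)
    next
      case 4
      then show ?thesis using e by (simp add: e'_def)
    qed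
  qed
  then show ?case by blast
qed simp

text \<open>Complex coordinates in a unitary basis: \<open>\<rho>\<close> takes them and
  \<open>\<sigma>\<close> rebuilds the vector. They carry \<open>J\<close> to multiplication by i
  and its inner product to the Euclidean one, so questions about \<open>J\<close> become questions
  about block matrices.\<close>

lemma ex_unitary_frame:
  obtains R S :: "'n pmat" where "R ** S = mat 1" "S ** R = mat 1" "R ** J = std_cs ** R"
    "\<And>u v. omega0 u (J *v v) = (R *v u) \<bullet> (R *v v)"
proof -
  obtain e :: "'n \<Rightarrow> 'n pvec" where e: "\<And>i j. omega0 (e i) (J *v e j) = (if i = j then 1 else 0)"
      "\<And>i j. omega0 (e i) (e j) = 0"
    using ex_unitary_family[OF finite, of UNIV] by auto
  define \<rho> :: "'n pvec \<Rightarrow> 'n pvec" where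
    "\<rho> v = (\<chi> k. case k of Inl i \<Rightarrow> omega0 (e i) (J *v v) | Inr i \<Rightarrow> omega0 (e i) v)" for v
  define \<sigma> :: "'n pvec \<Rightarrow> 'n pvec" where
    "\<sigma> c = (\<Sum>i\<in>UNIV. c $ Inl i *\<^sub>R e i + c $ Inr i *\<^sub>R (J *v e i))" for c
  have lin: "linear \<rho>" "linear \<sigma>"
    by (auto intro!: linearI simp: \<rho>_def \<sigma>_def vec_sum_eq_iff matrix_vector_right_distrib omega0.add_right
        matrix_vector_mult_scaleR omega0.scaleR_right sum.distrib scaleR_add_left scaleR_sum_right algebra_simps)
  define R S where "R = matrix \<rho>" and "S = matrix \<sigma>"
  have R: "R *v v = \<rho> v" and S: "S *v v = \<sigma> v" for v
    by (simp_all add: R_def S_def matrix_works lin)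
  have Jsig: "J *v \<sigma> c = (\<Sum>i\<in>UNIV. c $ Inl i *\<^sub>R (J *v e i) - c $ Inr i *\<^sub>R e i)" for c
    unfolding \<sigma>_def
    by (simp add: matvec.sum_right matvec.add_right matvec.scaleR_right cs_vec)
  have "\<rho> (\<sigma> c) = c" for c
    by (simp add: vec_sum_eq_iff \<rho>_def Jsig)
       (simp add: \<sigma>_def omega0.sum_right omega0.add_right omega0.diff_right omega0.scaleR_right e
         if_distrib[of "\<lambda>x. _ * x"] cong: if_cong)
  then have RS: "R ** S = mat 1"
    by (simp add: matrix_eq R S flip: matrix_vector_mul_assoc)
  moreover from this have SR: "S ** R = mat 1"
    by (simp add: matrix_left_right_inverse)
  moreover have "R ** J = std_cs ** R"
    by (simp add: matrix_eq R vec_sum_eq_iff std_cs_vec flip: matrix_vector_mul_assoc)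
       (simp add: \<rho>_def cs_vec omega0.minus_right)
  moreover have "omega0 u (J *v v) = (R *v u) \<bullet> (R *v v)" for u v
  proof -
    have "u = \<sigma> (\<rho> u)"
      using SR by (metis R S matrix_vector_mul_assoc matrix_vector_mul_lid)
    then have "omega0 u (J *v v) = omega0 (\<sigma> (\<rho> u)) (J *v v)" by simp
    also have "\<dots> = (\<Sum>i\<in>UNIV. \<rho> u $ Inl i * omega0 (e i) (J *v v) + \<rho> u $ Inr i * omega0 (e i) v)"
      unfolding \<sigma>_def
      by (simp add: omega0.sum_left omega0.add_left omega0.scaleR_left omega0_cs)
    also have "\<dots> = \<rho> u \<bullet> \<rho> v"
      by (simp add: inner_vec_def sum_UNIV_sum sum.distrib) (simp add: \<rho>_def)
    finally show ?thesis by (simp add: R)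
  qed
  ultimately show ?thesis by (rule that)
qed

text \<open>The projection to the matrices anticommuting with \<open>J\<close>, along those commuting with \<open>J\<close>.\<close>

definition anti_part :: "'n pmat \<Rightarrow> 'n pmat" where
  "anti_part X = (1/2) *\<^sub>R (X + J ** X ** J)"

text \<open>The noncompact summand of the Cartan decomposition of sp(2n) determined by
  \<open>J\<close>; the compact summand, which commutes with \<open>J\<close>, is a copy of
  u(n).\<close>

definition anti_sp :: "'n pmat set" where
  "anti_sp = {X. in_sp X \<and> J ** X = - (X ** J)}"

text \<open>Self-adjointness for the inner product omega0(u, J v).\<close>

definition cs_symmetric :: "'n pmat \<Rightarrow> bool" where
  "cs_symmetric X \<longleftrightarrow> (\<forall>u v. omega0 u (J *v (X *v v)) = omega0 v (J *v (X *v u)))"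

text \<open>\<open>R\<close> is an isometry onto Euclidean space, where the adjoint is the
  transpose.\<close>

lemma cs_symmetric_iff:
  fixes R S X :: "'n pmat"
  assumes "S ** R = mat 1" "R ** S = mat 1" "\<And>u v. omega0 u (J *v v) = (R *v u) \<bullet> (R *v v)"
  shows "cs_symmetric X \<longleftrightarrow> transpose (R ** X ** S) = R ** X ** S"
proof -
  have SR: "S *v (R *v v) = v" and RS: "R *v (S *v v) = v" for v
    using assms by (simp_all add: matrix_vector_mul_assoc)
  let ?X = "R ** X ** S"
  have eq: "omega0 u (J *v (X *v v)) = (R *v u) \<bullet> (?X *v (R *v v))" for u v
    by (simp add: assms(3) SR flip: matrix_vector_mul_assoc)
  have tr: "x \<bullet> (transpose ?X *v y) = y \<bullet> (?X *v x)" for x y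
    by (metis dot_lmul_matrix inner_commute transpose_matrix_vector transpose_transpose)
  show ?thesis
  proof
    assume X: "cs_symmetric X"
    have "x \<bullet> (transpose ?X *v y) = x \<bullet> (?X *v y)" for x y
      using X eq[of "S *v x" "S *v y"] eq[of "S *v y" "S *v x"] unfolding tr RS cs_symmetric_def by metis
    then have "transpose ?X *v y = ?X *v y" for y
      using vector_eq_ldot by blast
    then show "transpose ?X = ?X"
      unfolding matrix_eq by blast
  next
    assume "transpose ?X = ?X"
    then show "cs_symmetric X"
      unfolding cs_symmetric_def eq using tr by metis
  qed
qed

lemma in_sp_iff: "in_sp X \<longleftrightarrow> cs_symmetric (J ** X)"
  by (simp add: in_sp_def cs_symmetric_def cs_vec omega0.minus_right flip: matrix_vector_mul_assoc)

text \<open>In a unitary frame \<open>X\<close> becomes a symmetric matrix \<open>Y\<close>, and the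
  trace is the sum of the squares of its entries.\<close>

lemma trace_square_pos:
  assumes X: "cs_symmetric X"
  shows "0 \<le> trace (X ** X)" "trace (X ** X) = 0 \<longleftrightarrow> X = 0"
proof -
  obtain R S :: "'n pmat" where RS: "R ** S = mat 1" "S ** R = mat 1"
    and g: "\<And>u v. omega0 u (J *v v) = (R *v u) \<bullet> (R *v v)"
    using ex_unitary_frame by metis
  define Y where "Y = R ** X ** S"
  have Y: "transpose Y = Y"
    using X cs_symmetric_iff[OF RS(2,1) g] by (simp add: Y_def)
  have SRA: "S ** (R ** A) = A" for A by (simp add: matrix_mul_assoc RS)
  have XY: "X = S ** Y ** R"
    unfolding Y_def by (simp add: RS SRA flip: matrix_mul_assoc)
  have "trace (X ** X) = trace (X ** X ** (S ** R))" by (simp add: RS)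
  also have "\<dots> = trace (R ** (X ** X ** S))"
    by (subst trace_mul_sym[of R]) (simp add: matrix_mul_assoc)
  also have "R ** (X ** X ** S) = Y ** Y"
    by (simp add: Y_def SRA flip: matrix_mul_assoc)
  also have "trace (Y ** Y) = (\<Sum>i\<in>UNIV. \<Sum>j\<in>UNIV. (Y $ i $ j)\<^sup>2)"
  proof -
    have "Y $ i $ j * Y $ j $ i = (Y $ i $ j)\<^sup>2" for i j
      using transpose_eq_entry[OF Y, of i j] by (simp add: power2_eq_square)
    then show ?thesis
      unfolding trace_def matrix_matrix_mult_def by simp
  qed
  finally have *: "trace (X ** X) = (\<Sum>i\<in>UNIV. \<Sum>j\<in>UNIV. (Y $ i $ j)\<^sup>2)" .
  show "0 \<le> trace (X ** X)"
    unfolding * by (intro sum_nonneg) auto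
  show "trace (X ** X) = 0 \<longleftrightarrow> X = 0"
  proof
    assume "trace (X ** X) = 0"
    then have "Y = 0"
      unfolding * by (simp add: sum_nonneg_eq_0_iff sum_nonneg vec_eq_iff)
    then show "X = 0" using XY by simp
  qed (simp add: trace_def)
qed

text \<open>Cauchy-Schwarz against the identity, obtained as positivity of tr(X0 X0) for the
  trace-free part X0 of \<open>X\<close>; the constant is the trace of the identity.\<close>

lemma trace_squared_le:
  assumes X: "cs_symmetric X"
  shows "(trace X)\<^sup>2 \<le> 2 * real CARD('n) * trace (X ** X)"
proof -
  define m where "m = 2 * real CARD('n)"
  have m: "0 < m" by (simp add: m_def)
  have tr1: "trace (mat 1 :: 'n pmat) = m"
    by (simp add: trace_I m_def)
  have "cs_symmetric (X - (trace X / m) *\<^sub>R mat 1)"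
  proof -
    have "omega0 u (J *v (X *v v)) = omega0 v (J *v (X *v u))" for u v
      using X unfolding cs_symmetric_def by blast
    then show ?thesis
      unfolding cs_symmetric_def matvec.diff_left matvec.diff_right omega0.diff_right
        matvec.scaleR_left matvec.scaleR_right omega0.scaleR_right matrix_vector_mul_lid
      by (intro allI arg_cong2[where f = "(-)"] arg_cong2[where f = "(*\<^sub>R)"] refl cs_sym)
  qed
  from trace_square_pos(1)[OF this]
  have "0 \<le> trace (X ** X) - 2 * (trace X / m) * trace X + (trace X / m) * ((trace X / m) * m)"
    unfolding matrix_distribs trace_sub trace_scaleR matrix_mul_lid matrix_mul_rid tr1 using m by simp
  also have "\<dots> = trace (X ** X) - (trace X)\<^sup>2 / m"
    using m by (simp add: field_simps power2_eq_square)
  finally have "(trace X)\<^sup>2 \<le> m * trace (X ** X)"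
    using m by (simp add: field_simps)
  then show ?thesis by (simp add: m_def)
qed

text \<open>For a matrix anticommuting with \<open>J\<close>, moving \<open>J\<close> across it
  trades symmetry of omega0(u, X v) for symmetry of omega0(u, J X v). The converse is
  \<open>anti_sp_if_cs_symmetric\<close>, so \<open>anti_sp\<close> consists of the self-adjoint
  matrices anticommuting with \<open>J\<close>.\<close>

lemma anti_sp_cs_symmetric: "X \<in> anti_sp \<Longrightarrow> cs_symmetric X"
proof -
  assume "X \<in> anti_sp"
  then have X: "in_sp X" "J ** X = - (X ** J)"
    by (auto simp: anti_sp_def)
  have JX: "J *v (X *v v) = - (X *v (J *v v))" for v
    using X(2) by (simp add: matrix_vector_mul_assoc matvec.minus_left)
  have "omega0 u (J *v (X *v v)) = omega0 v (J *v (X *v u))" for u v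
  proof -
    have "omega0 u (J *v (X *v v)) = - omega0 u (X *v (J *v v))"
      by (simp add: JX omega0.minus_right)
    also have "\<dots> = - omega0 (J *v v) (X *v u)"
      by (simp only: in_spD[OF X(1), of u])
    also have "\<dots> = omega0 (X *v u) (J *v v)"
      by (rule omega0_skew[symmetric])
    also have "\<dots> = omega0 v (J *v (X *v u))"
      by (rule cs_sym)
    finally show ?thesis .
  qed
  then show "cs_symmetric X"
    unfolding cs_symmetric_def by blast
qed

lemma anti_sp_if_cs_symmetric:
  assumes X: "cs_symmetric X" "J ** X = - (X ** J)"
  shows "X \<in> anti_sp"
proof -
  have JX: "J *v (X *v v) = - (X *v (J *v v))" for v
    using X(2) by (simp add: matrix_vector_mul_assoc matvec.minus_left)
  have "omega0 u (X *v v) = omega0 v (X *v u)" for u v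
  proof -
    have "X *v v = J *v (X *v (J *v v))"
      by (simp add: JX cs_vec matvec.minus_right)
    then have "omega0 u (X *v v) = omega0 u (J *v (X *v (J *v v)))" by simp
    also have "\<dots> = omega0 (J *v v) (J *v (X *v u))"
      using X(1) unfolding cs_symmetric_def by blast
    finally show ?thesis by (simp add: omega0_cs)
  qed
  then show ?thesis
    using X(2) unfolding anti_sp_def in_sp_def by blast
qed

lemma subspace_anti_sp: "subspace anti_sp"
proof -
  have "subspace {X. J ** X = - (X ** J)}"
    by (auto simp: subspace_def matrix_distribs)
  moreover have "anti_sp = {X. in_sp X} \<inter> {X. J ** X = - (X ** J)}"
    by (auto simp: anti_sp_def)
  ultimately show ?thesis
    by (simp add: subspace_inter subspace_sp)
qed

text \<open>In a unitary frame the elements are the block matrices with rows (A, B) and (B, -A),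
  where A and B are symmetric n by n matrices. Two such blocks have n (n + 1) free entries.\<close>

lemma dim_anti_sp: "dim anti_sp = CARD('n)\<^sup>2 + CARD('n)"
proof -
  obtain R S :: "'n pmat" where RS: "R ** S = mat 1" "S ** R = mat 1" and RJ: "R ** J = std_cs ** R"
    and g: "\<And>u v. omega0 u (J *v v) = (R *v u) \<bullet> (R *v v)"
    using ex_unitary_frame by metis
  \<comment> \<open>An injection into the naturals orders the indices, so that upper and lower
    triangles make sense.\<close>
  obtain h :: "'n \<Rightarrow> nat" where h: "inj h"
    using finite_imp_inj_to_nat_seg[of "UNIV :: 'n set"] by auto
  have SRA: "S ** (R ** A) = A" and RSA: "R ** (S ** A) = A" for A :: "'n pmat"
    by (simp_all add: matrix_mul_assoc RS)
  have JS: "J ** S = S ** std_cs"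
    by (metis RJ RS SRA matrix_mul_assoc matrix_mul_rid)
  \<comment> \<open>The pair (A, B) is packed into one square matrix and one vector: A is stored in
    the upper triangle of \<open>M\<close> with its diagonal, the off-diagonal entries of B in the
    strict lower triangle, and the diagonal of B in \<open>v\<close>. The dimension n^2 + n is then
    that of a product type.\<close>
  define a where "a M i j = (if h i \<le> h j then M $ i $ j else M $ j $ i)" for M :: "real ^ 'n ^ 'n" and i j
  define b where "b M v i j = (if i = j then v $ i else if h i \<le> h j then M $ j $ i else M $ i $ j)"
    for M :: "real ^ 'n ^ 'n" and v :: "real ^ 'n" and i j
  define \<beta> :: "(real ^ 'n ^ 'n) \<times> (real ^ 'n) \<Rightarrow> 'n pmat" where
    "\<beta> p = (\<chi> k l. case k of
       Inl i \<Rightarrow> (case l of Inl j \<Rightarrow> a (fst p) i j | Inr j \<Rightarrow> b (fst p) (snd p) i j)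
     | Inr i \<Rightarrow> (case l of Inl j \<Rightarrow> b (fst p) (snd p) i j | Inr j \<Rightarrow> - a (fst p) i j))" for p
  have h_eq: "h i = h j \<longleftrightarrow> i = j" for i j using h by (auto dest: injD)
  have sym: "a M i j = a M j i" "b M v i j = b M v j i" for M v i j
    using h_eq[of i j] by (auto simp: a_def b_def)
  have lin\<beta>: "linear \<beta>"
    by (auto intro!: linearI simp: \<beta>_def vec_sum_eq_iff a_def b_def)
  have inj\<beta>: "p = 0" if "\<beta> p = 0" for p
  proof -
    have A: "a (fst p) i j = 0" and B: "b (fst p) (snd p) i j = 0" for i j
      using that by (auto simp: \<beta>_def vec_sum_eq_iff)
    have "fst p $ i $ j = 0" for i j
      using A[of i j] B[of j i] h_eq[of i j] by (auto simp: a_def b_def split: if_splits)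
    moreover have "snd p $ i = 0" for i
      using B[of i i] by (simp add: b_def)
    ultimately show ?thesis by (simp add: prod_eq_iff vec_eq_iff)
  qed
  define \<Psi> where "\<Psi> p = S ** \<beta> p ** R" for p
  have lin\<Psi>: "linear \<Psi>"
    by (rule linearI) (simp_all only: \<Psi>_def linear_add[OF lin\<beta>] linear_scale[OF lin\<beta>] matrix_distribs)
  have inj\<Psi>: "inj \<Psi>"
    unfolding linear_injective_0[OF lin\<Psi>]
  proof (intro allI impI)
    fix p assume "\<Psi> p = 0"
    then have "R ** (S ** \<beta> p ** R) ** S = 0" by (simp add: \<Psi>_def)
    then have "\<beta> p = 0" by (simp add: RSA RS flip: matrix_mul_assoc)
    then show "p = 0" by (rule inj\<beta>)
  qed
  have hat\<Psi>: "R ** \<Psi> p ** S = \<beta> p" for p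
    by (simp add: \<Psi>_def RSA RS flip: matrix_mul_assoc)
  have "\<Psi> p \<in> anti_sp" for p
  proof (rule anti_sp_if_cs_symmetric)
    show "cs_symmetric (\<Psi> p)"
      unfolding cs_symmetric_iff[OF RS(2,1) g] hat\<Psi>
      by (simp add: transpose_def vec_sum_eq_iff \<beta>_def) (use sym in metis)
    have "std_cs ** \<beta> p = - (\<beta> p ** std_cs)"
      by (simp add: vec_sum_eq_iff std_cs_mult) (simp add: \<beta>_def)
    then have "S ** (std_cs ** \<beta> p) ** R = - (S ** (\<beta> p ** std_cs) ** R)"
      by (simp add: matrix_distribs)
    then show "J ** \<Psi> p = - (\<Psi> p ** J)"
      by (simp add: \<Psi>_def matrix_mul_assoc JS) (simp add: RJ flip: matrix_mul_assoc)
  qed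
  moreover have "X \<in> range \<Psi>" if X: "X \<in> anti_sp" for X
  proof -
    define Y where "Y = R ** X ** S"
    have XY: "X = S ** Y ** R"
      unfolding Y_def by (simp add: RS SRA flip: matrix_mul_assoc)
    have "transpose Y = Y"
      using anti_sp_cs_symmetric[OF X] cs_symmetric_iff[OF RS(2,1) g] by (simp add: Y_def)
    then have Ysym: "Y $ k $ l = Y $ l $ k" for k l
      by (rule transpose_eq_entry)
    have "R ** (J ** X) ** S = - (R ** (X ** J) ** S)"
      using X by (simp add: anti_sp_def matrix_distribs)
    then have "std_cs ** Y = - (Y ** std_cs)"
      by (simp add: Y_def matrix_mul_assoc RJ) (simp add: JS flip: matrix_mul_assoc)
    then have Y: "Y $ Inr i $ Inl j = Y $ Inl i $ Inr j" "Y $ Inr i $ Inr j = - (Y $ Inl i $ Inl j)" for i j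
      using std_cs_mult(1)[of Y i "Inl j"] std_cs_mult(3)[of Y "Inl i" j]
        std_cs_mult(1)[of Y i "Inr j"] std_cs_mult(4)[of Y "Inl i" j] by simp_all
    have Bsym: "Y $ Inl i $ Inr j = Y $ Inl j $ Inr i" for i j
      using Ysym[of "Inl i" "Inr j"] Y(1)[of j i] by simp
    define M where "M = (\<chi> i j. if h i \<le> h j then Y $ Inl i $ Inl j else Y $ Inl i $ Inr j)"
    define v where "v = (\<chi> i. Y $ Inl i $ Inr i)"
    have "a M i j = Y $ Inl i $ Inl j" for i j
      using Ysym[of "Inl i" "Inl j"] by (auto simp: a_def M_def)
    moreover have "b M v i j = Y $ Inl i $ Inr j" for i j
      using Bsym[of i j] h_eq[of i j] by (auto simp: b_def M_def v_def)
    ultimately have "\<beta> (M, v) = Y"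
      by (simp add: vec_sum_eq_iff \<beta>_def Y)
    then show ?thesis using XY by (auto simp: \<Psi>_def)
  qed
  ultimately have "anti_sp = range \<Psi>" by blast
  then have "dim anti_sp = dim (UNIV :: ((real ^ 'n ^ 'n) \<times> (real ^ 'n)) set)"
    using dim_image_eq[OF lin\<Psi>, of UNIV] inj\<Psi> by simp
  then show ?thesis by (simp add: power2_eq_square)
qed

end

section \<open>Pointwise bounds on the integrand and nonpositivity of the second variation\<close>

context compatible
begin

lemma cs_mult_cs: "J ** (J ** X) = - X"
  by (simp add: matrix_mul_assoc cs_squared matrix_distribs)

lemma in_sp_conj: "in_sp X \<Longrightarrow> in_sp (J ** X ** J)"
proof -
  assume X: "in_sp X"
  have *: "omega0 u (J *v w) = - omega0 (J *v u) w" for u w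
    using omega0_cs[of u "J *v w"] by (simp add: cs_vec omega0.minus_right)
  show ?thesis
    unfolding in_sp_def
  proof (intro allI)
    show "omega0 u (J ** X ** J *v v) = omega0 v (J ** X ** J *v u)" for u v
      using in_spD[OF X, of "J *v u" "J *v v"] by (simp add: * flip: matrix_vector_mul_assoc)
  qed
qed

lemma anti_part_in_anti_sp:
  assumes X: "in_sp X" shows "anti_part X \<in> anti_sp"
proof -
  have "in_sp (X + J ** X ** J)"
    using subspace_add[OF subspace_sp, of X "J ** X ** J"] X in_sp_conj[OF X] by simp
  then have "in_sp (anti_part X)"
    using subspace_scale[OF subspace_sp, of "X + J ** X ** J" "1/2"] by (simp add: anti_part_def)
  moreover have "J ** anti_part X = - (anti_part X ** J)"
    by (simp add: anti_part_def matrix_distribs cs_mult_cs cs_squared flip: matrix_mul_assoc)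
       (simp add: algebra_simps)
  ultimately show ?thesis by (simp add: anti_sp_def)
qed

lemma anti_part_id: "X \<in> anti_sp \<Longrightarrow> anti_part X = X"
proof -
  assume "X \<in> anti_sp"
  then have "J ** X ** J = X"
    by (simp add: anti_sp_def matrix_distribs cs_squared flip: matrix_mul_assoc)
  then show ?thesis by (simp add: anti_part_def flip: scaleR_2)
qed

lemma comm_part_commute: "J ** (X - anti_part X) = (X - anti_part X) ** J"
proof -
  have "X - anti_part X = (1/2) *\<^sub>R (X - J ** X ** J)"
    by (simp add: anti_part_def vec_eq_iff field_simps)
  then show ?thesis
    by (simp add: matrix_distribs cs_mult_cs cs_squared add.commute flip: matrix_mul_assoc)
qed

lemma bounded_linear_anti_part: "bounded_linear anti_part"
  unfolding anti_part_def[abs_def]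
  by (intro bounded_linear_scaleR_right[THEN bounded_linear_compose] bounded_linear_add bounded_linear_ident
      bounded_linear_compose[OF matmul.bounded_linear_left matmul.bounded_linear_right])

text \<open>Conjugation by \<open>J\<close> changes the sign of \<open>X\<close> but preserves the
  trace. This kills every mixed product of a commuting and an anticommuting factor.\<close>

lemma trace_anticommuting: "J ** X = - (X ** J) \<Longrightarrow> trace X = 0"
proof -
  assume "J ** X = - (X ** J)"
  then have "J ** X ** J = X"
    by (simp add: matrix_distribs cs_squared flip: matrix_mul_assoc)
  moreover have "trace (J ** X ** J) = trace (J ** (J ** X))"
    by (rule trace_mul_sym)
  ultimately show "trace X = 0"
    by (simp add: cs_mult_cs trace_minus)
qed

lemma anti_spD: "X \<in> anti_sp \<Longrightarrow> X ** J = - (J ** X)"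
  by (simp add: anti_sp_def)

lemma anti_sp_mult: "X \<in> anti_sp \<Longrightarrow> X ** (J ** Y) = - (J ** (X ** Y))"
  by (simp add: matrix_mul_assoc anti_spD matrix_distribs)

text \<open>Cyclicity of the trace and one anticommutation. For anticommuting D it gives tr(J
  [D,D']) = 2 tr(J D D').\<close>

lemma trace_cs_anti_swap:
  assumes "X \<in> anti_sp" shows "trace (J ** (Y ** X)) = - trace (J ** (X ** Y))"
proof -
  have "trace (J ** (Y ** X)) = trace (X ** (J ** Y))"
    by (simp add: matrix_mul_assoc) (subst trace_mul_sym, simp add: matrix_mul_assoc)
  then show ?thesis using assms by (simp add: anti_sp_mult trace_minus)
qed

lemma cs_mult_anti_sp: "X \<in> anti_sp \<Longrightarrow> J ** X \<in> anti_sp"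
proof (rule anti_sp_if_cs_symmetric)
  assume X: "X \<in> anti_sp"
  then show "cs_symmetric (J ** X)"
    unfolding in_sp_iff[symmetric] by (simp add: anti_sp_def)
  show "J ** (J ** X) = - (J ** X ** J)"
    using X by (simp add: anti_spD matrix_distribs flip: matrix_mul_assoc)
qed

text \<open>Mixed terms are traceless, and tr(J [C,C']) = 0 by cyclicity because \<open>J\<close>
  commutes with the commuting part C. Only the velocity C' of that part survives, through
  \<open>B\<close>, which is J C'.\<close>

lemma var_form_eq:
  fixes Y Z :: "'n pmat"
  defines "D \<equiv> anti_part Y" and "D' \<equiv> anti_part Z" and "B \<equiv> J ** (Z - anti_part Z)"
  assumes Y: "in_sp Y" and Z: "in_sp Z"
  shows "2 * real CARD('n) * var_form J (Y, Z) (Y, Z) = - trace (D' ** D') + 2 * trace (J ** D ** D')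
    + ((trace B)\<^sup>2 / (2 * real CARD('n)) - trace (B ** B))"
proof -
  define m where "m = 2 * real CARD('n)"
  have m: "m \<noteq> 0" by (simp add: m_def)
  define C C' where "C = Y - D" and "C' = Z - D'"
  have YZ: "Y = C + D" "Z = C' + D'" by (simp_all add: C_def C'_def)
  have D: "D ** J = - (J ** D)" "D' ** J = - (J ** D')"
    using anti_part_in_anti_sp[OF Y] anti_part_in_anti_sp[OF Z] by (simp_all add: anti_spD D_def D'_def)
  have C: "C ** J = J ** C" "C' ** J = J ** C'"
    by (simp_all add: C_def C'_def D_def D'_def comm_part_commute)
  have push: "D ** (J ** X) = - (J ** (D ** X))" "D' ** (J ** X) = - (J ** (D' ** X))"
    "C ** (J ** X) = J ** (C ** X)" "C' ** (J ** X) = J ** (C' ** X)" for X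
    by (simp_all add: matrix_mul_assoc C D matrix_distribs)
  \<comment> \<open>A normal form: all factors \<open>J\<close> are moved to the left, where they
    cancel in pairs.\<close>
  note norm = C D push cs_mult_cs cs_squared matrix_distribs matrix_mul_assoc[symmetric]
  have z: "trace (J ** D') = 0" "trace (J ** (C ** D')) = 0" "trace (J ** (D ** C')) = 0"
    "trace (J ** (C' ** D)) = 0" "trace (J ** (D' ** C)) = 0" "trace (C' ** D') = 0" "trace (D' ** C') = 0"
    by (rule trace_anticommuting; simp add: norm)+
  have c: "trace (J ** (C' ** C)) = trace (J ** (C ** C'))"
  proof -
    have "trace (J ** (C' ** C)) = trace (C ** (J ** C'))"
      by (simp add: matrix_mul_assoc) (subst trace_mul_sym, simp add: matrix_mul_assoc)
    then show ?thesis by (simp add: norm)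
  qed
  have d: "trace (J ** (D' ** D)) = - trace (J ** (D ** D'))"
    unfolding D_def by (rule trace_cs_anti_swap[OF anti_part_in_anti_sp[OF Y]])
  have B: "B = J ** C'" by (simp add: B_def C'_def D'_def)
  have BB: "trace (B ** B) = - trace (C' ** C')"
    by (simp add: B norm trace_minus)
  have t1: "trace (J ** (Y ** Z - Z ** Y)) = 2 * trace (J ** (D ** D'))"
    unfolding YZ by (simp add: norm trace_add trace_sub trace_minus z c d)
  have t2: "trace (J ** Z ** J ** Z) = trace (B ** B) + trace (D' ** D')"
    unfolding YZ BB by (simp add: norm trace_add trace_sub trace_minus z)
  have t3: "trace (J ** Z) = trace B"
    unfolding YZ B by (simp add: matrix_distribs trace_add z)
  have "m * var_form J (Y, Z) (Y, Z) = trace (J ** (Y ** Z - Z ** Y)) - trace (J ** Z ** J ** Z) + (trace (J ** Z))\<^sup>2 / m"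
    using m unfolding var_form_def m_def[symmetric] fst_conv snd_conv
    by (simp add: field_simps power2_eq_square)
  then show ?thesis
    unfolding t1 t2 t3 m_def[symmetric] by (simp flip: matrix_mul_assoc)
qed

lemma var_form_le:
  assumes "in_sp Y" "in_sp Z"
  shows "2 * real CARD('n) * var_form J (Y, Z) (Y, Z)
    \<le> - trace (anti_part Z ** anti_part Z) + 2 * trace (J ** anti_part Y ** anti_part Z)"
proof -
  have "in_sp (Z - anti_part Z)"
    using subspace_diff[OF subspace_sp, of Z "anti_part Z"] assms(2) anti_part_in_anti_sp[OF assms(2)]
    by (simp add: anti_sp_def)
  then have "cs_symmetric (J ** (Z - anti_part Z))"
    by (simp add: in_sp_iff)
  from trace_squared_le[OF this] show ?thesis
    unfolding var_form_eq[OF assms] by (simp add: field_simps)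
qed

text \<open>Completing the square, since tr(W W) is nonnegative. If D = e^(tJ) E and D' is its
  velocity, then \<open>W\<close> is e^(tJ) (E' + r E), so this is the usual Riccati step for the
  form tr(E E) - tr(E' E').\<close>

lemma riccati_bound:
  assumes D: "D \<in> anti_sp" and D': "D' \<in> anti_sp"
  shows "- trace (D' ** D') + 2 * trace (J ** D ** D')
    \<le> (1 + r\<^sup>2) * trace (D ** D) + 2 * r * trace (D ** D')"
proof -
  define W where "W = D' - J ** D + r *\<^sub>R D"
  have "W \<in> anti_sp"
    unfolding W_def
    by (intro subspace_add[OF subspace_anti_sp] subspace_diff[OF subspace_anti_sp]
        subspace_scale[OF subspace_anti_sp] D D' cs_mult_anti_sp)
  then have "0 \<le> trace (W ** W)"
    by (intro trace_square_pos anti_sp_cs_symmetric)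
  moreover have "trace (D' ** D) = trace (D ** D')" by (rule trace_mul_sym)
  moreover have "trace (J ** (D' ** D)) = - trace (J ** (D ** D'))"
    by (rule trace_cs_anti_swap[OF D])
  ultimately show ?thesis
    unfolding W_def
    by (simp add: matrix_distribs anti_sp_mult[OF D] anti_sp_mult[OF D'] cs_mult_cs trace_add trace_sub
        trace_minus trace_scaleR flip: matrix_mul_assoc)
       (simp add: algebra_simps power2_eq_square)
qed

text \<open>A linear projection onto sp(2n) fixes the curve on the interval, hence its derivative.
  At an end point only one side is available, but derivatives within a nondegenerate interval are
  unique.\<close>

lemma in_sp_derivative:
  assumes Y: "\<And>t. t \<in> {a..b} \<Longrightarrow> in_sp (Y t :: 'n pmat)" "a < b" "t \<in> {a..b}"
    and d: "(Y has_vector_derivative Z) (at t)"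
  shows "in_sp Z"
proof -
  obtain P :: "'n pmat \<Rightarrow> 'n pmat" where P: "linear P" "\<And>X. in_sp (P X)" "\<And>X. in_sp X \<Longrightarrow> P X = X"
    using linear_exists_left_inverse_on[OF linear_id subspace_sp] by auto
  have Pb: "bounded_linear P" using P(1) by (simp add: linear_conv_bounded_linear)
  have d': "(Y has_vector_derivative Z) (at t within {a..b})"
    using d by (rule has_vector_derivative_at_within)
  from bounded_linear.has_vector_derivative[OF Pb this]
  have "(Y has_vector_derivative P Z) (at t within {a..b})"
    by (rule has_vector_derivative_transform[OF assms(3), rotated]) (simp add: P(3) Y(1))
  then have "P Z = Z"
    using d' assms(2,3) by (metis vector_derivative_unique_within_closed_interval cbox_interval)
  then show ?thesis using P(2)[of Z] by simp
qed

text \<open>Strictness of \<open>c < 1\<close> keeps the poles of the tangent off the closed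
  interval even when \<open>L = pi\<close>.\<close>

lemma cos_scaled_pos:
  fixes c L :: real
  assumes "0 < c" "c < 1" "0 < L" "L \<le> pi" "\<bar>t\<bar> \<le> L / 2"
  shows "cos (c * t) > 0"
proof -
  have "\<bar>c * t\<bar> \<le> c * (pi / 2)"
    using assms by (simp add: abs_mult)
  also have "\<dots> < 1 * (pi / 2)"
    using assms by (intro mult_strict_right_mono) auto
  finally show ?thesis by (intro cos_gt_zero_pi) auto
qed

text \<open>The Riccati bound is used with \<open>r = c * \<theta> t\<close>. Since \<theta>' = c (1
  + \<theta>^2), the bound equals the derivative of c \<theta> N plus (1 - c^2) N, so integration
  leaves boundary terms and a small multiple of the integral of N.\<close>

lemma var_form_integral_le:
  assumes Y: "\<And>t. (Y has_vector_derivative Z t) (at t)" and Z: "continuous_on UNIV Z"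
    and sp: "\<And>t. t \<in> {0..T} \<Longrightarrow> in_sp (Y t)" and T: "0 < T"
    and c: "0 < c" "c < 1" and L: "0 < L" "L \<le> pi" and a: "0 \<le> a" "a + L \<le> T"
  defines "N \<equiv> \<lambda>t. trace (anti_part (Y t) ** anti_part (Y t))"
  shows "2 * real CARD('n) * integral {a..a + L} (\<lambda>t. var_form J (Y t, Z t) (Y t, Z t))
    \<le> (1 - c\<^sup>2) * integral {a..a + L} N + c * tan (c * (L / 2)) * (N a + N (a + L))"
proof -
  \<comment> \<open>Centring at the midpoint keeps the argument of the tangent within c pi / 2 in
    absolute value and makes its two end values opposite, so \<open>N a\<close> and
    \<open>N (a + L)\<close> receive the same coefficient.\<close>
  define \<mu> where "\<mu> = a + L / 2"
  define \<theta> where "\<theta> t = tan (c * (t - \<mu>))" for t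
  define D where "D t = anti_part (Y t)" for t
  define D' where "D' t = anti_part (Z t)" for t
  have cos: "0 < cos (c * (t - \<mu>))" if "t \<in> {a..a + L}" for t
    using that by (intro cos_scaled_pos[OF c L]) (auto simp: \<mu>_def abs_if)
  have Yc: "continuous_on S Y" for S
    by (meson Y continuous_at_imp_continuous_on has_vector_derivative_continuous)
  have Zc: "continuous_on S Z" for S using Z continuous_on_subset by blast
  have Zsp: "in_sp (Z t)" if "t \<in> {0..T}" for t
    by (rule in_sp_derivative[OF sp T that Y])
  have DD: "(D has_vector_derivative D' t) (at t)" for t
    unfolding D_def[abs_def] D'_def by (rule bounded_linear.has_vector_derivative[OF bounded_linear_anti_part Y])
  have N: "(N has_real_derivative 2 * trace (D t ** D' t)) (at t)" for t
  proof -
    have "(N has_vector_derivative trace (D t ** D' t + D' t ** D t)) (at t)"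
      unfolding N_def D_def[symmetric]
      by (rule bounded_linear.has_vector_derivative[OF bounded_linear_trace matmul_has_vector_derivative[OF DD DD]])
    then show ?thesis
      by (simp add: has_real_derivative_iff_has_vector_derivative trace_add trace_mul_sym[of "D' t"])
  qed
  have Nc: "continuous_on S N" for S
    by (meson N DERIV_continuous continuous_at_imp_continuous_on)
  define H where "H t = (1 - c\<^sup>2) * N t + (c\<^sup>2 * (1 + (\<theta> t)\<^sup>2) * N t + 2 * (c * \<theta> t) * trace (D t ** D' t))" for t
  have prim: "((\<lambda>t. c * \<theta> t * N t) has_real_derivative
      c\<^sup>2 * (1 + (\<theta> t)\<^sup>2) * N t + 2 * (c * \<theta> t) * trace (D t ** D' t)) (at t)" if "t \<in> {a..a + L}" for t
  proof -
    have "(\<theta> has_real_derivative inverse ((cos (c * (t - \<mu>)))\<^sup>2) * c) (at t)"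
      unfolding \<theta>_def[abs_def] using cos[OF that] by (auto intro!: derivative_eq_intros)
    moreover have "inverse ((cos (c * (t - \<mu>)))\<^sup>2) = 1 + (\<theta> t)\<^sup>2"
      using cos[OF that] tan_sec[of "c * (t - \<mu>)"] by (simp add: \<theta>_def power_inverse)
    ultimately have "(\<theta> has_real_derivative (1 + (\<theta> t)\<^sup>2) * c) (at t)" by simp
    from DERIV_mult[OF DERIV_cmult[OF this, of c] N] show ?thesis
      by (rule DERIV_cong) (simp add: algebra_simps power2_eq_square)
  qed
  have int1: "((\<lambda>t. c\<^sup>2 * (1 + (\<theta> t)\<^sup>2) * N t + 2 * (c * \<theta> t) * trace (D t ** D' t)) has_integral
      c * \<theta> (a + L) * N (a + L) - c * \<theta> a * N a) {a..a + L}"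
    using L prim by (intro fundamental_theorem_of_calculus)
      (auto simp flip: has_real_derivative_iff_has_vector_derivative intro: has_field_derivative_at_within)
  have int2: "((\<lambda>t. (1 - c\<^sup>2) * N t) has_integral (1 - c\<^sup>2) * integral {a..a + L} N) {a..a + L}"
    by (intro has_integral_mult_right integrable_integral integrable_continuous_real Nc)
  have intH: "(H has_integral (1 - c\<^sup>2) * integral {a..a + L} N
      + (c * \<theta> (a + L) * N (a + L) - c * \<theta> a * N a)) {a..a + L}"
    unfolding H_def[abs_def] by (rule has_integral_add[OF int2 int1])
  have intV: "((\<lambda>t. 2 * real CARD('n) * var_form J (Y t, Z t) (Y t, Z t)) has_integral
      2 * real CARD('n) * integral {a..a + L} (\<lambda>t. var_form J (Y t, Z t) (Y t, Z t))) {a..a + L}"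
    by (intro has_integral_mult_right integrable_integral integrable_continuous_real
        bounded_bilinear.continuous_on[OF bounded_bilinear_var_form] continuous_intros Yc Zc)
  have "2 * real CARD('n) * integral {a..a + L} (\<lambda>t. var_form J (Y t, Z t) (Y t, Z t))
      \<le> (1 - c\<^sup>2) * integral {a..a + L} N + (c * \<theta> (a + L) * N (a + L) - c * \<theta> a * N a)"
  proof (rule has_integral_le[OF intV intH])
    fix t assume t: "t \<in> {a..a + L}"
    then have "t \<in> {0..T}" using a by auto
    note spt = sp[OF this] Zsp[OF this]
    have "2 * real CARD('n) * var_form J (Y t, Z t) (Y t, Z t)
        \<le> - trace (D' t ** D' t) + 2 * trace (J ** D t ** D' t)"
      unfolding D_def D'_def by (rule var_form_le[OF spt])
    also have "\<dots> \<le> (1 + (c * \<theta> t)\<^sup>2) * trace (D t ** D t) + 2 * (c * \<theta> t) * trace (D t ** D' t)"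
      unfolding D_def D'_def by (intro riccati_bound anti_part_in_anti_sp spt)
    also have "\<dots> = H t"
      by (simp add: H_def N_def D_def algebra_simps power2_eq_square)
    finally show "2 * real CARD('n) * var_form J (Y t, Z t) (Y t, Z t) \<le> H t" .
  qed
  moreover have "\<theta> (a + L) = tan (c * (L / 2))" "\<theta> a = - tan (c * (L / 2))"
    by (simp_all add: \<theta>_def \<mu>_def flip: tan_minus)
  ultimately show ?thesis
    by (simp add: algebra_simps)
qed

lemma var_form_integral_sum_le:
  assumes Y: "\<And>t. (Y has_vector_derivative Z t) (at t)" and Z: "continuous_on UNIV Z"
    and sp: "\<And>t. t \<in> {0..T} \<Longrightarrow> in_sp (Y t)" and T: "0 < T"
    and c: "0 < c" "c < 1" and L: "0 < L" "L \<le> pi" and a: "real j * L \<le> T"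
  defines "N \<equiv> \<lambda>t. trace (anti_part (Y t) ** anti_part (Y t))"
  shows "2 * real CARD('n) * integral {0..real j * L} (\<lambda>t. var_form J (Y t, Z t) (Y t, Z t))
    \<le> (1 - c\<^sup>2) * integral {0..real j * L} N
      + (\<Sum>i<j. c * tan (c * (L / 2)) * (N (real i * L) + N (real (Suc i) * L)))"
  using a
proof (induction j)
  case 0
  then show ?case by simp
next
  case (Suc j)
  have le: "real j * L \<le> real (Suc j) * L" "real j * L + L = real (Suc j) * L"
    using L by (auto simp: algebra_simps)
  have Yc: "continuous_on S Y" for S
    by (meson Y continuous_at_imp_continuous_on has_vector_derivative_continuous)
  have Zc: "continuous_on S Z" for S using Z continuous_on_subset by blast
  have Vc: "continuous_on S (\<lambda>t. var_form J (Y t, Z t) (Y t, Z t))" for S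
    by (intro bounded_bilinear.continuous_on[OF bounded_bilinear_var_form] continuous_intros Yc Zc)
  have Nc: "continuous_on S N" for S
    unfolding N_def
    by (intro bounded_linear.continuous_on[OF bounded_linear_trace] matmul.continuous_on
        bounded_linear.continuous_on[OF bounded_linear_anti_part] Yc)
  have split: "integral {0..real (Suc j) * L} f = integral {0..real j * L} f + integral {real j * L..real j * L + L} f"
    if "\<And>S. continuous_on S f" for f :: "real \<Rightarrow> real"
    using Henstock_Kurzweil_Integration.integral_combine[of 0 "real j * L" "real (Suc j) * L" f] L le(1) that
    by (simp add: integrable_continuous_real le(2) del: of_nat_Suc)
  have IH: "2 * real CARD('n) * integral {0..real j * L} (\<lambda>t. var_form J (Y t, Z t) (Y t, Z t))
    \<le> (1 - c\<^sup>2) * integral {0..real j * L} N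
      + (\<Sum>i<j. c * tan (c * (L / 2)) * (N (real i * L) + N (real (Suc i) * L)))"
    using Suc.IH Suc.prems le(1) by linarith
  have step: "2 * real CARD('n) * integral {real j * L..real j * L + L} (\<lambda>t. var_form J (Y t, Z t) (Y t, Z t))
    \<le> (1 - c\<^sup>2) * integral {real j * L..real j * L + L} N + c * tan (c * (L / 2)) * (N (real j * L) + N (real (Suc j) * L))"
    using var_form_integral_le[OF Y Z sp T c L, of "real j * L"] Suc.prems L
    unfolding N_def le(2)[symmetric] by simp
  show ?case
    unfolding split[OF Vc] split[OF Nc] sum.lessThan_Suc distrib_left
    using IH step by (simp only: distrib_left)
qed

lemma second_var_ext_nonpos:
  assumes T: "0 < T" and N: "0 < N" "T / real N \<le> pi" and Y: "Y \<in> H1_0_sp T"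
    and zero: "\<And>i. 0 < i \<Longrightarrow> i < N \<Longrightarrow> anti_part (Y (real i * (T / real N))) = 0"
  shows "second_var_ext J T Y \<le> 0"
proof -
  define L where "L = T / real N"
  have L: "0 < L" "L \<le> pi" "real N * L = T" using T N by (simp_all add: L_def)
  obtain Z where Z: "h1_deriv T Y Z"
    using Y unfolding H1_0_sp_def by blast
  have Y0: "Y 0 = 0" "Y T = 0" using Y unfolding H1_0_sp_def by blast+
  obtain Ys where Ys: "\<And>k. smooth_var T (Ys k)" and conv: "h1_conv T Ys Y"
    using smooth_var_dense[OF Y T] by blast
  obtain Zs Z' where Zs: "\<And>k. h1_deriv T (Ys k) (Zs k)" and Z': "h1_deriv T Y Z'"
    and lim: "(\<lambda>k. Ys k 0) \<longlonglongrightarrow> Y 0" "(\<lambda>k. l2_sq T (\<lambda>t. Zs k t - Z' t)) \<longlonglongrightarrow> 0"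
    using conv unfolding h1_conv_def l2_sq_def by blast
  obtain \<eta> where \<eta>: "\<eta> \<longlonglongrightarrow> 0" "\<And>k t. t \<in> {0..T} \<Longrightarrow> norm (Ys k t - Y t) \<le> \<eta> k"
    using h1_conv_uniform[OF Zs Z' _ lim] T by (metis less_imp_le)
  define \<nu> where "\<nu> A B = trace (anti_part A ** anti_part B)" for A B :: "'n pmat"
  have \<nu>: "bounded_bilinear \<nu>"
  proof -
    have lin: "linear anti_part" using bounded_linear_anti_part by (rule bounded_linear.linear)
    have "bilinear \<nu>"
      unfolding bilinear_def \<nu>_def
      by (auto intro!: linearI simp: linear_add[OF lin] linear_scale[OF lin] matrix_distribs trace_add trace_scaleR)
    then show ?thesis by (simp add: bilinear_conv_bounded_bilinear)
  qed
  have pt: "(\<lambda>k. Ys k t) \<longlonglongrightarrow> Y t" if "t \<in> {0..T}" for t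
    by (rule LIM_zero_cancel, rule Lim_null_comparison[OF _ \<eta>(1)])
       (use \<eta>(2)[OF that] in \<open>simp add: always_eventually\<close>)
  have \<nu>pt: "(\<lambda>k. \<nu> (Ys k (real i * L)) (Ys k (real i * L))) \<longlonglongrightarrow> 0" if iN: "i \<le> N" for i
  proof -
    have iT: "real i * L \<in> {0..T}"
      using iN L mult_right_mono[of "real i" "real N" L] by auto
    have "(\<lambda>k. \<nu> (Ys k (real i * L)) (Ys k (real i * L))) \<longlonglongrightarrow> \<nu> (Y (real i * L)) (Y (real i * L))"
      by (intro bounded_bilinear.tendsto[OF \<nu>] pt iT)
    moreover have "anti_part (Y (real i * L)) = 0"
    proof -
      consider "i = 0" | "0 < i" "i < N" | "i = N" using iN by linarith
      then show ?thesis
        using zero[of i] Y0 L(3) by cases (auto simp: L_def[symmetric] anti_part_def)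
    qed
    ultimately show ?thesis by (simp add: \<nu>_def trace_def)
  qed
  define I where "I = integral {0..T} (\<lambda>t. \<nu> (Y t) (Y t))"
  have \<nu>int: "(\<lambda>k. integral {0..T} (\<lambda>t. \<nu> (Ys k t) (Ys k t))) \<longlonglongrightarrow> I"
    unfolding I_def
  proof (rule integral_bilinear_tendsto[OF \<nu>])
    show "sq_int T (Ys k)" for k by (rule sq_int_continuous[OF h1_deriv_continuous[OF Zs]])
    show "sq_int T Y" by (rule sq_int_continuous[OF h1_deriv_continuous[OF Z]])
    have dY: "sq_int T (\<lambda>t. Ys k t - Y t)" for k
      by (intro sq_int_diff sq_int_continuous h1_deriv_continuous[OF Zs] h1_deriv_continuous[OF Z])
    have dZ: "sq_int T (\<lambda>t. Zs k t - Z' t)" for k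
      by (intro sq_int_diff h1_deriv_sq_int[OF Zs] h1_deriv_sq_int[OF Z'])
    have pair: "(\<lambda>k. l2_sq T (\<lambda>t. (Ys k t, Zs k t) - (Y t, Z' t))) \<longlonglongrightarrow> 0"
      by (rule h1_conv_pair[OF Zs Z' _ lim]) (use T in simp)
    have "l2_sq T (\<lambda>t. Ys k t - Y t) \<le> l2_sq T (\<lambda>t. (Ys k t, Zs k t) - (Y t, Z' t))" for k
      using l2_sq_Pair[OF dY dZ, of k] l2_sq_nonneg[of T "\<lambda>t. Zs k t - Z' t"] by simp
    then show "(\<lambda>k. l2_sq T (\<lambda>t. Ys k t - Y t)) \<longlonglongrightarrow> 0"
      by (rule tendsto_sandwich[OF always_eventually[OF allI[OF l2_sq_nonneg]]
            always_eventually[OF allI] tendsto_const pair])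
  qed
  have Q: "(\<lambda>k. second_var J T (Ys k)) \<longlonglongrightarrow> second_var_ext J T Y"
    using second_var_h1_tendsto[OF cs_squared T Z Ys conv] second_var_ext_eq[OF cs_squared T Y Z] by simp
  \<comment> \<open>For fixed \<open>c\<close> the tangent is a finite constant, so the boundary
    terms vanish in the limit of the approximants and only (1 - c^2) times the integral
    remains.\<close>
  have le: "2 * real CARD('n) * second_var_ext J T Y \<le> (1 - c\<^sup>2) * I" if c: "0 < c" "c < 1" for c
  proof -
    define b where "b k = (1 - c\<^sup>2) * integral {0..T} (\<lambda>t. \<nu> (Ys k t) (Ys k t)) + (\<Sum>i<N. c * tan (c * (L / 2)) *
        (\<nu> (Ys k (real i * L)) (Ys k (real i * L)) + \<nu> (Ys k (real (Suc i) * L)) (Ys k (real (Suc i) * L))))" for k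
    have "2 * real CARD('n) * second_var J T (Ys k) \<le> b k" for k
    proof -
      obtain D where D: "D 0 = Ys k" "\<And>j t. (D j has_vector_derivative D (Suc j) t) (at t)"
        using Ys[of k] unfolding smooth_var_def smooth_curve_def by blast
      have D0: "(Ys k has_vector_derivative D 1 t) (at t)" for t
        using D(2)[of 0 t] D(1) by simp
      have D1: "continuous_on UNIV (D 1)"
        using D(2)[of 1] by (meson continuous_at_imp_continuous_on has_vector_derivative_continuous)
      have sp: "in_sp (Ys k t)" if "t \<in> {0..T}" for t
        using Ys[of k] that unfolding smooth_var_def by blast
      show ?thesis
        using var_form_integral_sum_le[OF D0 D1 sp T c L(1,2), of N]
        unfolding second_var_eq[OF cs_squared D0 D1] b_def \<nu>_def L(3) by simp
    qed
    moreover have "b \<longlonglongrightarrow> (1 - c\<^sup>2) * I + (\<Sum>i<N. c * tan (c * (L / 2)) * (0 + 0))"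
      unfolding b_def[abs_def]
      by (intro tendsto_add tendsto_mult tendsto_const tendsto_sum \<nu>int \<nu>pt) auto
    moreover have "(\<lambda>k. 2 * real CARD('n) * second_var J T (Ys k)) \<longlonglongrightarrow> 2 * real CARD('n) * second_var_ext J T Y"
      by (intro tendsto_mult tendsto_const Q)
    ultimately show ?thesis
      using LIMSEQ_le[of "\<lambda>k. 2 * real CARD('n) * second_var J T (Ys k)" _ b] by auto
  qed
  \<comment> \<open>The double successor starts the sequence at 1/2, so every term lies strictly
    between 0 and 1.\<close>
  define c where "c k = 1 - inverse (real (Suc (Suc k)))" for k
  have "c \<longlonglongrightarrow> 1 - 0"
    unfolding c_def[abs_def] by (intro tendsto_diff tendsto_const LIMSEQ_Suc[OF LIMSEQ_inverse_real_of_nat])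
  then have "(\<lambda>k. (1 - (c k)\<^sup>2) * I) \<longlonglongrightarrow> (1 - (1 - 0)\<^sup>2) * I"
    by (intro tendsto_intros)
  moreover have "2 * real CARD('n) * second_var_ext J T Y \<le> (1 - (c k)\<^sup>2) * I" for k
    by (rule le) (auto simp: c_def field_simps)
  ultimately have "2 * real CARD('n) * second_var_ext J T Y \<le> 0"
    using LIMSEQ_le_const[of "\<lambda>k. (1 - (c k)\<^sup>2) * I" "(1 - (1 - 0)\<^sup>2) * I" "2 * real CARD('n) * second_var_ext J T Y"]
    by auto
  then show ?thesis
    by (simp add: mult_le_0_iff)
qed

end

subsection \<open>Finite-dimensional spaces of curves\<close>

interpretation fs: vector_space "fscale :: real \<Rightarrow> (real \<Rightarrow> 'n::finite pmat) \<Rightarrow> (real \<Rightarrow> 'n pmat)"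
  by unfold_locales (simp_all add: fscale_def fun_eq_iff scaleR_add_right scaleR_add_left)

interpretation mfs: vector_space_pair "scaleR :: real \<Rightarrow> 'n::finite pmat \<Rightarrow> 'n pmat"
    "fscale :: real \<Rightarrow> (real \<Rightarrow> 'n pmat) \<Rightarrow> (real \<Rightarrow> 'n pmat)"
  by unfold_locales

interpretation ffs: vector_space_pair "fscale :: real \<Rightarrow> (real \<Rightarrow> 'n::finite pmat) \<Rightarrow> (real \<Rightarrow> 'n pmat)"
    "fscale :: real \<Rightarrow> (real \<Rightarrow> 'n pmat) \<Rightarrow> (real \<Rightarrow> 'n pmat)"
  by unfold_locales

lemma fun_sum_apply: "(\<Sum>i\<in>A. f i) x = (\<Sum>i\<in>A. f i x)" for f :: "'i \<Rightarrow> 'a \<Rightarrow> 'b::comm_monoid_add"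
  by (induction A rule: infinite_finite_induct) auto

text \<open>Coefficients belong to indices, not to curves, so distinctness follows too: two equal
  members would satisfy the relation with coefficients 1 and -1.\<close>

lemma independent_family:
  fixes x :: "'i \<Rightarrow> real \<Rightarrow> 'n::finite pmat"
  assumes I: "finite I" and indep: "\<And>c i. (\<Sum>i\<in>I. fscale (c i) (x i)) = 0 \<Longrightarrow> i \<in> I \<Longrightarrow> c i = 0"
  shows "inj_on x I" "fs.independent (x ` I)"
proof -
  show inj: "inj_on x I"
  proof (rule inj_onI, rule ccontr)
    fix i j assume ij: "i \<in> I" "j \<in> I" "x i = x j" "i \<noteq> j"
    define c :: "'i \<Rightarrow> real" where "c k = (if k = i then 1 else if k = j then - 1 else 0)" for k
    have "(\<Sum>k\<in>I. fscale (c k) (x k)) = (\<Sum>k\<in>{i, j}. fscale (c k) (x k))"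
      using I ij by (intro sum.mono_neutral_right) (auto simp: c_def)
    also have "\<dots> = 0"
      using ij by (simp add: c_def)
    finally have "c i = 0" using indep ij(1) by blast
    then show False by (simp add: c_def)
  qed
  show "fs.independent (x ` I)"
  proof (rule fs.independent_if_scalars_zero)
    fix f v assume "(\<Sum>v\<in>x ` I. fscale (f v) v) = 0" "v \<in> x ` I"
    then show "f v = 0"
      using indep[of "\<lambda>i. f (x i)"] by (auto simp: sum.reindex[OF inj])
  qed (use I in simp)
qed

text \<open>One dimension count for three spaces of curves: curves supported on the division points,
  sine modes, and Jacobi fields. Each is an injective linear image of \<open>card P\<close> copies
  of \<open>V\<close>, and a basis of \<open>V\<close> is pushed through every
  \<open>E k\<close>.\<close>

lemma curve_family_basis:
  fixes E :: "'i \<Rightarrow> 'n::finite pmat \<Rightarrow> real \<Rightarrow> 'n pmat" and V :: "'n pmat set"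
  assumes P: "finite P" and V: "subspace V"
    and lin: "\<And>k. k \<in> P \<Longrightarrow> Vector_Spaces.linear scaleR fscale (E k)"
    and inj: "\<And>F k. (\<And>k. k \<in> P \<Longrightarrow> F k \<in> V) \<Longrightarrow> (\<Sum>k\<in>P. E k (F k)) = 0 \<Longrightarrow> k \<in> P \<Longrightarrow> F k = 0"
  obtains W where "finite W" "card W = card P * dim V" "fs.independent W"
    "fs.span W = {\<Sum>k\<in>P. E k (F k) | F. \<forall>k\<in>P. F k \<in> V}"
proof -
  obtain B where B: "B \<subseteq> V" "independent B" "V \<subseteq> span B" "card B = dim V"
    using basis_exists by blast
  have finB: "finite B" using B(2) by (rule independent_imp_finite)
  have spanB: "span B = V"
    using B V by (metis span_eq_iff span_mono subset_antisym)
  define x where "x = (\<lambda>(k, b). E k b)"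
  define W where "W = x ` (P \<times> B)"
  have E_sum: "E k (\<Sum>b\<in>B. c b *\<^sub>R b) = (\<Sum>b\<in>B. fscale (c b) (E k b))" if "k \<in> P" for k c
    by (simp add: mfs.linear_sum[OF lin[OF that]] mfs.linear_scale[OF lin[OF that]])
  have scal: "c i = 0" if c: "(\<Sum>i\<in>P \<times> B. fscale (c i) (x i)) = 0" and i: "i \<in> P \<times> B" for c i
  proof -
    define F where "F k = (\<Sum>b\<in>B. c (k, b) *\<^sub>R b)" for k
    have FV: "F k \<in> V" for k
      unfolding F_def by (intro subspace_sum[OF V] subspace_scale[OF V]) (use B(1) in auto)
    have "(\<Sum>k\<in>P. E k (F k)) = (\<Sum>k\<in>P. \<Sum>b\<in>B. fscale (c (k, b)) (E k b))"
      unfolding F_def by (intro sum.cong refl E_sum)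
    also have "\<dots> = (\<Sum>i\<in>P \<times> B. fscale (c i) (x i))"
      by (simp add: sum.cartesian_product x_def case_prod_beta)
    finally have "(\<Sum>k\<in>P. E k (F k)) = 0" using c by simp
    then have "F (fst i) = 0"
      using inj[OF FV] i by auto
    then have "c (fst i, b) = 0" if "b \<in> B" for b
      using independentD[OF B(2) finB subset_refl, of "\<lambda>b. c (fst i, b)" b] that by (simp add: F_def)
    then show ?thesis using i by auto
  qed
  have fin: "finite (P \<times> B)" using P finB by simp
  have fam: "inj_on x (P \<times> B)" "fs.independent (x ` (P \<times> B))"
    by (rule independent_family[OF fin]; rule scal; assumption)+
  show ?thesis
  proof (rule that)
    show "finite W" using fin by (simp add: W_def)
    show "card W = card P * dim V"
      by (simp add: W_def card_image[OF fam(1)] card_cartesian_product B(4))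
    show "fs.independent W" using fam(2) by (simp add: W_def)
    show "fs.span W = {\<Sum>k\<in>P. E k (F k) | F. \<forall>k\<in>P. F k \<in> V}" (is "_ = ?R")
    proof
      have RI: "(\<Sum>k\<in>P. E k (F k)) \<in> ?R" if "\<forall>k\<in>P. F k \<in> V" for F
        using that by blast
      have "fs.subspace ?R"
      proof (rule fs.subspaceI)
        show "0 \<in> ?R"
          using RI[of "\<lambda>_. 0"] by (simp add: mfs.linear_0[OF lin] subspace_0[OF V])
        show "f + g \<in> ?R" if "f \<in> ?R" "g \<in> ?R" for f g
        proof -
          obtain F F' where F: "f = (\<Sum>k\<in>P. E k (F k))" "\<forall>k\<in>P. F k \<in> V" "g = (\<Sum>k\<in>P. E k (F' k))" "\<forall>k\<in>P. F' k \<in> V"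
            using \<open>f \<in> ?R\<close> \<open>g \<in> ?R\<close> by blast
          have "f + g = (\<Sum>k\<in>P. E k (F k + F' k))"
            using F by (simp add: mfs.linear_add[OF lin] sum.distrib)
          moreover have "\<forall>k\<in>P. F k + F' k \<in> V" using F subspace_add[OF V] by blast
          ultimately show ?thesis using RI[of "\<lambda>k. F k + F' k"] by simp
        qed
        show "fscale c f \<in> ?R" if "f \<in> ?R" for c f
        proof -
          obtain F where F: "f = (\<Sum>k\<in>P. E k (F k))" "\<forall>k\<in>P. F k \<in> V"
            using \<open>f \<in> ?R\<close> by blast
          have "fscale c f = (\<Sum>k\<in>P. E k (c *\<^sub>R F k))"
            using F by (simp add: mfs.linear_scale[OF lin] fs.scale_sum_right)
          moreover have "\<forall>k\<in>P. c *\<^sub>R F k \<in> V" using F subspace_scale[OF V] by blast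
          ultimately show ?thesis using RI[of "\<lambda>k. c *\<^sub>R F k"] by simp
        qed
      qed
      moreover have "W \<subseteq> ?R"
      proof
        fix w assume "w \<in> W"
        then obtain k b where kb: "k \<in> P" "b \<in> B" "w = E k b"
          by (auto simp: W_def x_def)
        define F where "F j = (if j = k then b else 0)" for j
        have "(\<Sum>j\<in>P. E j (F j)) = (\<Sum>j\<in>{k}. E j (F j))"
          using P kb by (intro sum.mono_neutral_right) (auto simp: F_def mfs.linear_0[OF lin])
        then have "w = (\<Sum>j\<in>P. E j (F j))"
          using kb by (simp add: F_def)
        moreover have "\<forall>j\<in>P. F j \<in> V"
          using kb B(1) subspace_0[OF V] by (auto simp: F_def)
        ultimately show "w \<in> ?R" using RI[of F] by simp
      qed
      ultimately show "fs.span W \<subseteq> ?R" by (intro fs.span_minimal)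
      show "?R \<subseteq> fs.span W"
      proof
        fix f assume "f \<in> ?R"
        then obtain F where F: "f = (\<Sum>k\<in>P. E k (F k))" "\<forall>k\<in>P. F k \<in> V" by blast
        have "E k (F k) \<in> fs.span W" if k: "k \<in> P" for k
        proof -
          have "F k \<in> span B" using F(2) k by (simp add: spanB)
          then obtain c where c: "F k = (\<Sum>b\<in>B. c b *\<^sub>R b)"
            unfolding span_finite[OF finB] by blast
          show ?thesis
            unfolding c E_sum[OF k]
            by (intro fs.span_sum fs.span_scale fs.span_base) (use k in \<open>auto simp: W_def x_def\<close>)
        qed
        then show "f \<in> fs.span W"
          unfolding F(1) by (intro fs.span_sum)
      qed
    qed
  qed
qed

lemma fscale_linearI:
  fixes E :: "'n::finite pmat \<Rightarrow> real \<Rightarrow> 'n pmat"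
  assumes "\<And>t. linear (\<lambda>X. E X t)"
  shows "Vector_Spaces.linear scaleR fscale E"
  unfolding Vector_Spaces.linear_iff
  using real_vector.vector_space_axioms fs.vector_space_axioms linear_add[OF assms] linear_scale[OF assms]
  by (simp add: fscale_def fun_eq_iff)

lemma cos_integral:
  assumes T: "0 < T" and j: "j \<noteq> (0::int)"
  shows "((\<lambda>t. cos (real_of_int j * pi * t / T)) has_integral 0) {0..T}"
proof -
  have nz: "real_of_int j * pi / T \<noteq> 0" using T j by simp
  have "((\<lambda>t. cos (real_of_int j * pi * t / T)) has_integral
      sin (real_of_int j * pi * T / T) / (real_of_int j * pi / T) - sin (real_of_int j * pi * 0 / T) / (real_of_int j * pi / T)) {0..T}"
  proof (rule fundamental_theorem_of_calculus)
    show "((\<lambda>t. sin (real_of_int j * pi * t / T) / (real_of_int j * pi / T)) has_vector_derivative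
        cos (real_of_int j * pi * t / T)) (at t within {0..T})" for t
      unfolding has_real_derivative_iff_has_vector_derivative[symmetric]
      using nz T by (auto intro!: derivative_eq_intros)
  qed (use T in simp)
  moreover have "sin (real_of_int j * pi * T / T) = 0"
    using T by (simp add: sin_times_pi_eq_0)
  ultimately show ?thesis by simp
qed

lemma sin_cos_orthogonal:
  fixes k l :: nat
  assumes T: "0 < T" and kl: "0 < k" "0 < l"
  shows "((\<lambda>t. sin (real k * pi * t / T) * sin (real l * pi * t / T)) has_integral (if k = l then T / 2 else 0)) {0..T}"
    and "((\<lambda>t. cos (real k * pi * t / T) * cos (real l * pi * t / T)) has_integral (if k = l then T / 2 else 0)) {0..T}"
proof -
  have sum: "((\<lambda>t. cos (real k * pi * t / T + real l * pi * t / T)) has_integral 0) {0..T}"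
    using cos_integral[OF T, of "int k + int l"] kl by (simp add: add_divide_distrib distrib_right)
  have diff: "((\<lambda>t. cos (real k * pi * t / T - real l * pi * t / T)) has_integral (if k = l then T else 0)) {0..T}"
  proof (cases "k = l")
    case True
    then show ?thesis using has_integral_const_real[of "1::real" 0 T] T by simp
  next
    case False
    then show ?thesis
      using cos_integral[OF T, of "int k - int l"] by (simp add: diff_divide_distrib left_diff_distrib)
  qed
  show "((\<lambda>t. sin (real k * pi * t / T) * sin (real l * pi * t / T)) has_integral (if k = l then T / 2 else 0)) {0..T}"
    unfolding sin_times_sin using has_integral_divide[OF has_integral_diff[OF diff sum], of 2] by (simp split: if_splits)
  show "((\<lambda>t. cos (real k * pi * t / T) * cos (real l * pi * t / T)) has_integral (if k = l then T / 2 else 0)) {0..T}"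
    unfolding cos_times_cos using has_integral_divide[OF has_integral_add[OF diff sum], of 2] by (simp split: if_splits)
qed

section \<open>Upper and lower bounds for the co-index\<close>

context compatible
begin

text \<open>\<open>\<Lambda>\<close> records the anticommuting part at the interior division points.
  An element of \<open>S\<close> in its kernel has nonpositive second variation and must be 0, so
  \<open>\<Lambda>\<close> embeds \<open>S\<close> into a space of dimension at most (N - 1) (n^2 +
  n).\<close>

lemma coindex_dims_le:
  assumes T: "0 < T" and N: "0 < N" "T / real N \<le> pi" and d: "d \<in> coindex_dims J T"
  shows "d \<le> (N - 1) * (CARD('n)\<^sup>2 + CARD('n))"
proof -
  obtain S B where dS: "d = fs.dim S" and S: "finite B" "S = fs.span B" "S \<subseteq> H1_0_sp T"
    and pos: "\<forall>Y\<in>S. Y \<noteq> 0 \<longrightarrow> 0 < second_var_ext J T Y"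
    using d unfolding coindex_dims_def mem_Collect_eq by (elim exE conjE) (rule that)
  define P where "P = (\<lambda>i. real i * (T / real N)) ` {0<..<N}"
  have finP: "finite P" by (simp add: P_def)
  have cardP: "card P \<le> N - 1"
    using card_image_le[of "{0<..<N}" "\<lambda>i. real i * (T / real N)"] by (simp add: P_def)
  \<comment> \<open>Values at the points of \<open>P\<close> are encoded as curves vanishing off
    \<open>P\<close>, so the target of \<open>\<Lambda>\<close> lies in the same vector space of
    curves.\<close>
  define E :: "real \<Rightarrow> 'n pmat \<Rightarrow> real \<Rightarrow> 'n pmat" where "E p F = (\<lambda>t. if t = p then F else 0)" for p F
  have E: "Vector_Spaces.linear scaleR fscale (E p)" for p
    by (rule fscale_linearI) (auto simp: E_def intro!: linearI)
  have Eval: "(\<Sum>p\<in>P. E p (F p)) t = (if t \<in> P then F t else 0)" for F t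
    using finP by (simp add: fun_sum_apply E_def)
  obtain W where W: "finite W" "card W = card P * dim anti_sp"
    "fs.span W = {\<Sum>p\<in>P. E p (F p) | F. \<forall>p\<in>P. F p \<in> anti_sp}"
  proof (rule curve_family_basis[OF finP subspace_anti_sp E])
    fix F k assume "(\<Sum>k\<in>P. E k (F k)) = 0" "k \<in> P"
    then show "F k = 0"
      using Eval[of F k] by simp
  qed blast
  define \<Lambda> where "\<Lambda> Y = (\<lambda>t. if t \<in> P then anti_part (Y t) else 0)" for Y
  have \<Lambda>: "Vector_Spaces.linear fscale fscale \<Lambda>"
    unfolding Vector_Spaces.linear_iff using bounded_linear.linear[OF bounded_linear_anti_part] fs.vector_space_axioms
    by (simp add: \<Lambda>_def fscale_def fun_eq_iff linear_add linear_scale)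
  have PT: "t \<in> {0..T}" if tP: "t \<in> P" for t
  proof -
    obtain i where i: "0 < i" "i < N" "t = real i * (T / real N)" using tP by (auto simp: P_def)
    have "real i * (T / real N) \<le> real N * (T / real N)"
      using i T by (intro mult_right_mono) auto
    also have "\<dots> = T" using N(1) by simp
    finally show ?thesis using i(3) T by simp
  qed
  obtain A where A: "A \<subseteq> S" "fs.independent A" "S \<subseteq> fs.span A" "card A = fs.dim S"
    using fs.basis_exists by blast
  have spanA: "fs.span A = S"
    using A S by (metis fs.span_mono fs.span_span subset_antisym)
  have inj: "inj_on \<Lambda> (fs.span A)"
  proof (rule inj_onI)
    fix x y assume xy: "x \<in> fs.span A" "y \<in> fs.span A" "\<Lambda> x = \<Lambda> y"
    have xyS: "x - y \<in> S"
      using xy spanA fs.span_diff by blast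
    have z: "anti_part ((x - y) t) = 0" if "t \<in> P" for t
      using fun_cong[OF xy(3), of t] that bounded_linear.linear[OF bounded_linear_anti_part]
      by (simp add: \<Lambda>_def linear_diff)
    have "second_var_ext J T (x - y) \<le> 0"
    proof (rule second_var_ext_nonpos[OF T N])
      show "x - y \<in> H1_0_sp T" using xyS S(3) by blast
      show "anti_part ((x - y) (real i * (T / real N))) = 0" if "0 < i" "i < N" for i
        by (rule z) (use that in \<open>unfold P_def, blast intro: greaterThanLessThan_iff[THEN iffD2]\<close>)
    qed
    then have "x - y = 0"
      using bspec[OF pos xyS] by linarith
    then show "x = y" by simp
  qed
  have \<Lambda>A: "fs.independent (\<Lambda> ` A)" "inj_on \<Lambda> A"
    by (rule ffs.linear_independent_injective_image[OF \<Lambda> A(2) inj])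
       (rule inj_on_subset[OF inj fs.span_superset])
  have "\<Lambda> ` A \<subseteq> fs.span W"
  proof
    fix w assume "w \<in> \<Lambda> ` A"
    then obtain Y where Y: "Y \<in> S" "w = \<Lambda> Y" using A(1) by blast
    have "w = (\<Sum>p\<in>P. E p (anti_part (Y p)))"
      unfolding fun_eq_iff Eval Y(2) \<Lambda>_def by blast
    moreover have "\<forall>p\<in>P. anti_part (Y p) \<in> anti_sp"
      using Y(1) S(3) PT by (auto intro!: anti_part_in_anti_sp simp: H1_0_sp_def)
    ultimately show "w \<in> fs.span W"
      unfolding W(3) by (intro CollectI exI[of _ "\<lambda>p. anti_part (Y p)"]) simp
  qed
  then have "card (\<Lambda> ` A) \<le> card W"
    using fs.independent_span_bound[OF W(1) \<Lambda>A(1)] by blast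
  then have "d \<le> card P * dim anti_sp"
    using W(2) A(4) dS by (simp add: card_image[OF \<Lambda>A(2)])
  also have "\<dots> \<le> (N - 1) * (CARD('n)\<^sup>2 + CARD('n))"
    unfolding dim_anti_sp by (intro mult_right_mono cardP) simp
  finally show ?thesis .
qed

text \<open>The exponential of \<open>t *\<^sub>R J\<close> in closed form.\<close>

definition rot :: "real \<Rightarrow> 'n pmat" where
  "rot t = cos t *\<^sub>R mat 1 + sin t *\<^sub>R J"

lemma rot_has_derivative: "(rot has_vector_derivative J ** rot t) (at t within S)"
  unfolding rot_def[abs_def]
  by (rule has_vector_derivative_eq_rhs, (rule derivative_intros)+)
     (auto simp: matrix_distribs cs_squared algebra_simps has_real_derivative_iff_has_vector_derivative[symmetric]
       intro!: derivative_eq_intros)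

lemma rot_scaled_has_derivative:
  "((\<lambda>t. rot (c * t)) has_vector_derivative c *\<^sub>R (J ** rot (c * t))) (at t within S)"
proof -
  have "((\<lambda>t. c * t) has_vector_derivative c) (at t within S)"
    by (auto intro!: derivative_eq_intros simp flip: has_real_derivative_iff_has_vector_derivative)
  from vector_diff_chain_within[OF this rot_has_derivative] show ?thesis by (simp add: o_def)
qed

lemma rot_anti: "X \<in> anti_sp \<Longrightarrow> rot t ** X \<in> anti_sp"
  unfolding rot_def matrix_distribs matrix_mul_lid
  by (intro subspace_add[OF subspace_anti_sp] subspace_scale[OF subspace_anti_sp] cs_mult_anti_sp)

lemma rot_inverse: "rot (- t) ** (rot t ** X) = X"
proof -
  have "rot (- t) ** (rot t ** X) = (cos t)\<^sup>2 *\<^sub>R X + (sin t)\<^sup>2 *\<^sub>R X"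
    by (simp add: rot_def matrix_distribs cs_mult_cs power2_eq_square scaleR_add_right scaleR_diff_right
        mult.commute flip: matrix_mul_assoc)
  then show ?thesis by (simp flip: scaleR_add_left)
qed

lemma anti_sp_rot: "X \<in> anti_sp \<Longrightarrow> X ** (rot t ** Y) = rot (- t) ** (X ** Y)"
  by (simp add: rot_def matrix_distribs anti_sp_mult)

text \<open>Moving a rotation across an element of \<open>anti_sp\<close> inverts it, so the two
  rotations cancel.\<close>

lemma trace_rot:
  assumes "A \<in> anti_sp" shows "trace (rot t ** A ** (rot t ** B)) = trace (A ** B)"
proof -
  have "rot t ** A ** (rot t ** B) = rot t ** (rot (- t) ** (A ** B))"
    using anti_sp_rot[OF assms, of t B] by (simp flip: matrix_mul_assoc)
  also have "\<dots> = A ** B"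
    using rot_inverse[of "- t" "A ** B"] by simp
  finally show ?thesis by simp
qed

text \<open>\<open>rot t ** (J ** E + E')\<close> is the velocity of the curve
  \<open>rot t ** E\<close>. In the rotating frame the cross terms cancel and one copy of tr(E E) is
  left over.\<close>

lemma var_form_rot:
  assumes E: "E \<in> anti_sp" and E': "E' \<in> anti_sp"
  shows "2 * real CARD('n) * var_form J (rot t ** E, rot t ** (J ** E + E')) (rot t ** E, rot t ** (J ** E + E'))
    = trace (E ** E) - trace (E' ** E')"
proof -
  define G where "G = J ** E + E'"
  have G: "G \<in> anti_sp"
    unfolding G_def by (intro subspace_add[OF subspace_anti_sp] cs_mult_anti_sp E E')
  have r: "rot t ** E \<in> anti_sp" "rot t ** G \<in> anti_sp"
    by (intro rot_anti E G)+
  have sp: "in_sp (rot t ** E)" "in_sp (rot t ** G)" using r by (auto simp: anti_sp_def)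
  have z: "trace (0 :: 'n pmat) = 0" by (simp add: trace_def)
  have Jrot: "J ** (rot t ** X) = rot t ** (J ** X)" for X
    by (simp add: rot_def matrix_distribs)
  have "2 * real CARD('n) * var_form J (rot t ** E, rot t ** G) (rot t ** E, rot t ** G)
      = - trace (rot t ** G ** (rot t ** G)) + 2 * trace (J ** (rot t ** E) ** (rot t ** G))"
    unfolding var_form_eq[OF sp] anti_part_id[OF r(1)] anti_part_id[OF r(2)] by (simp add: z)
  also have "\<dots> = - trace (G ** G) + 2 * trace (J ** E ** G)"
    unfolding Jrot trace_rot[OF G] trace_rot[OF cs_mult_anti_sp[OF E]] ..
  also have "trace (G ** G) = trace (E ** E) + 2 * trace (J ** (E ** E')) + trace (E' ** E')"
  proof -
    have "trace (J ** (E' ** E)) = - trace (J ** (E ** E'))"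
      by (rule trace_cs_anti_swap[OF E])
    then show ?thesis
      unfolding G_def
      by (simp add: matrix_distribs anti_sp_mult[OF E] anti_sp_mult[OF E'] cs_mult_cs trace_add trace_sub trace_minus
          flip: matrix_mul_assoc)
  qed
  also have "trace (J ** E ** G) = trace (E ** E) + trace (J ** (E ** E'))"
    unfolding G_def
    by (simp add: matrix_distribs anti_sp_mult[OF E] cs_mult_cs trace_add flip: matrix_mul_assoc)
  finally show ?thesis by (simp add: G_def)
qed

text \<open>Orthogonality of sines and of cosines diagonalises the form in the rotating frame: mode
  \<open>k\<close> contributes (1 - \<kappa>^2) (T/2) tr(F F), up to the factor 1/(2n), with
  \<kappa> = k pi / T < 1.\<close>

lemma coindex_dims_attained:
  assumes T: "0 < T" and K: "real K * pi < T"
  shows "K * (CARD('n)\<^sup>2 + CARD('n)) \<in> coindex_dims J T"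
proof -
  define P where "P = {1..K}"
  define \<kappa> where "\<kappa> k = real k * pi / T" for k :: nat
  \<comment> \<open>\<open>H1_0_sp\<close> consists of curves that are 0 outside [0,T], hence the
    cut-off.\<close>
  define E :: "nat \<Rightarrow> 'n pmat \<Rightarrow> real \<Rightarrow> 'n pmat" where
    "E k F = (\<lambda>t. if t \<in> {0..T} then sin (\<kappa> k * t) *\<^sub>R (rot t ** F) else 0)" for k F
  have \<kappa>: "0 < \<kappa> k" "\<kappa> k < 1" if "k \<in> P" for k
  proof -
    have "real k * pi \<le> real K * pi" using that by (intro mult_right_mono) (auto simp: P_def)
    then have "real k * pi < T" using K by (rule le_less_trans)
    then show "0 < \<kappa> k" "\<kappa> k < 1" using that T by (auto simp: \<kappa>_def P_def)
  qed
  have linE: "Vector_Spaces.linear scaleR fscale (E k)" for k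
    by (rule fscale_linearI) (auto simp: E_def matrix_distribs scaleR_add_right intro!: linearI)
  have orth: "((\<lambda>t. sin (\<kappa> k * t) * sin (\<kappa> l * t)) has_integral (if k = l then T / 2 else 0)) {0..T}"
    "((\<lambda>t. cos (\<kappa> k * t) * cos (\<kappa> l * t)) has_integral (if k = l then T / 2 else 0)) {0..T}"
    if "k \<in> P" "l \<in> P" for k l
    using sin_cos_orthogonal[OF T, of k l] that by (simp_all add: \<kappa>_def P_def)
  define e where "e F t = (\<Sum>k\<in>P. sin (\<kappa> k * t) *\<^sub>R F k)" for F :: "nat \<Rightarrow> 'n pmat" and t
  define e' where "e' F t = (\<Sum>k\<in>P. (\<kappa> k * cos (\<kappa> k * t)) *\<^sub>R F k)" for F :: "nat \<Rightarrow> 'n pmat" and t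
  have e_anti: "e F t \<in> anti_sp" "e' F t \<in> anti_sp" if "\<And>k. k \<in> P \<Longrightarrow> F k \<in> anti_sp" for F t
    unfolding e_def e'_def
    by (intro subspace_sum[OF subspace_anti_sp] subspace_scale[OF subspace_anti_sp] that; simp)+
  have E_eq: "(\<Sum>k\<in>P. E k (F k)) t = (if t \<in> {0..T} then rot t ** e F t else 0)" for F t
    by (cases "t \<in> {0..T}") (simp_all add: fun_sum_apply E_def e_def matmul.sum_right matrix_distribs
        del: atLeastAtMost_iff)
  have trsum: "trace ((\<Sum>k\<in>P. a k *\<^sub>R F k) ** (\<Sum>k\<in>P. a k *\<^sub>R F k))
      = (\<Sum>k\<in>P. \<Sum>l\<in>P. (a k * a l) * trace (F k ** F l))" for a and F :: "nat \<Rightarrow> 'n pmat"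
    by (simp add: matmul.sum_left matmul.sum_right linear_sum[OF bounded_linear.linear[OF bounded_linear_trace]] matrix_distribs trace_scaleR mult.assoc
        sum_distrib_left, subst sum.swap, simp add: mult.left_commute)
  have int_e: "((\<lambda>t. trace (e F t ** e F t)) has_integral (\<Sum>k\<in>P. T / 2 * trace (F k ** F k))) {0..T}" for F
  proof -
    have "((\<lambda>t. trace (e F t ** e F t)) has_integral
        (\<Sum>k\<in>P. \<Sum>l\<in>P. (if k = l then T / 2 else 0) * trace (F k ** F l))) {0..T}"
      unfolding e_def trsum
      by (intro has_integral_sum has_integral_mult_left orth) (auto simp: P_def)
    then show ?thesis by (simp add: P_def if_distrib[of "\<lambda>x. x * _"] cong: if_cong)
  qed
  have int_e': "((\<lambda>t. trace (e' F t ** e' F t)) has_integral (\<Sum>k\<in>P. (\<kappa> k)\<^sup>2 * (T / 2 * trace (F k ** F k)))) {0..T}" for F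
  proof -
    have "((\<lambda>t. \<kappa> k * cos (\<kappa> k * t) * (\<kappa> l * cos (\<kappa> l * t))) has_integral \<kappa> k * \<kappa> l * (if k = l then T / 2 else 0)) {0..T}"
      if "k \<in> P" "l \<in> P" for k l
      using has_integral_mult_right[OF orth(2)[OF that], of "\<kappa> k * \<kappa> l"] by (simp add: mult_ac)
    then have "((\<lambda>t. trace (e' F t ** e' F t)) has_integral
        (\<Sum>k\<in>P. \<Sum>l\<in>P. (\<kappa> k * \<kappa> l * (if k = l then T / 2 else 0)) * trace (F k ** F l))) {0..T}"
      unfolding e'_def trsum
      by (intro has_integral_sum has_integral_mult_left) (auto simp: P_def)
    then show ?thesis
      by (simp add: P_def if_distrib[of "\<lambda>x. x * _"] if_distrib[of "\<lambda>x. _ * x"] power2_eq_square mult.assoc cong: if_cong)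
  qed
  have trF: "0 \<le> trace (X ** X)" "trace (X ** X) = 0 \<longleftrightarrow> X = 0" if "X \<in> anti_sp" for X
    using trace_square_pos[OF anti_sp_cs_symmetric[OF that]] by blast+
  have inj: "F k = 0" if F: "\<And>k. k \<in> P \<Longrightarrow> F k \<in> anti_sp" and z: "(\<Sum>k\<in>P. E k (F k)) = 0" and k: "k \<in> P" for F k
  proof -
    have e0: "e F t = 0" if "t \<in> {0..T}" for t
    proof -
      have "rot t ** e F t = 0" using E_eq[of F t] z that by simp
      then show ?thesis using rot_inverse[of t "e F t"] by simp
    qed
    have "((\<lambda>t. trace (e F t ** e F t)) has_integral 0) {0..T}"
      by (rule has_integral_is_0) (simp add: e0 trace_def)
    with int_e have "(\<Sum>k\<in>P. T / 2 * trace (F k ** F k)) = 0"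
      by (rule has_integral_unique)
    moreover have "0 \<le> T / 2 * trace (F j ** F j)" if "j \<in> P" for j
      using T trF(1)[OF F[OF that]] by simp
    ultimately have "\<forall>j\<in>P. T / 2 * trace (F j ** F j) = 0"
      by (subst (asm) sum_nonneg_eq_0_iff) (simp_all add: P_def)
    then show ?thesis using T trF(2)[OF F[OF k]] k by simp
  qed
  obtain W where W: "finite W" "card W = card P * dim anti_sp" "fs.independent W"
    "fs.span W = {\<Sum>k\<in>P. E k (F k) | F. \<forall>k\<in>P. F k \<in> anti_sp}"
  proof (rule curve_family_basis[where P = P and V = anti_sp and E = E])
    show "F k = 0" if "\<And>k. k \<in> P \<Longrightarrow> F k \<in> anti_sp" "(\<Sum>k\<in>P. E k (F k)) = 0" "k \<in> P" for F k
      using that by (rule inj)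
  qed (use subspace_anti_sp linE in \<open>auto simp: P_def\<close>)
  have props: "Y \<in> H1_0_sp T \<and> (Y \<noteq> 0 \<longrightarrow> 0 < second_var_ext J T Y)" if "Y \<in> fs.span W" for Y
  proof -
    obtain F where Y: "Y = (\<Sum>k\<in>P. E k (F k))" and F: "\<And>k. k \<in> P \<Longrightarrow> F k \<in> anti_sp"
      using \<open>Y \<in> fs.span W\<close> unfolding W(4) by blast
    have eF: "e F t \<in> anti_sp" "e' F t \<in> anti_sp" for t
      by (rule e_anti, rule F, assumption)+
    define Z where "Z t = rot t ** (J ** e F t + e' F t)" for t
    have Yt: "Y t = rot t ** e F t" if "t \<in> {0..T}" for t
      using that by (simp add: Y E_eq)
    have de: "(e F has_vector_derivative e' F t) (at t within S)" for t S
      unfolding e_def[abs_def] e'_def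
      by (intro has_vector_derivative_sum has_vector_derivative_scaleR[THEN has_vector_derivative_eq_rhs] 
          has_vector_derivative_const)
         (auto intro!: derivative_eq_intros)
    have dY: "((\<lambda>t. rot t ** e F t) has_vector_derivative Z t) (at t within S)" for t S
      by (rule has_vector_derivative_eq_rhs[OF matmul_has_vector_derivative[OF rot_has_derivative de]])
         (simp add: Z_def rot_def matrix_distribs matrix_mul_assoc algebra_simps)
    have Zc: "continuous_on {0..T} Z"
      unfolding Z_def[abs_def] e_def e'_def rot_def
      by (intro continuous_intros matmul.continuous_on)
    have hZ: "h1_deriv T Y Z"
    proof (rule h1_deriv_C1[OF _ Zc])
      show "(Y has_vector_derivative Z t) (at t within {0..T})" if "t \<in> {0..T}" for t
        by (rule has_vector_derivative_transform[OF that _ dY]) (simp add: Yt)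
    qed
    have sinT: "sin (\<kappa> k * T) = 0" for k
      using T by (simp add: \<kappa>_def)
    have YH: "Y \<in> H1_0_sp T"
      unfolding H1_0_sp_def
    proof (intro CollectI conjI exI ballI allI impI)
      show "h1_deriv T Y Z" by (rule hZ)
      show "Y 0 = 0" using Yt[of 0] T by (simp add: e_def)
      show "Y T = 0" using Yt[of T] T by (simp add: e_def sinT)
      show "in_sp (Y t)" if "t \<in> {0..T}" for t
        using rot_anti[OF eF(1)[of t], of t] Yt[OF that] by (simp add: anti_sp_def)
      show "Y t = 0" if "t \<notin> {0..T}" for t
        unfolding Y E_eq using that by (simp only: if_False)
    qed
    have "0 < second_var_ext J T Y" if Y0: "Y \<noteq> 0"
    proof -
      obtain k where k: "k \<in> P" "F k \<noteq> 0"
      proof (rule ccontr)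
        assume "\<not> thesis"
        then have "\<And>k. k \<in> P \<Longrightarrow> F k = 0" using that by blast
        then have "Y = 0"
          unfolding Y by (intro sum.neutral) (simp add: mfs.linear_0[OF linE])
        with Y0 show False by simp
      qed
      have "((\<lambda>t. trace (e F t ** e F t) - trace (e' F t ** e' F t)) has_integral
          (\<Sum>k\<in>P. T / 2 * trace (F k ** F k)) - (\<Sum>k\<in>P. (\<kappa> k)\<^sup>2 * (T / 2 * trace (F k ** F k)))) {0..T}"
        by (rule has_integral_diff[OF int_e int_e'])
      then have "((\<lambda>t. 2 * real CARD('n) * var_form J (Y t, Z t) (Y t, Z t)) has_integral
          (\<Sum>k\<in>P. T / 2 * trace (F k ** F k)) - (\<Sum>k\<in>P. (\<kappa> k)\<^sup>2 * (T / 2 * trace (F k ** F k)))) {0..T}"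
        by (rule has_integral_eq[rotated]) (use var_form_rot[OF eF] in \<open>simp add: Yt Z_def\<close>)
      then have "integral {0..T} (\<lambda>t. 2 * real CARD('n) * var_form J (Y t, Z t) (Y t, Z t))
          = (\<Sum>k\<in>P. T / 2 * trace (F k ** F k)) - (\<Sum>k\<in>P. (\<kappa> k)\<^sup>2 * (T / 2 * trace (F k ** F k)))"
        by (rule integral_unique)
      also have "\<dots> = (\<Sum>k\<in>P. (1 - (\<kappa> k)\<^sup>2) * (T / 2 * trace (F k ** F k)))"
        by (simp only: left_diff_distrib mult_1_left sum_subtractf)
      also have "\<dots> > 0"
      proof (rule sum_pos2[of _ k])
        have \<kappa>1: "0 < 1 - (\<kappa> j)\<^sup>2" if "j \<in> P" for j
          using \<kappa>[OF that] by (simp add: power_less_one_iff abs_square_less_1)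
        show "0 \<le> (1 - (\<kappa> j)\<^sup>2) * (T / 2 * trace (F j ** F j))" if "j \<in> P" for j
          using \<kappa>1[OF that] T trF(1)[OF F[OF that]] by simp
        have "0 < trace (F k ** F k)"
          using trF[OF F[OF k(1)]] k(2) by linarith
        then show "0 < (1 - (\<kappa> k)\<^sup>2) * (T / 2 * trace (F k ** F k))"
          using \<kappa>1[OF k(1)] T by simp
      qed (use k in \<open>auto simp: P_def\<close>)
      finally have "0 < 2 * real CARD('n) * second_var_ext J T Y"
        unfolding second_var_ext_eq[OF cs_squared T YH hZ] by simp
      then show ?thesis by (simp add: zero_less_mult_iff)
    qed
    with YH show ?thesis by blast
  qed
  have "K * (CARD('n)\<^sup>2 + CARD('n)) = fs.dim (fs.span W)"
    using fs.dim_span_eq_card_independent[OF W(3)] W(2) by (simp add: dim_anti_sp P_def)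
  then show ?thesis
    unfolding coindex_dims_def using W(1) props by blast
qed

subsection \<open>Jacobi fields\<close>

text \<open>The commutator with \<open>J\<close> kills the commuting part of Y' and acts on the
  anticommuting part as 2 J. So the former is constant, the latter rotates at double speed, and one
  integration from \<open>Y 0 = 0\<close> gives the formula.\<close>

lemma jacobi_field_form:
  assumes Y: "jacobi_field J Y" "Y 0 = 0"
  obtains A C where "A \<in> anti_sp" "J ** C = C ** J" "\<And>t. Y t = t *\<^sub>R C + (rot (2 * t) - mat 1) ** A"
proof -
  obtain Y1 Y2 where sp: "\<And>t. in_sp (Y t)" and d1: "\<And>t. (Y has_vector_derivative Y1 t) (at t)"
    and d2: "\<And>t. (Y1 has_vector_derivative Y2 t) (at t)" and eq: "\<And>t. Y2 t = J ** Y1 t - Y1 t ** J"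
    using Y(1) unfolding jacobi_field_def by blast
  note bl = bounded_linear_anti_part
  have sp1: "in_sp (Y1 t)" for t
    by (rule in_sp_derivative[of t "t + 1" Y t]) (use sp d1 in auto)
  have anti_eq: "anti_part (Y2 t) = Y2 t" "Y2 t = 2 *\<^sub>R (J ** anti_part (Y1 t))" for t
  proof -
    show *: "Y2 t = 2 *\<^sub>R (J ** anti_part (Y1 t))"
      by (simp add: eq anti_part_def matrix_distribs cs_mult_cs flip: matrix_mul_assoc)
    have "Y2 t \<in> anti_sp"
      unfolding * by (intro subspace_scale[OF subspace_anti_sp] cs_mult_anti_sp anti_part_in_anti_sp sp1)
    then show "anti_part (Y2 t) = Y2 t" by (rule anti_part_id)
  qed
  then have aY2: "anti_part (Y2 t) = 2 *\<^sub>R (J ** anti_part (Y1 t))" for t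
    by metis
  have C1: "((\<lambda>t. Y1 t - anti_part (Y1 t)) has_vector_derivative 0) (at t within UNIV)" for t
    using has_vector_derivative_diff[OF d2 bounded_linear.has_vector_derivative[OF bl d2], of t] anti_eq(1)[of t] by simp
  obtain C where C: "\<And>t. Y1 t - anti_part (Y1 t) = C"
    by (rule has_vector_derivative_zero_constant[OF convex_UNIV C1]) auto
  have rotJ: "rot t ** (J ** X) = J ** (rot t ** X)" for t X
    by (simp add: rot_def matrix_distribs)
  have D1: "((\<lambda>t. rot (- 2 * t) ** anti_part (Y1 t)) has_vector_derivative 0) (at t within UNIV)" for t
    by (rule has_vector_derivative_eq_rhs[OF matmul_has_vector_derivative[OF rot_scaled_has_derivative
            bounded_linear.has_vector_derivative[OF bl d2]]])
       (simp add: aY2 matrix_distribs rotJ flip: matrix_mul_assoc)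
  obtain B where B: "\<And>t. rot (- 2 * t) ** anti_part (Y1 t) = B"
    by (rule has_vector_derivative_zero_constant[OF convex_UNIV D1]) auto
  have B0: "B \<in> anti_sp"
    using B[of 0] anti_part_in_anti_sp[OF sp1[of 0]] by (simp add: rot_def)
  have aY1: "anti_part (Y1 t) = rot (2 * t) ** B" for t
    using rot_inverse[of "- 2 * t" "anti_part (Y1 t)"] B[of t] by simp
  \<comment> \<open>The inverse of 2 J is -J/2, so differentiating \<open>rot (2 * t) ** A\<close>
    gives \<open>rot (2 * t) ** B\<close>.\<close>
  define A where "A = - ((1/2) *\<^sub>R (J ** B))"
  have A: "A \<in> anti_sp"
    unfolding A_def by (intro subspace_neg[OF subspace_anti_sp] subspace_scale[OF subspace_anti_sp] cs_mult_anti_sp B0)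
  define g where "g t = t *\<^sub>R C + (rot (2 * t) - mat 1) ** A" for t
  have "(g has_vector_derivative Y1 t) (at t)" for t
  proof -
    have "((\<lambda>t. t *\<^sub>R C) has_vector_derivative C) (at t)"
      by (auto intro!: derivative_eq_intros)
    moreover have "((\<lambda>t. rot (2 * t) - mat 1) has_vector_derivative 2 *\<^sub>R (J ** rot (2 * t))) (at t)"
      using rot_scaled_has_derivative by (auto intro!: derivative_eq_intros)
    ultimately have "(g has_vector_derivative C + 2 *\<^sub>R (J ** rot (2 * t)) ** A) (at t)"
      unfolding g_def[abs_def]
      by (intro has_vector_derivative_add bounded_linear.has_vector_derivative[OF matmul.bounded_linear_left])
    moreover have "2 *\<^sub>R (J ** rot (2 * t)) ** A = anti_part (Y1 t)"
      by (simp add: A_def aY1 matrix_distribs rotJ cs_mult_cs flip: matrix_mul_assoc)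
    ultimately show ?thesis
      using C[of t] by (simp add: algebra_simps)
  qed
  then have "((\<lambda>t. Y t - g t) has_vector_derivative 0) (at t within UNIV)" for t
    using has_vector_derivative_diff[OF d1, of g "Y1 t" t] by simp
  then obtain c where c: "\<And>t. Y t - g t = c"
    by (rule has_vector_derivative_zero_constant[OF convex_UNIV]) auto
  have "Y t = g t" for t
    using c[of 0] c[of t] Y(2) by (simp add: g_def rot_def)
  moreover have "J ** C = C ** J"
    using comm_part_commute[of "Y1 0"] C[of 0] by simp
  ultimately show ?thesis
    using that[OF A] by (simp add: g_def)
qed

lemma jacobi_field_rot:
  assumes A: "A \<in> anti_sp"
  shows "jacobi_field J (\<lambda>t. (rot (2 * t) - mat 1) ** A)"
  unfolding jacobi_field_def
proof (intro exI allI conjI)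
  fix t
  have r: "rot (2 * t) ** A \<in> anti_sp" by (rule rot_anti[OF A])
  show "in_sp ((rot (2 * t) - mat 1) ** A)"
    using subspace_diff[OF subspace_anti_sp r A] by (simp add: matrix_distribs anti_sp_def)
  note rot2 = rot_scaled_has_derivative[of 2 t UNIV]
  have "((\<lambda>t. rot (2 * t) - mat 1) has_vector_derivative 2 *\<^sub>R (J ** rot (2 * t))) (at t)"
    using rot2 by (auto intro!: derivative_eq_intros)
  from bounded_linear.has_vector_derivative[OF matmul.bounded_linear_left this, of A]
  show "((\<lambda>t. (rot (2 * t) - mat 1) ** A) has_vector_derivative 2 *\<^sub>R (J ** (rot (2 * t) ** A))) (at t)"
    by (simp add: matrix_distribs flip: matrix_mul_assoc)
  from bounded_linear.has_vector_derivative[OF bounded_linear_compose[OF bounded_linear_scaleR_right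
        bounded_linear_compose[OF matmul.bounded_linear_right matmul.bounded_linear_left]] rot2, of 2 J A]
  show "((\<lambda>t. 2 *\<^sub>R (J ** (rot (2 * t) ** A))) has_vector_derivative - 4 *\<^sub>R (rot (2 * t) ** A)) (at t)"
    by (simp add: matrix_distribs cs_mult_cs flip: matrix_mul_assoc)
  show "- 4 *\<^sub>R (rot (2 * t) ** A) = J ** (2 *\<^sub>R (J ** (rot (2 * t) ** A))) - 2 *\<^sub>R (J ** (rot (2 * t) ** A)) ** J"
  proof -
    have "J ** (rot (2 * t) ** A) ** J = rot (2 * t) ** A"
      using anti_spD[OF cs_mult_anti_sp[OF r]] by (simp add: cs_mult_cs)
    then show ?thesis
      by (simp only: matmul.scaleR_left matmul.scaleR_right cs_mult_cs) (simp add: vec_eq_iff)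
  qed
qed

lemma rot_eq_id: "rot (2 * t) ** A = A \<longleftrightarrow> A = 0 \<or> (\<exists>k::int. t = real_of_int k * pi)"
proof
  assume "rot (2 * t) ** A = A"
  then have *: "(cos (2 * t) - 1) *\<^sub>R A + sin (2 * t) *\<^sub>R (J ** A) = 0"
    by (simp add: rot_def matrix_distribs scaleR_left_diff_distrib algebra_simps)
  \<comment> \<open>Multiplication by the complex conjugate of e^(2it) - 1, with \<open>J\<close> in
    the role of i, leaves the squared modulus times \<open>A\<close>.\<close>
  have "(cos (2 * t) - 1) *\<^sub>R ((cos (2 * t) - 1) *\<^sub>R A + sin (2 * t) *\<^sub>R (J ** A))
      - sin (2 * t) *\<^sub>R (J ** ((cos (2 * t) - 1) *\<^sub>R A + sin (2 * t) *\<^sub>R (J ** A)))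
      = ((cos (2 * t) - 1)\<^sup>2 + (sin (2 * t))\<^sup>2) *\<^sub>R A"
    by (simp add: matrix_distribs cs_mult_cs power2_eq_square scaleR_add_right scaleR_add_left
        scaleR_diff_right mult.commute)
  then have "((cos (2 * t) - 1)\<^sup>2 + (sin (2 * t))\<^sup>2) *\<^sub>R A = 0"
    unfolding * by simp
  then have "A = 0 \<or> cos (2 * t) = 1"
    by (auto simp: sum_power2_eq_zero_iff)
  then show "A = 0 \<or> (\<exists>k::int. t = real_of_int k * pi)"
    by (auto simp: cos_one_2pi_int)
next
  assume "A = 0 \<or> (\<exists>k::int. t = real_of_int k * pi)"
  then show "rot (2 * t) ** A = A"
  proof
    assume "\<exists>k::int. t = real_of_int k * pi"
    then obtain k :: int where k: "t = real_of_int k * pi" by blast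
    have "cos (2 * t) = 1" "sin (2 * t) = 0"
      using sin_int_2pin[of k] cos_int_2pin[of k] by (simp_all add: k mult_ac)
    then show ?thesis by (simp add: rot_def)
  qed simp
qed

text \<open>At \<open>T\<close> the linear term commutes with \<open>J\<close> and the rotating term
  anticommutes, so \<open>Y T = 0\<close> forces each to vanish.\<close>

lemma conj_fields_eq:
  assumes T: "0 < T"
  shows "conj_fields J T = {\<lambda>t. (rot (2 * t) - mat 1) ** A | A. A \<in> anti_sp \<and> rot (2 * T) ** A = A}"
proof (intro subset_antisym subsetI)
  fix Y assume "Y \<in> conj_fields J T"
  then have Y: "jacobi_field J Y" "Y 0 = 0" "Y T = 0" by (auto simp: conj_fields_def)
  obtain A C where A: "A \<in> anti_sp" and C: "J ** C = C ** J" and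
    eq: "\<And>t. Y t = t *\<^sub>R C + (rot (2 * t) - mat 1) ** A"
    using jacobi_field_form[OF Y(1,2)] by blast
  define R where "R = (rot (2 * T) - mat 1) ** A"
  have R: "R \<in> anti_sp"
    unfolding R_def matrix_distribs matrix_mul_lid by (intro subspace_diff[OF subspace_anti_sp] rot_anti A)
  have "anti_part C = 0"
    by (simp add: anti_part_def C cs_squared matrix_distribs flip: matrix_mul_assoc)
  then have "anti_part (Y T) = R"
    using bounded_linear.linear[OF bounded_linear_anti_part]
    by (simp add: eq linear_add linear_scale R_def[symmetric] anti_part_id[OF R])
  then have R0: "R = 0"
    using Y(3) by (simp add: anti_part_def)
  then have "C = 0" using Y(3) eq[of T] T by (simp add: R_def)
  then have "Y = (\<lambda>t. (rot (2 * t) - mat 1) ** A)" using eq by auto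
  moreover have "rot (2 * T) ** A = A" using R0 by (simp add: R_def matrix_distribs)
  ultimately show "Y \<in> {\<lambda>t. (rot (2 * t) - mat 1) ** A | A. A \<in> anti_sp \<and> rot (2 * T) ** A = A}"
    using A by blast
next
  fix Y assume "Y \<in> {\<lambda>t. (rot (2 * t) - mat 1) ** A | A. A \<in> anti_sp \<and> rot (2 * T) ** A = A}"
  then obtain A where A: "A \<in> anti_sp" "rot (2 * T) ** A = A" "Y = (\<lambda>t. (rot (2 * t) - mat 1) ** A)" by blast
  then show "Y \<in> conj_fields J T"
    using jacobi_field_rot[OF A(1)] by (simp add: conj_fields_def matrix_distribs) (simp add: rot_def)
qed

lemma rot_family_eq_0: "(\<lambda>t. (rot (2 * t) - mat 1) ** A) = 0 \<Longrightarrow> A = 0"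
proof -
  assume "(\<lambda>t. (rot (2 * t) - mat 1) ** A) = 0"
  \<comment> \<open>At time pi/2 the double-speed rotation is minus the identity, so the field takes
    the value -2 A.\<close>
  then have "(rot (2 * (pi / 2)) - mat 1) ** A = 0" by (simp only: fun_eq_iff zero_fun_def)
  moreover have "rot (2 * (pi / 2)) = - mat 1" by (simp add: rot_def)
  ultimately have "- A - A = 0" by (simp only: matrix_distribs matrix_mul_lid)
  then show "A = 0" by (simp add: vec_eq_iff)
qed

lemma conjugate_instant_iff:
  assumes T: "0 < T"
  shows "conjugate_instant J T \<longleftrightarrow> (\<exists>k::nat. T = real k * pi)"
proof
  assume "conjugate_instant J T"
  then obtain Y where Y: "Y \<in> conj_fields J T" "Y \<noteq> 0" by (auto simp: conjugate_instant_def)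
  then obtain A where A: "rot (2 * T) ** A = A" "Y = (\<lambda>t. (rot (2 * t) - mat 1) ** A)"
    unfolding conj_fields_eq[OF T] by blast
  have "A \<noteq> 0"
    using A(2) Y(2) by (auto simp: fun_eq_iff)
  then obtain k :: int where k: "T = real_of_int k * pi"
    using A(1) rot_eq_id by blast
  then have "0 < k" using T by (simp add: zero_less_mult_iff)
  then show "\<exists>k::nat. T = real k * pi"
    using k by (intro exI[of _ "nat k"]) simp
next
  assume "\<exists>k::nat. T = real k * pi"
  then obtain k :: nat where k: "T = real_of_int (int k) * pi" by auto
  have "anti_sp \<noteq> {0}"
    using dim_anti_sp dim_eq_0[of anti_sp] by auto
  then obtain A where A: "A \<in> anti_sp" "A \<noteq> 0"
    using subspace_0[OF subspace_anti_sp] by blast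
  have "rot (2 * T) ** A = A" using k rot_eq_id by blast
  then have "(\<lambda>t. (rot (2 * t) - mat 1) ** A) \<in> conj_fields J T"
    unfolding conj_fields_eq[OF T] using A(1) by blast
  then show "conjugate_instant J T"
    unfolding conjugate_instant_def using T A(2) rot_family_eq_0 by blast
qed

text \<open>At multiples of pi the rotation \<open>rot (2 * T)\<close> is the identity, so every
  \<open>A\<close> in \<open>anti_sp\<close> gives a field vanishing at \<open>T\<close>, and
  distinct \<open>A\<close> give distinct fields.\<close>

lemma conj_multiplicity_eq:
  assumes T: "0 < T" and c: "conjugate_instant J T"
  shows "conj_multiplicity J T = CARD('n)\<^sup>2 + CARD('n)"
proof -
  define E :: "unit \<Rightarrow> 'n pmat \<Rightarrow> real \<Rightarrow> 'n pmat" where "E k A = (\<lambda>t. (rot (2 * t) - mat 1) ** A)" for k A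
  have lin: "Vector_Spaces.linear scaleR fscale (E k)" for k
    by (rule fscale_linearI) (auto simp: E_def matrix_distribs scaleR_diff_right intro!: linearI)
  obtain k :: nat where k: "T = real_of_int (int k) * pi"
    using c unfolding conjugate_instant_iff[OF T] by auto
  have rotA: "rot (2 * T) ** A = A" for A
    using k rot_eq_id by blast
  obtain W where W: "card W = card {()} * dim anti_sp" "fs.independent W"
    "fs.span W = {\<Sum>i\<in>{()}. E i (F i) | F. \<forall>i\<in>{()}. F i \<in> anti_sp}"
  proof (rule curve_family_basis[where P = "{()}" and V = anti_sp and E = E])
    show "F j = 0" if "(\<Sum>i\<in>{()}. E i (F i)) = 0" for F j
      using that rot_family_eq_0[of "F ()"] by (simp add: E_def)
  qed (use subspace_anti_sp lin in auto)
  have "fs.span W = conj_fields J T"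
    unfolding W(3) conj_fields_eq[OF T] rotA by (auto simp: E_def)
  then have "conj_multiplicity J T = card W"
    unfolding conj_multiplicity_def using fs.dim_span_eq_card_independent[OF W(2)] by simp
  then show ?thesis using W(1) by (simp add: dim_anti_sp)
qed

end

theorem theorem1:
  fixes J :: "'n::finite pmat"
  assumes "compatible_cs J"
  shows "(\<forall>T>0. conjugate_instant J T \<longleftrightarrow> (\<exists>k::nat. T = real k * pi))
    \<and> (\<forall>T>0. conjugate_instant J T \<longrightarrow> conj_multiplicity J T = CARD('n)^2 + CARD('n))
    \<and> (\<forall>T>0. finite {t. 0 < t \<and> t < T \<and> conjugate_instant J t}
        \<and> (\<exists>c\<in>coindex_dims J T. (\<forall>d\<in>coindex_dims J T. d \<le> c)
           \<and> c = (\<Sum>t\<in>{t. 0 < t \<and> t < T \<and> conjugate_instant J t}. conj_multiplicity J t)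
           \<and> int c = (\<lceil>T / pi\<rceil> - 1) * int (CARD('n)^2 + CARD('n))))"
proof -
  interpret compatible J by unfold_locales (rule assms)
  have index: "finite {t. 0 < t \<and> t < T \<and> conjugate_instant J t}
        \<and> (\<exists>c\<in>coindex_dims J T. (\<forall>d\<in>coindex_dims J T. d \<le> c)
           \<and> c = (\<Sum>t\<in>{t. 0 < t \<and> t < T \<and> conjugate_instant J t}. conj_multiplicity J t)
           \<and> int c = (\<lceil>T / pi\<rceil> - 1) * int (CARD('n)^2 + CARD('n)))" if T: "0 < T" for T
  proof -
    \<comment> \<open>Both bounds meet at this \<open>N\<close>: it is the least number of equal
      intervals of length at most pi, and \<open>N - 1\<close> is the largest \<open>k\<close> with
      k pi strictly below \<open>T\<close>. If \<open>T\<close> is itself a multiple of pi, the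
      instant \<open>T\<close> is not counted.\<close>
    define N where "N = nat \<lceil>T / pi\<rceil>"
    have ceil: "0 < \<lceil>T / pi\<rceil>" using T by simp
    have N: "0 < N" "int N = \<lceil>T / pi\<rceil>" using ceil by (simp_all add: N_def)
    have "T / pi \<le> real N"
      using N(2) by (metis le_of_int_ceiling of_int_of_nat_eq)
    then have TN: "T / real N \<le> pi"
      using N(1) by (simp add: field_simps)
    have "real_of_int \<lceil>T / pi\<rceil> - 1 < T / pi" by linarith
    moreover have "real_of_int \<lceil>T / pi\<rceil> = real N"
      unfolding N(2)[symmetric] by simp
    moreover have "real (N - 1) = real N - 1"
      using N(1) by (simp add: of_nat_diff)
    ultimately have "real (N - 1) < T / pi" by simp
    then have KT: "real (N - 1) * pi < T"
      by (simp add: field_simps)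
    have less: "real k * pi < T \<longleftrightarrow> k < N" for k :: nat
    proof -
      have "real k * pi < T \<longleftrightarrow> real_of_int (int k) < T / pi" by (simp add: field_simps)
      also have "\<dots> \<longleftrightarrow> int k < \<lceil>T / pi\<rceil>" by (rule less_ceiling_iff[symmetric])
      finally show ?thesis unfolding N(2)[symmetric] by simp
    qed
    have inst: "{t. 0 < t \<and> t < T \<and> conjugate_instant J t} = (\<lambda>k. real k * pi) ` {0<..<N}"
      using conjugate_instant_iff by (auto simp: less zero_less_mult_iff)
    have inj: "inj_on (\<lambda>k. real k * pi) {0<..<N}" by (auto simp: inj_on_def)
    have "(\<Sum>t\<in>{t. 0 < t \<and> t < T \<and> conjugate_instant J t}. conj_multiplicity J t)
        = (\<Sum>t\<in>{t. 0 < t \<and> t < T \<and> conjugate_instant J t}. CARD('n)\<^sup>2 + CARD('n))"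
      by (intro sum.cong refl) (simp add: conj_multiplicity_eq)
    also have "\<dots> = (N - 1) * (CARD('n)\<^sup>2 + CARD('n))"
      unfolding inst by (simp add: card_image[OF inj])
    finally have sum: "(\<Sum>t\<in>{t. 0 < t \<and> t < T \<and> conjugate_instant J t}. conj_multiplicity J t)
        = (N - 1) * (CARD('n)\<^sup>2 + CARD('n))" .
    have int: "int ((N - 1) * (CARD('n)\<^sup>2 + CARD('n))) = (\<lceil>T / pi\<rceil> - 1) * int (CARD('n)\<^sup>2 + CARD('n))"
      unfolding N(2)[symmetric] using N(1) by (simp add: of_nat_diff)
    have fin: "finite {t. 0 < t \<and> t < T \<and> conjugate_instant J t}"
      unfolding inst by simp
    show ?thesis
      using fin coindex_dims_attained[OF T KT] coindex_dims_le[OF T N(1) TN] sum int by auto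
  qed
  show ?thesis
    using conjugate_instant_iff conj_multiplicity_eq index by blast
qed

end
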